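(* Let $\Lambda$ be an admissible sequence and let $k\ge1$ be an integer. For $n\in\mathbb{N}$ let $\alpha=\alpha(n)>0$ be the solution of $n=\sum_{\lambda\in\Lambda}\frac{\lambda}{e^{\alpha\lambda}-1}$. Then, as $n\to\infty$: (i) If $\mu_0>1$, then $$t_\Lambda^k(n)=t_\Lambda^0(n)\cdot\alpha^{-\mu_0k}A_{-\mu_0}^k[\zeta_R(\mu_0)]^k\,[1+o(1)].$$ (ii) If $\mu_0=1$, then $$t_\Lambda^k(n)=t_\Lambda^0(n)\cdot\alpha^{-k}\,Y_k\Bigl(\mathrm{FP}_{t=1}\zeta_\Lambda(t)-A_{-1}\log\alpha,\ \zeta_\Lambda(2),\ 2\zeta_\Lambda(3),\ \ldots,\ (k-1)!\,\zeta_\Lambda(k)\Bigr)[1+o(1)].$$ (iii) If $\mu_0<1$, then $$t_\Lambda^k(n)=t_\Lambda^0(n)\cdot\alpha^{-k}\,Y_k\bigl(\zeta_\Lambda(1),\ \zeta_\Lambda(2),\ 2\zeta_\Lambda(3),\ \ldots,\ (k-1)!\,\zeta_\Lambda(k)\bigr)[1+o(1)].$$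
   Context: A sequence $\Lambda$ is called admissible if it is a nondecreasing sequence of positive integers (the same integer may occur finitely many times; all sums and products over $\lambda\in\Lambda$ count multiplicity) such that: (i) $1\in\Lambda$; (ii) $\Theta(t)=\sum_{\lambda\in\Lambda}e^{-\lambda t}$ converges for all $t>0$; (iii) as $t\to0^+$, $\Theta$ admits a full asymptotic expansion $\Theta(t)\sim\sum_{n\ge0}A_{i_n}t^{i_n}$ with real exponents $i_0<i_1<i_2<\cdots$, $i_n\to\infty$, $i_0<0$ and $A_{i_0}\neq0$. Thus $A_x$ is the coefficient of $t^x$ in the expansion. Write $\mu_0=-i_0$. Let $\zeta_\Lambda(s)=\sum_{\lambda\in\Lambda}\lambda^{-s}$ for $\Re s>\mu_0$, also denoting its meromorphic continuation to $\mathbb{C}$; $\mathrm{FP}_{t=1}\zeta_\Lambda(t)$ is the constant term of the Laurent expansion of $\zeta_\Lambda(t)$ about $t=1$. $\zeta_R$ is the Riemann zeta-function. Let $p_\Lambda(n,m)$ be the number of partitions of $n$ into $m$ summands from $\Lambda$, where repetition of summands is allowed and equal integers occupying different positions of $\Lambda$ are regarded as different; that is, $\prod_{\lambda\in\Lambda}(1-zx^\lambda)^{-1}=\sum_{n,m\ge0}p_\Lambda(n,m)x^nz^m$. For $n\ge1$ and $k\ge0$ the $k$-th moment is $t_\Lambda^k(n)=\sum_{m\ge0}m^kp_\Lambda(n,m)$ (the $k$ in $t_\Lambda^k$ is an index, not a power; $t_\Lambda^0(n)=\sum_m p_\Lambda(n,m)$). For $k\ge1$, $$Y_k(x_1,\ldots,x_k)=\sum\frac{k!}{b_1!b_2!\cdots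 b_k!}\left(\frac{x_1}{1!}\right)^{b_1}\left(\frac{x_2}{2!}\right)^{b_2}\cdots\left(\frac{x_k}{k!}\right)^{b_k},$$ the sum being over all $b_1,\ldots,b_k\in\mathbb{N}_0$ with $b_1+2b_2+\cdots+kb_k=k$. *)

theory Defs
  imports "HOL-Complex_Analysis.Complex_Analysis" "HOL-Library.Landau_Symbols"
    "HOL-Library.Multiset" "HOL-Library.FuncSet"
begin

definition Theta :: "(nat \<Rightarrow> nat) \<Rightarrow> real \<Rightarrow> real" where
  "Theta \<Lambda> t = (\<Sum>j. exp (- real (\<Lambda> j) * t))"

text \<open>Full asymptotic expansion of \<open>f\<close> at \<open>0\<^sup>+\<close> in the sense of Poincare, with exponents
  \<open>i 0 < i 1 < \<dots>\<close> tending to infinity; \<open>A x\<close> is the coefficient of \<open>t\<close> to the power \<open>x\<close>, and only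
  its values at the exponents matter.\<close>

definition asymp_expansion_at_0 ::
  "(real \<Rightarrow> real) \<Rightarrow> (nat \<Rightarrow> real) \<Rightarrow> (real \<Rightarrow> real) \<Rightarrow> bool" where
  "asymp_expansion_at_0 f i A \<longleftrightarrow>
     strict_mono i \<and> filterlim i at_top sequentially \<and>
     (\<forall>N. (\<lambda>t. f t - (\<Sum>n\<le>N. A (i n) * t powr i n)) \<in> o[at_right 0](\<lambda>t. t powr i N))"

text \<open>The sequence is indexed by all of \<^typ>\<open>nat\<close>: a finite one would have a bounded
  \<^const>\<open>Theta\<close>, contradicting \<open>i 0 < 0\<close> and \<open>A (i 0) \<noteq> 0\<close>.\<close>

definition admissible :: "(nat \<Rightarrow> nat) \<Rightarrow> (nat \<Rightarrow> real) \<Rightarrow> (real \<Rightarrow> real) \<Rightarrow> bool" where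
  "admissible \<Lambda> i A \<longleftrightarrow>
     mono \<Lambda> \<and> (\<forall>j. \<Lambda> j > 0) \<and> (\<forall>m. finite {j. \<Lambda> j = m}) \<and>
     1 \<in> range \<Lambda> \<and>
     (\<forall>t>0. summable (\<lambda>j. exp (- real (\<Lambda> j) * t))) \<and>
     asymp_expansion_at_0 (Theta \<Lambda>) i A \<and> i 0 < 0 \<and> A (i 0) \<noteq> 0"

text \<open>The meromorphic continuation to the whole plane of the Dirichlet series of \<open>\<Lambda>\<close>. By the
  identity theorem it does not depend on the half-plane on which it is compared with the series;
  \<^const>\<open>nicely_meromorphic_on\<close> (removable singularities removed, value \<open>0\<close> at poles) makes it
  unique as a total function.\<close>

definition zeta :: "(nat \<Rightarrow> nat) \<Rightarrow> complex \<Rightarrow> complex" where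
  "zeta \<Lambda> = (THE f. f nicely_meromorphic_on UNIV \<and>
     (\<exists>c. \<forall>s. Re s > c \<longrightarrow> (\<lambda>j. of_nat (\<Lambda> j) powr (- s)) sums f s))"

text \<open>The Riemann zeta function belongs to the sequence \<open>1, 2, 3, \<dots>\<close>.\<close>

definition riemann_zeta :: "complex \<Rightarrow> complex" where
  "riemann_zeta = zeta Suc"

definition finite_part :: "(complex \<Rightarrow> complex) \<Rightarrow> complex \<Rightarrow> complex" where
  "finite_part f z = fls_nth (laurent_expansion f z) 0"

text \<open>A partition is a multiset of positions of \<open>\<Lambda>\<close>, so that equal integers at different
  positions are distinguished.\<close>

definition num_partitions :: "(nat \<Rightarrow> nat) \<Rightarrow> nat \<Rightarrow> nat \<Rightarrow> nat" where
  "num_partitions \<Lambda> n m = card {M :: nat multiset. size M = m \<and> (\<Sum>j\<in>#M. \<Lambda> j) = n}"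

definition moment :: "(nat \<Rightarrow> nat) \<Rightarrow> nat \<Rightarrow> nat \<Rightarrow> real" where
  "moment \<Lambda> k n = (\<Sum>m. real m ^ k * real (num_partitions \<Lambda> n m))"

text \<open>The solution \<open>\<alpha>(n)\<close> of the saddle point equation; it exists and is unique for \<open>n > 0\<close>.\<close>

definition saddle :: "(nat \<Rightarrow> nat) \<Rightarrow> nat \<Rightarrow> real" where
  "saddle \<Lambda> n = (THE \<alpha>. \<alpha> > 0 \<and>
     (\<lambda>j. real (\<Lambda> j) / (exp (\<alpha> * real (\<Lambda> j)) - 1)) sums real n)"

definition bell_Y :: "nat \<Rightarrow> (nat \<Rightarrow> complex) \<Rightarrow> complex" where
  "bell_Y k x = (\<Sum>b | b \<in> {1..k} \<rightarrow>\<^sub>E (UNIV :: nat set) \<and> (\<Sum>j=1..k. j * b j) = k.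
     fact k / (\<Prod>j=1..k. fact (b j)) * (\<Prod>j=1..k. (x j / fact j) ^ b j))"

end

theory Submission
  imports Defs "HOL-Real_Asymp.Real_Asymp" "HOL-Probability.Probability"
begin

text \<open>
  Put \<open>x = e\<^sup>-\<^sup>t\<close>. Since \<open>log (\<Prod> 1 / (1 - z x\<^sup>\<lambda>)) = \<Sum>\<^sub>r z\<^sup>r \<Theta>(r t) / r\<close>, the generating function of the
  \<open>k\<close>-th moments is \<open>T\<^sub>k = T\<^sub>0 G\<^sub>k\<close>, where \<open>log T\<^sub>0 = \<Sum>\<^sub>r \<Theta>(r t) / r\<close> and \<open>G\<^sub>k\<close> is the complete Bell
  polynomial in the functions \<open>\<kappa>\<^sub>p(t) = \<Sum>\<^sub>r r\<^sup>p \<Theta>(r t)\<close>, \<open>p = 0, \<dots>, k - 1\<close>.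

  At the saddle point \<open>\<alpha>(n)\<close> the tilted moments \<open>t\<^sup>k(m) e\<^sup>-\<^sup>\<alpha>\<^sup>m / T\<^sub>k\<close>, as distributions in \<open>m\<close>, have for
  every \<open>k\<close> the same local limit at \<open>n\<close>, because \<open>G\<^sub>k\<close> varies slowly; so
  \<open>t\<^sup>k(n) \<sim> t\<^sup>0(n) G\<^sub>k(\<alpha>)\<close>. Vitali's theorem carries the first-order asymptotics of \<open>log T\<^sub>0\<close> from the
  real axis to the right half-plane and so controls the characteristic functions on windows of length
  proportional to \<open>\<alpha>\<close>. Nothing is known about them outside such windows; instead, \<open>1 \<in> \<Lambda>\<close> makes the
  moments nondecreasing in \<open>n\<close>, and a Tauberian argument with the Fejer kernel applies.

  Finally \<open>t \<Sum>\<^sub>r f(r t)\<close> is a Riemann sum, so \<open>t\<^sup>p\<^sup>+\<^sup>1 \<kappa>\<^sub>p(t)\<close> tends to the Mellin transform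
  \<open>\<Gamma>(p + 1) \<zeta>\<^sub>\<Lambda>(p + 1)\<close> of \<open>\<Theta>\<close> when this converges. At \<open>p = 0\<close>, if \<open>\<mu>\<^sub>0 = 1\<close>, subtracting
  \<open>A e\<^sup>-\<^sup>u / u\<close> leaves the finite part and the logarithm; if \<open>\<mu>\<^sub>0 > 1\<close>, the leading term of \<open>\<Theta>\<close> alone gives
  \<open>A \<zeta>\<^sub>R(\<mu>\<^sub>0)\<close>, and this dominates all other arguments of the Bell polynomial.
\<close>

section \<open>Moments and their generating functions\<close>

text \<open>The tilting uses the saddle point of \<open>T\<^sub>0\<close> for every k, although
  \<open>T\<^sub>k\<close> has its own. This is harmless: the factor \<open>G\<^sub>k\<close> shifts
  the mean by an amount of order 1/\<alpha>, while the standard deviation has the larger order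
  1/\<alpha> times \<alpha> to the power -\<mu>/2, where \<mu> = -\<open>i 0\<close>. Accordingly
  the only property of \<open>G\<^sub>k\<close> that the limit theorem asks for is a doubling bound
  of \<open>G\<^sub>k(t / 2)\<close> by a multiple of \<open>G\<^sub>k(t)\<close>. No moment is ever
  estimated by itself. Two families with the same lattice width and the same Gaussian limit are
  compared, so that kernel sums and Gaussian constants cancel. This suits the obstacle that an
  admissible sequence may have arithmetic structure: for 1, 2, 4, 6, ... the value of
  \<open>T\<^sub>0\<close> at -x falls short of the one at x only by a factor of order \<alpha>, so
  inversion over the whole circle has no general exponential bound to rest on. The local limit
  theorem uses the leading term of \<open>Theta\<close> only. The second term enters when it equals
  1, and the full expansion serves the continuation of the Dirichlet series.\<close>

locale part_seq =
  fixes \<Lambda> :: "nat \<Rightarrow> nat"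
  assumes pos: "\<Lambda> j > 0"
    and fin: "finite {j. \<Lambda> j = m}"
begin

definition parts :: "nat \<Rightarrow> nat multiset set" where
  "parts n = {M. (\<Sum>j\<in>#M. \<Lambda> j) = n}"

definition reps :: "nat \<Rightarrow> (nat \<times> nat) set" where
  "reps n = {(j, r). r \<ge> 1 \<and> r * \<Lambda> j = n}"

text \<open>The coefficient of \<open>x\<^sup>n\<close> in \<open>\<Sum>\<^sub>j \<Sum>\<^sub>r c j r x\<^bsup>r \<Lambda> j\<^esup>\<close>.\<close>

definition dsum :: "(nat \<Rightarrow> nat \<Rightarrow> real) \<Rightarrow> nat \<Rightarrow> real" where
  "dsum c n = (\<Sum>(j, r)\<in>reps n. c j r)"

lemma finite_le: "finite {j. \<Lambda> j \<le> n}"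
proof -
  have "{j. \<Lambda> j \<le> n} = (\<Union>m\<le>n. {j. \<Lambda> j = m})" by auto
  then show ?thesis using fin by auto
qed

lemma size_le_weight: "size M \<le> (\<Sum>j\<in>#M. \<Lambda> j)"
proof (induction M)
  case (add x M)
  then show ?case using pos[of x] by simp
qed simp

lemma weight_ge_elem: "j \<in># M \<Longrightarrow> \<Lambda> j \<le> (\<Sum>j\<in>#M. \<Lambda> j)"
  by (induction M) auto

lemma finite_parts [simp]: "finite (parts n)"
proof (rule finite_subset)
  show "parts n \<subseteq> mset ` {xs. set xs \<subseteq> {j. \<Lambda> j \<le> n} \<and> length xs \<le> n}"
  proof
    fix M assume M: "M \<in> parts n"
    obtain xs where xs: "M = mset xs" by (metis ex_mset)
    have "length xs \<le> n" using size_le_weight[of M] M xs by (simp add: parts_def)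
    moreover have "set xs \<subseteq> {j. \<Lambda> j \<le> n}" using weight_ge_elem[of _ M] M xs by (auto simp: parts_def)
    ultimately show "M \<in> mset ` {xs. set xs \<subseteq> {j. \<Lambda> j \<le> n} \<and> length xs \<le> n}" using xs by auto
  qed
  show "finite (mset ` {xs. set xs \<subseteq> {j. \<Lambda> j \<le> n} \<and> length xs \<le> n})"
    by (intro finite_imageI finite_lists_length_le finite_le)
qed

lemma reps_subset: "reps n \<subseteq> {j. \<Lambda> j \<le> n} \<times> {1..n}"
proof
  fix p assume "p \<in> reps n"
  then obtain j r where p: "p = (j, r)" "r \<ge> 1" "r * \<Lambda> j = n" by (auto simp: reps_def)
  have "r * 1 \<le> r * \<Lambda> j" using pos[of j] by (intro mult_left_mono) auto
  moreover have "1 * \<Lambda> j \<le> r * \<Lambda> j" using p by (intro mult_right_mono) auto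
  ultimately show "p \<in> {j. \<Lambda> j \<le> n} \<times> {1..n}" using p by auto
qed

lemma finite_reps [simp]: "finite (reps n)"
  by (rule finite_subset[OF reps_subset]) (auto intro: finite_le)

lemma moment_eq: "moment \<Lambda> k n = (\<Sum>M\<in>parts n. real (size M) ^ k)"
proof -
  have eq: "{M. size M = m \<and> (\<Sum>j\<in>#M. \<Lambda> j) = n} = {M\<in>parts n. size M = m}" for m
    by (auto simp: parts_def)
  have "num_partitions \<Lambda> n m = 0" if "m \<notin> {..n}" for m
  proof -
    have "{M\<in>parts n. size M = m} = {}" using that size_le_weight by (fastforce simp: parts_def)
    then show ?thesis unfolding num_partitions_def eq by simp
  qed
  then have "moment \<Lambda> k n = (\<Sum>m\<in>{..n}. real m ^ k * real (num_partitions \<Lambda> n m))"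
    unfolding moment_def by (intro suminf_finite) auto
  also have "\<dots> = (\<Sum>m\<in>{..n}. \<Sum>M | M \<in> parts n \<and> size M = m. real (size M) ^ k)"
    unfolding num_partitions_def eq by (intro sum.cong) auto
  also have "\<dots> = (\<Sum>M\<in>parts n. real (size M) ^ k)"
  proof (rule sum.group)
    show "size ` parts n \<subseteq> {..n}" using size_le_weight by (auto simp: parts_def)
  qed auto
  finally show ?thesis .
qed

lemma sum_mset_count: "(\<Sum>j\<in>#M. c j) = (\<Sum>j\<in>set_mset M. real (count M j) * c j)"
proof -
  have "(\<Sum>j\<in>#M. c j) = (\<Sum>j\<in>A. real (count M j) * c j)" if "finite A" "set_mset M \<subseteq> A" for A
    using that(2)
  proof (induction M)
    case (add x M)
    have "(\<Sum>j\<in>A. real (count (add_mset x M) j) * c j) =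
          (\<Sum>j\<in>A. real (count M j) * c j) + (\<Sum>j\<in>A. if j = x then c j else 0)"
      unfolding sum.distrib[symmetric]
    proof (rule sum.cong[OF refl])
      fix j
      show "real (count (add_mset x M) j) * c j = real (count M j) * c j + (if j = x then c j else 0)"
        by (cases "j = x") (simp_all add: distrib_right)
    qed
    also have "(\<Sum>j\<in>A. if j = x then c j else 0) = c x" using add that(1) by simp
    finally show ?case using add by simp
  qed simp
  from this[of "set_mset M"] show ?thesis by blast
qed

lemma sum_mset_one: "(\<Sum>j\<in>#M. 1) = real (size M)"
  by (induction M) auto

lemma weight_remove_rep:
  assumes "r \<le> count M j"
  shows "(\<Sum>j\<in>#M. \<Lambda> j) = (\<Sum>j\<in>#M - replicate_mset r j. \<Lambda> j) + r * \<Lambda> j"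
proof -
  have "M = (M - replicate_mset r j) + replicate_mset r j"
    using assms by (simp add: count_le_replicate_mset_subset_eq)
  from arg_cong[OF this, of "\<lambda>M. \<Sum>j\<in>#M. \<Lambda> j"] show ?thesis
    by (simp only: image_mset_union image_replicate_mset sum_mset.union sum_mset_replicate_mset of_nat_id)
qed

lemma sum_remove_rep:
  assumes "r * \<Lambda> j \<le> n"
  shows "(\<Sum>M | M \<in> parts n \<and> r \<le> count M j. f M) =
         (\<Sum>M\<in>parts (n - r * \<Lambda> j). f (M + replicate_mset r j) :: real)"
  using assms weight_remove_rep
    by (intro sum.reindex_bij_witness[of _ "\<lambda>M. M + replicate_mset r j" "\<lambda>M. M - replicate_mset r j"])
       (auto simp: parts_def count_le_replicate_mset_subset_eq)

text \<open>Double counting: \<open>count M j\<close> is the number of r \<ge> 1 with r \<le>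
  \<open>count M j\<close>, and deleting r copies of j is a bijection from the partitions of n with
  at least r copies onto all partitions of n - r \<open>\<Lambda> j\<close>. It is the combinatorial
  form of the logarithmic derivative of the generating product.\<close>

lemma sum_parts_elem:
  fixes f :: "nat multiset \<Rightarrow> real"
  shows "(\<Sum>M\<in>parts n. f M * (\<Sum>j\<in>#M. c j)) =
    (\<Sum>m\<le>n. \<Sum>(j,r)\<in>reps m. c j * (\<Sum>M\<in>parts (n - m). f (M + replicate_mset r j)))"
proof -
  let ?Q = "{j. \<Lambda> j \<le> n} \<times> {1..n}"
  have finQ: "finite ?Q" by (auto intro: finite_le)
  have cnt: "(\<Sum>j\<in>#M. c j) = (\<Sum>(j,r)\<in>?Q. if r \<le> count M j then c j else 0)" if M: "M \<in> parts n" for M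
  proof -
    have "(\<Sum>(j,r)\<in>?Q. if r \<le> count M j then c j else 0) =
      (\<Sum>j | \<Lambda> j \<le> n. \<Sum>r\<in>{1..n}. if r \<le> count M j then c j else 0)"
      by (simp add: sum.cartesian_product)
    also have "\<dots> = (\<Sum>j | \<Lambda> j \<le> n. real (count M j) * c j)"
    proof (rule sum.cong[OF refl])
      fix j
      have "count M j \<le> n" using size_le_weight[of M] M count_le_size[of M j]
        by (simp add: parts_def)
      then have "{r\<in>{1..n}. r \<le> count M j} = {1..count M j}" by auto
      then show "(\<Sum>r\<in>{1..n}. if r \<le> count M j then c j else 0) = real (count M j) * c j"
        by (simp add: sum.inter_filter[symmetric])
    qed
    also have "\<dots> = (\<Sum>j\<in>set_mset M. real (count M j) * c j)"
      using weight_ge_elem[of _ M] M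
      by (intro sum.mono_neutral_right finite_le) (auto simp: parts_def count_eq_zero_iff)
    also have "\<dots> = (\<Sum>j\<in>#M. c j)"
      by (rule sum_mset_count[symmetric])
    finally show ?thesis by simp
  qed
  have "(\<Sum>M\<in>parts n. f M * (\<Sum>j\<in>#M. c j)) =
        (\<Sum>M\<in>parts n. \<Sum>(j,r)\<in>?Q. if r \<le> count M j then c j * f M else 0)"
    by (intro sum.cong refl) (auto simp: cnt sum_distrib_left intro!: sum.cong)
  also have "\<dots> = (\<Sum>(j,r)\<in>?Q. \<Sum>M\<in>parts n. if r \<le> count M j then c j * f M else 0)"
    by (subst sum.swap) (simp add: case_prod_unfold)
  also have "\<dots> = (\<Sum>(j,r)\<in>?Q. c j * (\<Sum>M | M \<in> parts n \<and> r \<le> count M j. f M))"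
    by (intro sum.cong refl) (auto simp: sum_distrib_left sum.inter_filter intro!: sum.cong)
  also have "\<dots> = (\<Sum>(j,r)\<in>(\<Union>m\<le>n. reps m). c j * (\<Sum>M | M \<in> parts n \<and> r \<le> count M j. f M))"
  proof (rule sum.mono_neutral_right)
    show "(\<Union>m\<le>n. reps m) \<subseteq> ?Q" using reps_subset by fastforce
    show "\<forall>i\<in>?Q - (\<Union>m\<le>n. reps m). (case i of (j, r) \<Rightarrow> c j * (\<Sum>M | M \<in> parts n \<and> r \<le> count M j. f M)) = 0"
    proof safe
      fix j r assume jr: "(j, r) \<notin> (\<Union>m\<le>n. reps m)" "r \<in> {1..n}"
      then have "\<not> r * \<Lambda> j \<le> n" by (auto simp: reps_def)
      moreover have "r * \<Lambda> j \<le> n" if M: "M \<in> parts n" "r \<le> count M j" for M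
        using weight_remove_rep[OF M(2)] M(1) by (simp add: parts_def)
      ultimately have *: "{M \<in> parts n. r \<le> count M j} = {}" by auto
      show "c j * (\<Sum>M | M \<in> parts n \<and> r \<le> count M j. f M) = 0" unfolding * by simp
    qed
  qed (rule finQ)
  also have "\<dots> = (\<Sum>m\<le>n. \<Sum>(j,r)\<in>reps m. c j * (\<Sum>M | M \<in> parts n \<and> r \<le> count M j. f M))"
    by (rule sum.UNION_disjoint) (simp_all, auto simp: reps_def)
  also have "\<dots> = (\<Sum>m\<le>n. \<Sum>(j,r)\<in>reps m. c j * (\<Sum>M\<in>parts (n - m). f (M + replicate_mset r j)))"
    by (intro sum.cong refl) (auto simp: reps_def sum_remove_rep)
  finally show ?thesis .
qed

text \<open>One factor of the (k+1)-st power of the size is written as a sum of ones over the parts.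
  Reinserting r deleted copies turns the remaining power into the k-th power of r + size, which the
  binomial theorem splits. The result is the recursion between moments and cumulants, read off
  coefficientwise.\<close>

lemma moment_Suc:
  "moment \<Lambda> (Suc k) n =
    (\<Sum>i\<le>k. real (k choose i) * (\<Sum>m\<le>n. dsum (\<lambda>j r. real r ^ i) m * moment \<Lambda> (k - i) (n - m)))"
proof -
  have "moment \<Lambda> (Suc k) n = (\<Sum>M\<in>parts n. real (size M) ^ k * (\<Sum>j\<in>#M. 1))"
    unfolding moment_eq by (intro sum.cong refl) (simp only: sum_mset_one power_Suc2)
  also have "\<dots> = (\<Sum>m\<le>n. \<Sum>(j,r)\<in>reps m. \<Sum>M\<in>parts (n - m). (real r + real (size M)) ^ k)"
    unfolding sum_parts_elem size_union size_replicate_mset of_nat_add mult_1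
    by (simp only: add.commute[of "real (size _)"])
  also have "\<dots> = (\<Sum>m\<le>n. \<Sum>(j,r)\<in>reps m. \<Sum>i\<le>k. real (k choose i) * (real r ^ i * moment \<Lambda> (k - i) (n - m)))"
  proof (intro sum.cong refl, clarify)
    fix m j r
    show "(\<Sum>M\<in>parts (n - m). (real r + real (size M)) ^ k) =
       (\<Sum>i\<le>k. real (k choose i) * (real r ^ i * moment \<Lambda> (k - i) (n - m)))"
      unfolding moment_eq binomial_ring sum_distrib_left by (subst sum.swap) (simp add: mult.assoc)
  qed
  also have "\<dots> = (\<Sum>m\<le>n. \<Sum>i\<le>k. real (k choose i) * (dsum (\<lambda>j r. real r ^ i) m * moment \<Lambda> (k - i) (n - m)))"
  proof (rule sum.cong[OF refl])
    fix m
    show "(\<Sum>(j,r)\<in>reps m. \<Sum>i\<le>k. real (k choose i) * (real r ^ i * moment \<Lambda> (k - i) (n - m))) =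
      (\<Sum>i\<le>k. real (k choose i) * (dsum (\<lambda>j r. real r ^ i) m * moment \<Lambda> (k - i) (n - m)))"
      unfolding dsum_def sum_distrib_left sum_distrib_right case_prod_unfold by (rule sum.swap)
  qed
  also have "\<dots> = (\<Sum>i\<le>k. real (k choose i) * (\<Sum>m\<le>n. dsum (\<lambda>j r. real r ^ i) m * moment \<Lambda> (k - i) (n - m)))"
    unfolding sum_distrib_left by (rule sum.swap)
  finally show ?thesis .
qed

text \<open>The same double counting with the weight of a part in place of 1. In generating
  functions it is the equation x F' = S F for F = \<open>T\<^sub>0\<close>.\<close>

lemma moment_0_weight:
  "real n * moment \<Lambda> 0 n = (\<Sum>m\<le>n. dsum (\<lambda>j r. real (\<Lambda> j)) m * moment \<Lambda> 0 (n - m))"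
proof -
  have "real n * moment \<Lambda> 0 n = (\<Sum>M\<in>parts n. 1 * (\<Sum>j\<in>#M. real (\<Lambda> j)))"
    unfolding moment_eq sum_distrib_left
  proof (intro sum.cong refl)
    fix M assume "M \<in> parts n"
    then have "real n = real (\<Sum>j\<in>#M. \<Lambda> j)" by (simp add: parts_def)
    also have "\<dots> = (\<Sum>j\<in>#M. real (\<Lambda> j))" by (induction M) auto
    finally show "real n * real (size M) ^ 0 = 1 * (\<Sum>j\<in>#M. real (\<Lambda> j))" by simp
  qed
  also have "\<dots> = (\<Sum>m\<le>n. dsum (\<lambda>j r. real (\<Lambda> j)) m * moment \<Lambda> 0 (n - m))"
    unfolding sum_parts_elem moment_eq dsum_def sum_distrib_right case_prod_unfold power_0 ..
  finally show ?thesis .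
qed

lemma parts_0: "parts 0 = {{#}}"
proof -
  have "M = {#}" if "M \<in> parts 0" for M
    using size_le_weight[of M] that by (simp only: parts_def mem_Collect_eq) simp
  then show ?thesis by (auto simp: parts_def)
qed

lemma moment_0_0: "moment \<Lambda> 0 0 = 1"
  by (simp add: moment_eq parts_0)

lemma moment_nonneg: "moment \<Lambda> k n \<ge> 0"
  by (simp add: moment_eq sum_nonneg)

text \<open>Adjoining one part equal to 1 is injective on multisets, raises the weight by exactly 1
  and does not lower the size.\<close>

lemma moment_mono:
  assumes "1 \<in> range \<Lambda>" "m \<le> n"
  shows "moment \<Lambda> k m \<le> moment \<Lambda> k n"
  using assms(2)
proof (rule lift_Suc_mono_le[rotated])
  fix n
  obtain j where j: "\<Lambda> j = 1" using assms(1) by auto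
  have "moment \<Lambda> k n \<le> (\<Sum>M\<in>parts n. real (size (add_mset j M)) ^ k)"
    unfolding moment_eq by (intro sum_mono power_mono) auto
  also have "\<dots> = (\<Sum>M\<in>add_mset j ` parts n. real (size M) ^ k)"
    by (subst sum.reindex) (auto intro: inj_onI)
  also have "\<dots> \<le> moment \<Lambda> k (Suc n)"
    unfolding moment_eq
    by (intro sum_mono2 finite_parts) (auto simp: parts_def j)
  finally show "moment \<Lambda> k n \<le> moment \<Lambda> k (Suc n)" .
qed

lemma dsum_nonneg: "(\<And>j r. c j r \<ge> 0) \<Longrightarrow> dsum c n \<ge> 0"
  by (auto simp: dsum_def intro!: sum_nonneg)

end

section \<open>Double series with nonnegative terms, and the recursive Bell polynomials\<close>

lemma has_sum_double:
  fixes g :: "nat \<Rightarrow> nat \<Rightarrow> real"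
  assumes nn: "\<And>r j. g r j \<ge> 0" and inner: "\<And>r. (\<lambda>j. g r j) sums h r" and outer: "h sums S"
  shows "((\<lambda>(r, j). g r j) has_sum S) (UNIV \<times> UNIV)"
proof -
  have h0: "h r \<ge> 0" for r using sums_le[OF _ sums_zero inner[of r]] nn by auto
  have inner': "(g r has_sum h r) UNIV" for r
    by (rule sums_nonneg_imp_has_sum[OF inner]) (rule nn)
  have outer': "(h has_sum S) UNIV"
    by (rule sums_nonneg_imp_has_sum[OF outer h0])
  have "(\<lambda>p. norm (case p of (r, j) \<Rightarrow> g r j)) summable_on UNIV \<times> UNIV"
    unfolding Infinite_Sum.abs_summable_on_Sigma_iff
    using inner' outer' h0 nn by (auto simp: infsumI[OF inner'] summable_on_def)
  then have "(\<lambda>(r, j). g r j) summable_on UNIV \<times> UNIV" by (rule abs_summable_summable)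
  then show ?thesis
    by (intro has_sum_SigmaI[OF _ outer']) (use inner' in auto)
qed

lemma sums_swap_nonneg:
  fixes g :: "nat \<Rightarrow> nat \<Rightarrow> real"
  assumes nn: "\<And>r j. g r j \<ge> 0" and inner: "\<And>r. (\<lambda>j. g r j) sums h r" and outer: "h sums S"
    and inner': "\<And>j. (\<lambda>r. g r j) sums h' j"
  shows "h' sums S"
proof -
  have "((\<lambda>(r, j). g r j) has_sum S) (UNIV \<times> UNIV)"
    by (rule has_sum_double[OF nn inner outer])
  then have "((\<lambda>(j, r). g r j) has_sum S) (UNIV \<times> UNIV)"
    by (subst (asm) has_sum_swap) simp
  then have "(h' has_sum S) UNIV"
    by (rule has_sum_Sigma') (use inner' nn in \<open>auto intro!: sums_nonneg_imp_has_sum\<close>)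
  then show ?thesis by (rule has_sum_imp_sums)
qed

text \<open>The complete Bell polynomials, by their recursion; \<open>x 0\<close> is not used.\<close>

fun bell_rec :: "(nat \<Rightarrow> 'a::comm_semiring_1) \<Rightarrow> nat \<Rightarrow> 'a" where
  "bell_rec x 0 = 1"
| "bell_rec x (Suc k) = (\<Sum>i\<le>k. of_nat (k choose i) * x (Suc i) * bell_rec x (k - i))"

lemmas bell_rec_Suc = bell_rec.simps(2)
declare bell_rec.simps(2) [simp del]

lemma bell_rec_cong: "(\<And>i. i \<ge> 1 \<Longrightarrow> x i = y i) \<Longrightarrow> bell_rec x k = bell_rec y k"
proof (induction k rule: less_induct)
  case (less k)
  show ?case
  proof (cases k)
    case (Suc n)
    show ?thesis unfolding Suc bell_rec_Suc
      by (rule sum.cong) (use less Suc in auto)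
  qed simp
qed

lemma bell_rec_of_real: "bell_rec (\<lambda>i. complex_of_real (x i)) k = of_real (bell_rec x k)"
proof (induction k rule: less_induct)
  case (less k)
  show ?case
  proof (cases k)
    case (Suc n)
    then show ?thesis using less by (simp add: bell_rec_Suc)
  qed simp
qed

lemma bell_rec_pos:
  fixes x :: "nat \<Rightarrow> real"
  assumes "\<And>i. i \<ge> 1 \<Longrightarrow> x i > 0"
  shows "bell_rec x k > 0"
proof (induction k rule: less_induct)
  case (less k)
  show ?case
  proof (cases k)
    case (Suc n)
    show ?thesis unfolding Suc bell_rec_Suc
      by (intro sum_pos mult_pos_pos assms less) (use Suc in auto)
  qed simp
qed

section \<open>Power series with real nonnegative coefficients on the complex disc\<close>

definition cfps :: "(nat \<Rightarrow> real) \<Rightarrow> complex fps" where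
  "cfps f = Abs_fps (\<lambda>n. complex_of_real (f n))"

lemma cfps_nth [simp]: "fps_nth (cfps f) n = of_real (f n)"
  by (simp add: cfps_def)

lemma eval_cfps:
  assumes "(\<lambda>n. f n * x ^ n) sums S"
  shows "eval_fps (cfps f) (of_real x) = of_real S"
  using sums_of_real[OF assms, where 'a = complex] by (simp add: eval_fps_def sums_iff)

lemma cfps_conv_radius:
  assumes "\<And>x. 0 < x \<Longrightarrow> x < 1 \<Longrightarrow> summable (\<lambda>n. f n * x ^ n)"
  shows "fps_conv_radius (cfps f) \<ge> 1"
  unfolding fps_conv_radius_def
proof (rule conv_radius_geI_ex')
  fix r :: real assume "0 < r" "ereal r < 1"
  then have "summable (\<lambda>n. f n * r ^ n)" using assms by simp
  from summable_of_real[OF this, where 'a = complex]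
  show "summable (\<lambda>n. fps_nth (cfps f) n * of_real r ^ n)" by simp
qed

text \<open>Such a series is bounded on every circle by its value at the positive radius. All
  estimates off the real axis reduce to real ones in this way.\<close>

definition nonneg_fps :: "complex fps \<Rightarrow> bool" where
  "nonneg_fps F \<longleftrightarrow> (\<forall>n. fps_nth F n \<in> \<real>\<^sub>\<ge>\<^sub>0)"

lemma nonneg_Reals_sum: "(\<And>i. i \<in> I \<Longrightarrow> f i \<in> \<real>\<^sub>\<ge>\<^sub>0) \<Longrightarrow> sum f I \<in> \<real>\<^sub>\<ge>\<^sub>0"
  by (induction I rule: infinite_finite_induct) auto

lemma nonneg_fps_mult: "nonneg_fps F \<Longrightarrow> nonneg_fps G \<Longrightarrow> nonneg_fps (F * G)"
  by (auto simp: nonneg_fps_def fps_mult_nth intro!: nonneg_Reals_sum nonneg_Reals_mult_I)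

lemma nonneg_fps_sum: "(\<And>i. i \<in> I \<Longrightarrow> nonneg_fps (F i)) \<Longrightarrow> nonneg_fps (sum F I)"
  by (auto simp: nonneg_fps_def fps_sum_nth intro!: nonneg_Reals_sum)

lemma nonneg_fps_of_nat: "nonneg_fps (of_nat n)"
  by (auto simp: nonneg_fps_def simp flip: fps_of_nat)

lemma nonneg_fps_cfps: "(\<And>n. f n \<ge> 0) \<Longrightarrow> nonneg_fps (cfps f)"
  by (auto simp: nonneg_fps_def)

lemma fps_conv_radius_of_nat [simp]: "fps_conv_radius (of_nat n :: complex fps) = \<infinity>"
  by (simp flip: fps_of_nat)

lemma eval_fps_of_nat [simp]: "eval_fps (of_nat n :: complex fps) z = of_nat n"
  by (simp flip: fps_of_nat)

lemma fps_conv_radius_sum_ge: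
  assumes "finite I" "\<And>i. i \<in> I \<Longrightarrow> fps_conv_radius (F i) \<ge> r"
  shows "fps_conv_radius (sum F I) \<ge> r"
  using assms
proof (induction I rule: finite_induct)
  case (insert x I)
  then have "r \<le> min (fps_conv_radius (F x)) (fps_conv_radius (sum F I))" by simp
  also have "\<dots> \<le> fps_conv_radius (F x + sum F I)" by (rule fps_conv_radius_add)
  finally show ?case using insert by simp
qed auto

lemma eval_fps_sum:
  fixes r :: ereal and F :: "'a \<Rightarrow> complex fps"
  assumes "finite I" "\<And>i. i \<in> I \<Longrightarrow> fps_conv_radius (F i) \<ge> r" "norm z < r"
  shows "eval_fps (sum F I) z = (\<Sum>i\<in>I. eval_fps (F i) z)"
  using assms
proof (induction I rule: finite_induct)
  case (insert x I)
  have "eval_fps (F x + sum F I) z = eval_fps (F x) z + eval_fps (sum F I) z"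
  proof (rule eval_fps_add)
    show "norm z < fps_conv_radius (F x)" using insert.prems by (meson insertI1 order_less_le_trans)
    show "norm z < fps_conv_radius (sum F I)"
      using insert fps_conv_radius_sum_ge[of I r F] by (meson insertI2 order_less_le_trans)
  qed
  then show ?case using insert by auto
qed auto

text \<open>Running the recursion in the ring of power series gives the Bell polynomial a series of
  its own, with nonnegative coefficients, and evaluation commutes with the recursion.\<close>

lemma bell_rec_fps:
  fixes r :: ereal and X :: "nat \<Rightarrow> complex fps"
  assumes "\<And>i. fps_conv_radius (X i) \<ge> r"
  shows "fps_conv_radius (bell_rec X k) \<ge> r"
    and "norm z < r \<Longrightarrow> eval_fps (bell_rec X k) z = bell_rec (\<lambda>i. eval_fps (X i) z) k"
proof -
  show r: "fps_conv_radius (bell_rec X k) \<ge> r" for k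
  proof (induction k rule: less_induct)
    case (less k)
    show ?case
    proof (cases k)
      case (Suc n)
      then show ?thesis using less assms
        by (auto simp: bell_rec_Suc intro!: fps_conv_radius_sum_ge fps_conv_radius_mult_ge)
    qed auto
  qed
  show "eval_fps (bell_rec X k) z = bell_rec (\<lambda>i. eval_fps (X i) z) k" if z: "norm z < r"
  proof (induction k rule: less_induct)
    case (less k)
    show ?case
    proof (cases k)
      case (Suc n)
      have lt: "norm z < fps_conv_radius F" if "fps_conv_radius F \<ge> r" for F :: "complex fps"
        using z that by (rule order_less_le_trans)
      have "eval_fps (bell_rec X k) z =
         (\<Sum>i\<le>n. eval_fps (of_nat (n choose i) * X (Suc i) * bell_rec X (n - i)) z)"
        unfolding Suc bell_rec_Suc
        by (rule eval_fps_sum[OF _ _ z]) (use r assms in \<open>auto intro!: fps_conv_radius_mult_ge\<close>)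
      also have "\<dots> = bell_rec (\<lambda>i. eval_fps (X i) z) k"
        unfolding Suc bell_rec_Suc
      proof (intro sum.cong refl)
        fix i
        have "eval_fps (of_nat (n choose i) * X (Suc i)) z = of_nat (n choose i) * eval_fps (X (Suc i)) z"
          using assms by (subst eval_fps_mult) (auto intro!: lt)
        moreover have "eval_fps (of_nat (n choose i) * X (Suc i) * bell_rec X (n - i)) z =
            eval_fps (of_nat (n choose i) * X (Suc i)) z * eval_fps (bell_rec X (n - i)) z"
          using assms r by (intro eval_fps_mult lt fps_conv_radius_mult_ge) auto
        ultimately show "eval_fps (of_nat (n choose i) * X (Suc i) * bell_rec X (n - i)) z =
            of_nat (n choose i) * eval_fps (X (Suc i)) z * bell_rec (\<lambda>i. eval_fps (X i) z) (n - i)"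
          using less[of "n - i"] Suc by simp
      qed
      finally show ?thesis .
    qed auto
  qed
qed

lemma nonneg_fps_bell_rec:
  assumes "\<And>i. nonneg_fps (X i)"
  shows "nonneg_fps (bell_rec X k)"
proof (induction k rule: less_induct)
  case (less k)
  show ?case
  proof (cases k)
    case 0
    then show ?thesis using nonneg_fps_of_nat[of 1] by simp
  next
    case (Suc n)
    then show ?thesis using less assms
      by (auto simp: bell_rec_Suc intro!: nonneg_fps_sum nonneg_fps_mult nonneg_fps_of_nat)
  qed
qed

text \<open>Because S has no constant term, comparing coefficients gives n \<open>F\<^sub>n\<close>
  as a sum that involves only earlier coefficients, and over the complex numbers one may divide by
  n.\<close>

lemma fps_log_deriv_unique:
  fixes F G S :: "complex fps"
  assumes "fps_X * fps_deriv F = S * F" "fps_X * fps_deriv G = S * G" "fps_nth S 0 = 0"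
    and "fps_nth F 0 = fps_nth G 0"
  shows "F = G"
proof (rule fps_ext)
  fix n
  have rec: "of_nat n * fps_nth H n = (\<Sum>i=1..n. fps_nth S i * fps_nth H (n - i))"
    if "fps_X * fps_deriv H = S * H" for H :: "complex fps" and n
  proof -
    have "of_nat n * fps_nth H n = fps_nth (fps_X * fps_deriv H) n" by (cases n) auto
    also have "\<dots> = (\<Sum>i=0..n. fps_nth S i * fps_nth H (n - i))" by (simp add: that fps_mult_nth)
    also have "\<dots> = (\<Sum>i=1..n. fps_nth S i * fps_nth H (n - i))"
      using assms(3) by (simp add: sum.atLeast_Suc_atMost)
    finally show ?thesis .
  qed
  show "fps_nth F n = fps_nth G n"
  proof (induction n rule: less_induct)
    case (less n)
    show ?case
    proof (cases "n = 0")
      case False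
      have "of_nat n * fps_nth F n = of_nat n * fps_nth G n"
        unfolding rec[OF assms(1)] rec[OF assms(2)] using False
        by (intro sum.cong refl arg_cong2[of _ _ _ _ "(*)"] less) auto
      then show ?thesis using False by simp
    qed (use assms in auto)
  qed
qed

context part_seq
begin

lemma dsum_sums:
  assumes "((\<lambda>(r, j). c j (Suc r) * x ^ (Suc r * \<Lambda> j)) has_sum S) (UNIV \<times> UNIV)"
  shows "(\<lambda>n. dsum c n * x ^ n) sums S"
proof -
  \<comment> \<open>The double series is indexed from r = 0 while \<open>reps\<close> starts at
    multiplicity 1, hence the shift by \<open>Suc\<close> in the bijection.\<close>
  have "((\<lambda>(n, (j, r)). c j r * x ^ n) has_sum S) (Sigma UNIV reps) \<longleftrightarrow>
        ((\<lambda>(r, j). c j (Suc r) * x ^ (Suc r * \<Lambda> j)) has_sum S) (UNIV \<times> UNIV)"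
    by (rule has_sum_reindex_bij_witness[of _ "\<lambda>(r, j). (Suc r * \<Lambda> j, (j, Suc r))" "\<lambda>(n, (j, r)). (r - 1, j)"])
       (auto simp: reps_def simp del: mult_Suc)
  with assms have "((\<lambda>(n, (j, r)). c j r * x ^ n) has_sum S) (Sigma UNIV reps)" by simp
  then have "((\<lambda>n. dsum c n * x ^ n) has_sum S) UNIV"
  proof (rule has_sum_Sigma')
    fix n
    show "((\<lambda>p. case (n, p) of (n, j, r) \<Rightarrow> c j r * x ^ n) has_sum dsum c n * x ^ n) (reps n)"
      by (rule has_sum_finiteI) (auto simp: dsum_def sum_distrib_right case_prod_unfold)
  qed
  then show ?thesis by (rule has_sum_imp_sums)
qed

lemma dsum_0 [simp]: "dsum c 0 = 0"
proof -
  have "reps 0 = {}" using pos by (auto simp: reps_def)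
  then show ?thesis by (simp add: dsum_def)
qed

end

section \<open>The generating functions at exp(-t)\<close>

locale part_seq_summable = part_seq +
  assumes summ: "t > 0 \<Longrightarrow> summable (\<lambda>j. exp (- real (\<Lambda> j) * t))"
begin

abbreviation \<theta> where "\<theta> \<equiv> Theta \<Lambda>"

lemma Theta_sums: "t > 0 \<Longrightarrow> (\<lambda>j. exp (- real (\<Lambda> j) * t)) sums \<theta> t"
  unfolding Theta_def by (rule summable_sums[OF summ])

lemma Theta_pos: "t > 0 \<Longrightarrow> \<theta> t > 0"
  unfolding Theta_def by (rule suminf_pos[OF summ]) auto

text \<open>All elements of the sequence are at least 1, so each single term loses at least the
  factor exp(-(s - t)).\<close>

lemma Theta_decay:
  assumes "0 < t" "t \<le> s"
  shows "\<theta> s \<le> exp (- (s - t)) * \<theta> t"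
proof (rule sums_le[OF _ Theta_sums sums_mult[OF Theta_sums]])
  fix j
  have "1 * (s - t) \<le> real (\<Lambda> j) * (s - t)" using pos[of j] assms by (intro mult_right_mono) auto
  then have "- real (\<Lambda> j) * s \<le> - (s - t) + - real (\<Lambda> j) * t" by (simp add: algebra_simps)
  then show "exp (- real (\<Lambda> j) * s) \<le> exp (- (s - t)) * exp (- real (\<Lambda> j) * t)"
    by (simp flip: exp_add)
qed (use assms in auto)

lemma summable_Theta:
  assumes t: "t > 0"
  shows "summable (\<lambda>r. real (Suc r) powr p * \<theta> (real (Suc r) * t))"
proof (rule summable_comparison_test)
  have "\<theta> (real (Suc r) * t) \<le> exp (- (real r * t)) * \<theta> t" for r
    using Theta_decay[of t "real (Suc r) * t"] t by (simp add: algebra_simps)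
  then show "\<exists>N. \<forall>r\<ge>N. norm (real (Suc r) powr p * \<theta> (real (Suc r) * t)) \<le> real (Suc r) powr p * exp (- (real r * t)) * \<theta> t"
    using Theta_pos t by (auto simp: abs_mult less_imp_le mult.assoc intro!: mult_left_mono)
  have "(\<lambda>r. real (Suc r) powr p * exp (- (real r * t))) \<in> O(\<lambda>r. 1 / real (Suc r) ^ 2)"
    using t by real_asymp
  moreover have "summable (\<lambda>r. norm (1 / real (Suc r) ^ 2))"
    using inverse_power_summable[of 2, where 'a = real] by (subst summable_Suc_iff) (simp add: inverse_eq_divide)
  ultimately show "summable (\<lambda>r. real (Suc r) powr p * exp (- (real r * t)) * \<theta> t)"
    by (intro summable_mult2) (rule summable_comparison_test_bigo)
qed

lemma dsum_pow_sums:
  assumes t: "t > 0"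
  shows "(\<lambda>n. dsum (\<lambda>j r. real r powr p) n * exp (- t) ^ n) sums
         (\<Sum>r. real (Suc r) powr p * \<theta> (real (Suc r) * t))"
proof (rule dsum_sums, rule has_sum_double)
  fix r
  have "(\<lambda>j. exp (- real (\<Lambda> j) * (real (Suc r) * t))) sums \<theta> (real (Suc r) * t)"
    using t by (intro Theta_sums) auto
  then show "(\<lambda>j. real (Suc r) powr p * exp (- t) ^ (Suc r * \<Lambda> j)) sums (real (Suc r) powr p * \<theta> (real (Suc r) * t))"
    by (intro sums_mult) (simp add: algebra_simps flip: exp_of_nat_mult)
qed (use summable_Theta[OF t] in auto)

text \<open>Each quotient is expanded into a geometric series and the order of summation is
  exchanged. The common value S ties the left-hand side of the saddle point equation to the
  logarithmic derivative of \<open>T\<^sub>0\<close>.\<close>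

lemma dsum_weight_sums:
  assumes t: "t > 0"
  obtains S where "(\<lambda>n. dsum (\<lambda>j r. real (\<Lambda> j)) n * exp (- t) ^ n) sums S"
    "(\<lambda>j. real (\<Lambda> j) / (exp (t * real (\<Lambda> j)) - 1)) sums S"
proof -
  define g where "g r j = real (\<Lambda> j) * exp (- t) ^ (Suc r * \<Lambda> j)" for r j
  define h where "h r = (\<Sum>j. g r j)" for r
  have g0: "g r j \<ge> 0" for r j by (simp add: g_def)
  \<comment> \<open>Half of the exponential pays for the factor \<open>\<Lambda> j\<close>, so that
    the rest is again a term of \<open>Theta\<close>, at half the argument.\<close>
  have gb: "g r j \<le> 2 / t * exp (- real (\<Lambda> j) * (real (Suc r) * (t / 2)))" for r j
  proof -
    define u where "u = real (\<Lambda> j) * (real (Suc r) * (t / 2))"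
    have "real (\<Lambda> j) * (t / 2) \<le> u"
      unfolding u_def using t by (intro mult_left_mono) auto
    also have "\<dots> \<le> exp u"
      using exp_ge_add_one_self[of u] by linarith
    finally have "real (\<Lambda> j) \<le> 2 / t * exp u"
      using t by (simp add: field_simps)
    then have "g r j \<le> 2 / t * exp u * exp (- t) ^ (Suc r * \<Lambda> j)"
      unfolding g_def by (rule mult_right_mono) auto
    also have "exp (- t) ^ (Suc r * \<Lambda> j) = exp (- (2 * u))"
      by (simp add: u_def algebra_simps flip: exp_of_nat_mult)
    also have "2 / t * exp u * \<dots> = 2 / t * exp (- u)"
      by (simp flip: exp_add)
    finally show ?thesis by (simp add: u_def)
  qed
  have sumr: "(\<lambda>j. 2 / t * exp (- real (\<Lambda> j) * (real (Suc r) * (t / 2)))) sums (2 / t * \<theta> (real (Suc r) * (t / 2)))" for r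
    using t by (intro sums_mult Theta_sums) auto
  have sg: "summable (g r)" for r
    by (rule summable_comparison_test[OF _ sums_summable[OF sumr[of r]]]) (use g0 gb in auto)
  then have inner: "g r sums h r" for r unfolding h_def by (rule summable_sums)
  have "h r \<le> 2 / t * \<theta> (real (Suc r) * (t / 2))" for r
    by (rule sums_le[OF gb inner sumr])
  moreover have "h r \<ge> 0" for r unfolding h_def by (rule suminf_nonneg[OF sg g0])
  ultimately have "summable h"
    using summable_mult[OF summable_Theta[of "t / 2" 0], of "2 / t"] t
    by (intro summable_comparison_test[of h "\<lambda>r. 2 / t * (real (Suc r) powr 0 * \<theta> (real (Suc r) * (t / 2)))"]) auto
  then have outer: "h sums suminf h" by (rule summable_sums)
  have inner': "(\<lambda>r. g r j) sums (real (\<Lambda> j) / (exp (t * real (\<Lambda> j)) - 1))" for j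
  proof -
    define y where "y = exp (- (t * real (\<Lambda> j)))"
    have y: "0 < y" "y < 1" using t pos[of j] by (auto simp: y_def)
    have "(\<lambda>r. (real (\<Lambda> j) * y) * y ^ r) sums ((real (\<Lambda> j) * y) * (1 / (1 - y)))"
      using y by (intro sums_mult geometric_sums) auto
    also have "(\<lambda>r. (real (\<Lambda> j) * y) * y ^ r) = (\<lambda>r. g r j)"
      unfolding g_def y_def by (auto simp: algebra_simps simp flip: exp_of_nat_mult exp_add)
    also have "(real (\<Lambda> j) * y) * (1 / (1 - y)) = real (\<Lambda> j) / (1 / y - 1)"
      using y by (simp add: field_simps)
    also have "1 / y = exp (t * real (\<Lambda> j))" by (simp add: y_def exp_minus field_simps)
    finally show ?thesis .
  qed
  show ?thesis
  proof (rule that)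
    show "(\<lambda>n. dsum (\<lambda>j r. real (\<Lambda> j)) n * exp (- t) ^ n) sums suminf h"
      using has_sum_double[OF g0 inner outer] by (intro dsum_sums) (simp add: g_def)
    show "(\<lambda>j. real (\<Lambda> j) / (exp (t * real (\<Lambda> j)) - 1)) sums suminf h"
      by (rule sums_swap_nonneg[OF g0 inner outer inner'])
  qed
qed

text \<open>The index is the order of the cumulant, one more than the exponent of r. So index 0 is
  the cumulant generating function itself, the logarithm of \<open>T\<^sub>0\<close>, and for i
  \<ge> 1 the series is the i-th argument of the Bell polynomial.\<close>

definition powK :: "nat \<Rightarrow> complex fps" where
  "powK i = cfps (dsum (\<lambda>j r. real r powr (real i - 1)))"

definition logF :: "complex fps" where
  "logF = powK 0"

definition weightS :: "complex fps" where
  "weightS = cfps (dsum (\<lambda>j r. real (\<Lambda> j)))"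

definition momT :: "nat \<Rightarrow> complex fps" where
  "momT k = cfps (moment \<Lambda> k)"

definition kap :: "real \<Rightarrow> real \<Rightarrow> real" where
  "kap p t = (\<Sum>r. real (Suc r) powr p * \<theta> (real (Suc r) * t))"

lemma ex_exp_minus: "0 < x \<Longrightarrow> x < 1 \<Longrightarrow> \<exists>t>0. x = exp (- t :: real)"
  by (rule exI[of _ "- ln x"]) (auto simp: ln_less_zero)

lemma powK_radius: "fps_conv_radius (powK i) \<ge> 1"
  unfolding powK_def
proof (rule cfps_conv_radius)
  fix x :: real assume "0 < x" "x < 1"
  then obtain t where t: "t > 0" "x = exp (- t)" using ex_exp_minus by blast
  show "summable (\<lambda>n. dsum (\<lambda>j r. real r powr (real i - 1)) n * x ^ n)"
    unfolding t(2) by (rule sums_summable[OF dsum_pow_sums[OF t(1)]])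
qed

lemma weightS_radius: "fps_conv_radius weightS \<ge> 1"
  unfolding weightS_def
proof (rule cfps_conv_radius)
  fix x :: real assume "0 < x" "x < 1"
  then obtain t where t: "t > 0" "x = exp (- t)" using ex_exp_minus by blast
  obtain S where "(\<lambda>n. dsum (\<lambda>j r. real (\<Lambda> j)) n * exp (- t) ^ n) sums S"
    by (rule dsum_weight_sums[OF t(1)])
  then show "summable (\<lambda>n. dsum (\<lambda>j r. real (\<Lambda> j)) n * x ^ n)"
    unfolding t(2) by (rule sums_summable)
qed

lemma eval_powK: "t > 0 \<Longrightarrow> eval_fps (powK i) (of_real (exp (- t))) = of_real (kap (real i - 1) t)"
  unfolding powK_def kap_def by (intro eval_cfps dsum_pow_sums)

lemma nonneg_powK: "nonneg_fps (powK i)"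
  unfolding powK_def by (intro nonneg_fps_cfps dsum_nonneg) auto

lemma momT_eq: "momT k = momT 0 * bell_rec powK k"
proof (induction k rule: less_induct)
  case (less k)
  show ?case
  proof (cases k)
    case (Suc n)
    have "momT (Suc n) = (\<Sum>i\<le>n. of_nat (n choose i) * powK (Suc i) * momT (n - i))"
    proof (rule fps_ext)
      fix m
      have "fps_nth (of_nat (n choose i) * powK (Suc i) * momT (n - i)) m =
        of_real (real (n choose i) * (\<Sum>l\<le>m. dsum (\<lambda>j r. real r ^ i) l * moment \<Lambda> (n - i) (m - l)))" for i
      proof -
        \<comment> \<open>For i = 0 the two powers differ at r = 0; \<open>reps\<close> contains
          only r \<ge> 1.\<close>
        have eq: "dsum (\<lambda>j r. real r powr real i) = dsum (\<lambda>j r. real r ^ i)"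
          unfolding dsum_def by (intro ext sum.cong) (auto simp: reps_def powr_realpow)
        have "of_nat (n choose i) * powK (Suc i) * momT (n - i) =
              fps_const (of_nat (n choose i)) * (powK (Suc i) * momT (n - i))"
          by (simp only: fps_of_nat mult.assoc)
        then have "fps_nth (of_nat (n choose i) * powK (Suc i) * momT (n - i)) m =
            of_nat (n choose i) * fps_nth (powK (Suc i) * momT (n - i)) m"
          by (simp only: fps_mult_left_const_nth)
        then show ?thesis
          by (simp add: fps_mult_nth powK_def momT_def atMost_atLeast0 eq)
      qed
      then show "fps_nth (momT (Suc n)) m = fps_nth (\<Sum>i\<le>n. of_nat (n choose i) * powK (Suc i) * momT (n - i)) m"
        unfolding fps_sum_nth by (simp add: momT_def moment_Suc)
    qed
    also have "\<dots> = (\<Sum>i\<le>n. momT 0 * (of_nat (n choose i) * powK (Suc i) * bell_rec powK (n - i)))"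
      using Suc by (intro sum.cong refl) (subst less, auto simp: algebra_simps)
    also have "\<dots> = momT 0 * bell_rec powK (Suc n)"
      by (simp add: bell_rec_Suc sum_distrib_left)
    finally show ?thesis by (simp add: Suc)
  qed auto
qed

text \<open>On \<open>reps n\<close> one has n = r \<open>\<Lambda> j\<close>, so n times 1/r is the
  weight \<open>\<Lambda> j\<close>.\<close>

lemma X_deriv_logF: "fps_X * fps_deriv logF = weightS"
proof (rule fps_ext)
  fix n
  have "real n * dsum (\<lambda>j r. real r powr (real 0 - 1)) n = dsum (\<lambda>j r. real (\<Lambda> j)) n"
    unfolding dsum_def sum_distrib_left
    by (intro sum.cong) (auto simp: reps_def powr_minus field_simps)
  moreover have "fps_nth (fps_X * fps_deriv logF) n = of_real (real n * dsum (\<lambda>j r. real r powr (real 0 - 1)) n)"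
    by (cases n) (simp_all add: logF_def powK_def)
  ultimately show "fps_nth (fps_X * fps_deriv logF) n = fps_nth weightS n"
    by (simp only: weightS_def cfps_nth)
qed

lemma norm_less_conv_radius:
  "norm z < 1 \<Longrightarrow> fps_conv_radius F \<ge> 1 \<Longrightarrow> ereal (norm z) < fps_conv_radius F"
  by (rule order_less_le_trans[of _ 1]) (simp_all add: one_ereal_def)

text \<open>No growth estimate for the partition numbers is at hand, so convergence is not shown
  directly. The exponential of \<open>logF\<close> is holomorphic on the unit disc, and its Taylor
  series satisfies the same first-order equation with the same constant term as
  \<open>momT 0\<close>. Uniqueness identifies the two, which yields the radius and the value
  together.\<close>

lemma momT_0: "fps_conv_radius (momT 0) \<ge> 1"
  "norm z < 1 \<Longrightarrow> eval_fps (momT 0) z = exp (eval_fps logF z)"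
proof -
  define f where "f z = exp (eval_fps logF z)" for z
  have holo: "f holomorphic_on eball 0 1"
    unfolding f_def logF_def
    by (intro holomorphic_intros) (auto intro!: norm_less_conv_radius powK_radius)
  have Lexp: "eval_fps logF has_fps_expansion logF"
    unfolding logF_def by (intro eval_fps_has_fps_expansion order_less_le_trans[OF _ powK_radius]) simp
  have ball: "eball 0 1 = (ball 0 1 :: complex set)" by (auto simp: eball_def ball_def)
  define P where "P = fps_expansion f 0"
  have P: "f has_fps_expansion P"
    unfolding P_def by (rule has_fps_expansion_fps_expansion[of "ball 0 1"]) (use holo ball in auto)
  have dP: "deriv f has_fps_expansion fps_deriv P"
    by (rule has_fps_expansion_deriv[OF P])
  have "deriv (eval_fps logF) has_fps_expansion fps_deriv logF"
    by (rule has_fps_expansion_deriv[OF Lexp])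
  then have "(\<lambda>z. deriv (eval_fps logF) z * f z) has_fps_expansion fps_deriv logF * P"
    by (rule has_fps_expansion_mult[OF _ P])
  moreover have ev: "eventually (\<lambda>z. deriv (eval_fps logF) z * f z = deriv f z) (nhds 0)"
  proof -
    have "eventually (\<lambda>z. z \<in> ball 0 1) (nhds (0::complex))" by (intro eventually_nhds_in_open) auto
    then show ?thesis
    proof eventually_elim
      case (elim z)
      have n: "norm z < fps_conv_radius logF"
        using elim powK_radius[of 0] by (auto simp: logF_def intro!: norm_less_conv_radius)
      have d: "(eval_fps logF has_field_derivative eval_fps (fps_deriv logF) z) (at z)"
        by (rule has_field_derivative_eval_fps[OF n])
      have "(f has_field_derivative exp (eval_fps logF z) * eval_fps (fps_deriv logF) z) (at z)"
        unfolding f_def using d by (rule DERIV_fun_exp)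
      with d show ?case by (simp add: DERIV_imp_deriv f_def)
    qed
  qed
  ultimately have "deriv f has_fps_expansion fps_deriv logF * P"
    using has_fps_expansion_cong[OF ev refl] by simp
  from fps_expansion_unique_complex[OF dP this] have "fps_deriv P = fps_deriv logF * P" .
  then have 1: "fps_X * fps_deriv P = weightS * P"
    by (simp add: X_deriv_logF[symmetric] mult.assoc)
  have 2: "fps_X * fps_deriv (momT 0) = weightS * momT 0"
  proof (rule fps_ext)
    fix n
    have "fps_nth (fps_X * fps_deriv (momT 0)) n = of_real (real n * moment \<Lambda> 0 n)"
      by (cases n) (auto simp: momT_def)
    also have "\<dots> = fps_nth (weightS * momT 0) n"
      by (simp add: moment_0_weight momT_def weightS_def fps_mult_nth atMost_atLeast0)
    finally show "fps_nth (fps_X * fps_deriv (momT 0)) n = fps_nth (weightS * momT 0) n" .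
  qed
  have "P = momT 0"
  proof (rule fps_log_deriv_unique[OF 1 2])
    have "fps_nth P 0 = f 0" by (rule has_fps_expansion_imp_0_eq_fps_nth_0[OF P, symmetric])
    also have "\<dots> = 1" by (simp add: f_def eval_fps_at_0 logF_def powK_def)
    finally show "fps_nth P 0 = fps_nth (momT 0) 0" by (simp add: momT_def moment_0_0)
  qed (simp add: weightS_def)
  then have eq: "fps_expansion f 0 = momT 0" by (simp only: P_def)
  show "fps_conv_radius (momT 0) \<ge> 1"
    using conv_radius_fps_expansion[OF holo] unfolding eq .
  show "eval_fps (momT 0) z = exp (eval_fps logF z)" if "norm z < 1"
  proof -
    have "ereal (norm z) < 1" using that by (simp add: one_ereal_def)
    from eval_fps_expansion'[OF holo this] show ?thesis unfolding eq f_def by (simp only: add_0)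
  qed
qed

lemma momT_radius: "fps_conv_radius (momT k) \<ge> 1"
proof -
  have "fps_conv_radius (momT 0 * bell_rec powK k) \<ge> 1"
    by (rule fps_conv_radius_mult_ge[OF momT_0(1) bell_rec_fps(1)[OF powK_radius]])
  then show ?thesis by (simp only: momT_eq[of k, symmetric])
qed

end

section \<open>A local limit theorem for monotone weights\<close>

definition triangle :: "real \<Rightarrow> real \<Rightarrow> real" where
  "triangle T u = max 0 (1 - \<bar>u\<bar> / T)"

text \<open>The Fourier transform of \<open>triangle T\<close>; the separate value at 0 is the
  continuous extension.\<close>

definition fejer :: "real \<Rightarrow> real \<Rightarrow> real" where
  "fejer T y = (if y = 0 then T else 2 * (1 - cos (T * y)) / (T * y\<^sup>2))"

lemma triangle_bounds: "0 \<le> triangle T u" "T > 0 \<Longrightarrow> triangle T u \<le> 1"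
  by (auto simp: triangle_def)

lemma triangle_eq_0: "T > 0 \<Longrightarrow> \<bar>u\<bar> > T \<Longrightarrow> triangle T u = 0"
  by (auto simp: triangle_def field_simps)

lemma continuous_triangle [continuous_intros]: "continuous_on A (triangle T)"
  unfolding triangle_def divide_inverse by (intro continuous_intros)

lemma triangle_measurable [measurable]: "triangle T \<in> borel_measurable borel"
  by (rule borel_measurable_continuous_onI[OF continuous_triangle])

lemma integrable_triangle_mult:
  assumes T: "T > 0" and f: "continuous_on UNIV (f :: real \<Rightarrow> real)"
  shows "integrable lborel (\<lambda>u. triangle T u * f u)"
proof -
  have "set_integrable lborel {-T..T} (\<lambda>u. triangle T u * f u)"
    by (intro borel_integrable_atLeastAtMost' continuous_intros continuous_on_subset[OF f]) auto
  moreover have "(\<lambda>u. indicator {-T..T} u *\<^sub>R (triangle T u * f u)) = (\<lambda>u. triangle T u * f u)"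
  proof
    fix u show "indicator {-T..T} u *\<^sub>R (triangle T u * f u) = triangle T u * f u"
      using triangle_eq_0[OF T, of u] by (cases "\<bar>u\<bar> \<le> T") (auto simp: indicator_def)
  qed
  ultimately show ?thesis by (simp add: set_integrable_def)
qed

lemma integrable_triangle: "T > 0 \<Longrightarrow> integrable lborel (triangle T)"
  using integrable_triangle_mult[of T "\<lambda>_. 1"] by simp

lemma fejer_nonneg: "T > 0 \<Longrightarrow> fejer T y \<ge> 0"
  by (auto simp: fejer_def)

lemma fejer_minus [simp]: "fejer T (- y) = fejer T y"
  by (simp add: fejer_def)

lemma fejer_le:
  assumes "T > 0" "y \<noteq> 0"
  shows "fejer T y \<le> 4 / (T * y\<^sup>2)"
proof -
  have "2 * (1 - cos (T * y)) \<le> 4" by (rule order.trans[of _ "2 * (1 - (-1))"], intro mult_left_mono diff_left_mono) auto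
  then have "2 * (1 - cos (T * y)) / (T * y\<^sup>2) \<le> 4 / (T * y\<^sup>2)"
    using assms by (intro divide_right_mono) auto
  then show ?thesis using assms by (simp add: fejer_def)
qed

lemma integral_triangle_cos:
  assumes T: "T > 0"
  shows "(\<integral>u. triangle T u * cos (u * y) \<partial>lborel) = fejer T y"
proof -
  let ?f = "\<lambda>u. triangle T u * cos (u * y)"
  \<comment> \<open>The two closed halves overlap in the point 0, which the third summand takes off
    again; its integral vanishes.\<close>
  have split: "?f = (\<lambda>u. ((1 + u / T) * cos (u * y)) * indicator {-T..0} u +
      ((1 - u / T) * cos (u * y)) * indicator {0..T} u -
      cos (u * y) * indicator {0..0} u)"
    using T by (auto simp: fun_eq_iff triangle_def indicator_def field_simps max_def)
  have int: "integrable lborel (\<lambda>u. f u * indicator {c..d} u)" if "continuous_on UNIV f"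
    for f :: "real \<Rightarrow> real" and c d
    using borel_integrable_atLeastAtMost'[OF continuous_on_subset[OF that], of c d]
    by (simp add: set_integrable_def mult.commute)
  have point: "(\<integral>u. cos (u * y) * indicator {0..0} u \<partial>lborel) = 0"
  proof (cases "y = 0")
    case True
    then show ?thesis
      by (subst integral_FTC_Icc_real[where F = "\<lambda>u. u"]) (auto intro!: derivative_eq_intros)
  next
    case False
    then show ?thesis
      by (subst integral_FTC_Icc_real[where F = "\<lambda>u. sin (u * y) / y"]) (auto intro!: derivative_eq_intros)
  qed
  have "integral\<^sup>L lborel ?f = (\<integral>u. ((1 + u / T) * cos (u * y)) * indicator {-T..0} u \<partial>lborel) +
     (\<integral>u. ((1 - u / T) * cos (u * y)) * indicator {0..T} u \<partial>lborel)"
  proof -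
    have 1: "integrable lborel (\<lambda>u. ((1 + u / T) * cos (u * y)) * indicator {-T..0} u)"
      by (intro int continuous_intros) (use T in auto)
    have 2: "integrable lborel (\<lambda>u. ((1 - u / T) * cos (u * y)) * indicator {0..T} u)"
      by (intro int continuous_intros) (use T in auto)
    have 3: "integrable lborel (\<lambda>u. cos (u * y) * indicator {0..0} u)"
      by (intro int continuous_intros)
    show ?thesis unfolding split
      by (simp only: Bochner_Integration.integral_diff[OF Bochner_Integration.integrable_add[OF 1 2] 3]
        Bochner_Integration.integral_add[OF 1 2] point diff_0_right)
  qed
  also have "\<dots> = fejer T y"
  proof (cases "y = 0")
    case True
    have "(\<integral>u. ((1 + u / T) * cos (u * y)) * indicator {-T..0} u \<partial>lborel) = 0 - (-T + T\<^sup>2 / (2 * T))"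
      by (subst integral_FTC_Icc_real[where F = "\<lambda>u. u + u\<^sup>2 / (2 * T)"])
         (use T True in \<open>auto intro!: derivative_eq_intros continuous_intros simp: power2_eq_square\<close>)
    moreover have "(\<integral>u. ((1 - u / T) * cos (u * y)) * indicator {0..T} u \<partial>lborel) = T - T\<^sup>2 / (2 * T)"
      by (subst integral_FTC_Icc_real[where F = "\<lambda>u. u - u\<^sup>2 / (2 * T)"])
         (use T True in \<open>auto intro!: derivative_eq_intros continuous_intros simp: power2_eq_square\<close>)
    ultimately show ?thesis using T True by (simp add: fejer_def power2_eq_square)
  next
    case False
    have "(\<integral>u. ((1 + u / T) * cos (u * y)) * indicator {-T..0} u \<partial>lborel) =
        cos (0 * y) / (T * y\<^sup>2) - cos (-T * y) / (T * y\<^sup>2)"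
      by (subst integral_FTC_Icc_real[where F = "\<lambda>u. (1 + u / T) * sin (u * y) / y + cos (u * y) / (T * y\<^sup>2)"])
         (use T False in \<open>auto intro!: derivative_eq_intros continuous_intros simp: power2_eq_square field_simps\<close>)
    moreover have "(\<integral>u. ((1 - u / T) * cos (u * y)) * indicator {0..T} u \<partial>lborel) =
        - cos (T * y) / (T * y\<^sup>2) + cos (0 * y) / (T * y\<^sup>2)"
      by (subst integral_FTC_Icc_real[where F = "\<lambda>u. (1 - u / T) * sin (u * y) / y - cos (u * y) / (T * y\<^sup>2)"])
         (use T False in \<open>auto intro!: derivative_eq_intros continuous_intros simp: power2_eq_square field_simps\<close>)
    ultimately have "(\<integral>u. ((1 + u / T) * cos (u * y)) * indicator {-T..0} u \<partial>lborel) +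
       (\<integral>u. ((1 - u / T) * cos (u * y)) * indicator {0..T} u \<partial>lborel) =
       (cos (0 * y) / (T * y\<^sup>2) - cos (-T * y) / (T * y\<^sup>2)) + (- cos (T * y) / (T * y\<^sup>2) + cos (0 * y) / (T * y\<^sup>2))"
      by (simp only:)
    also have "\<dots> = fejer T y" using T False by (simp add: fejer_def field_simps)
    finally show ?thesis .
  qed
  finally show ?thesis .
qed

text \<open>For |y| \<le> 1 the kernel averages cos(u y) over |u| \<le> 1 against the weight
  \<open>triangle 1\<close> of total mass 1, and there the cosine is at least cos 1.\<close>

lemma fejer_1_ge:
  assumes "\<bar>y\<bar> \<le> 1"
  shows "fejer 1 y \<ge> cos 1"
proof -
  have one: "integral\<^sup>L lborel (triangle 1) = 1"
    using integral_triangle_cos[of 1 0] by (simp add: fejer_def)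
  have "(\<integral>u. triangle 1 u * cos 1 \<partial>lborel) \<le> (\<integral>u. triangle 1 u * cos (u * y) \<partial>lborel)"
  proof (rule integral_mono)
    show "integrable lborel (\<lambda>u. triangle 1 u * cos 1)" "integrable lborel (\<lambda>u. triangle 1 u * cos (u * y))"
      by (intro integrable_triangle_mult continuous_intros; simp)+
    fix u :: real
    show "triangle 1 u * cos 1 \<le> triangle 1 u * cos (u * y)"
    proof (cases "\<bar>u\<bar> \<le> 1")
      case True
      have "\<bar>u * y\<bar> \<le> 1 * 1" unfolding abs_mult using True assms by (intro mult_mono) auto
      then have "cos 1 \<le> cos \<bar>u * y\<bar>" using pi_gt3 by (intro cos_monotone_0_pi_le) auto
      then show ?thesis using triangle_bounds(1)[of 1 u] by (intro mult_left_mono) (auto simp: abs_if split: if_splits)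
    qed (simp add: triangle_eq_0)
  qed
  then show ?thesis by (simp add: integral_triangle_cos one)
qed

lemma integrable_gauss:
  assumes "c > 0"
  shows "integrable lborel (\<lambda>x::real. exp (- c * x\<^sup>2))" "(\<integral>x. exp (- c * (x::real)\<^sup>2) \<partial>lborel) > 0"
proof -
  define \<sigma> where "\<sigma> = sqrt (1 / (2 * c))"
  have s: "\<sigma> > 0" "2 * \<sigma>\<^sup>2 = 1 / c" using assms by (auto simp: \<sigma>_def field_simps)
  have eq: "exp (- c * x\<^sup>2) = sqrt (2 * pi * \<sigma>\<^sup>2) * normal_density 0 \<sigma> x" for x
    using s assms by (simp add: normal_density_def)
  show "integrable lborel (\<lambda>x::real. exp (- c * x\<^sup>2))" unfolding eq using s by simp
  show "(\<integral>x. exp (- c * (x::real)\<^sup>2) \<partial>lborel) > 0" unfolding eq using s by simp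
qed

lemma sum_inverse_squares_le:
  assumes "L > 0"
  shows "(\<Sum>j=Suc L..N. 1 / (real j)\<^sup>2) \<le> 1 / real L"
proof (cases "L \<le> N")
  case True
  then have "(\<Sum>j=Suc L..N. 1 / (real j)\<^sup>2) \<le> 1 / real L - 1 / real N"
  proof (induction N rule: dec_induct)
    case (step N)
    have "1 / (real (Suc N))\<^sup>2 \<le> 1 / real N - 1 / real (Suc N)"
    proof -
      have "1 / real N - 1 / real (Suc N) = 1 / (real N * real (Suc N))"
        using assms step by (simp add: field_simps)
      moreover have "1 / (real (Suc N))\<^sup>2 \<le> 1 / (real N * real (Suc N))"
        using assms step unfolding power2_eq_square by (intro divide_left_mono mult_right_mono) auto
      ultimately show ?thesis by simp
    qed
    then show ?case using step by simp
  qed simp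
  also have "\<dots> \<le> 1 / real L" by simp
  finally show ?thesis .
qed simp

lemma sum_symmetric_int:
  fixes f :: "int \<Rightarrow> real"
  assumes "\<And>j. f (- j) = f j"
  shows "(\<Sum>j | int L < \<bar>j\<bar> \<and> \<bar>j\<bar> \<le> int N. f j) = 2 * (\<Sum>j=Suc L..N. f (int j))"
proof -
  have "{j. int L < \<bar>j\<bar> \<and> \<bar>j\<bar> \<le> int N} = int ` {Suc L..N} \<union> (\<lambda>j. - int j) ` {Suc L..N}"
  proof (intro equalityI subsetI)
    fix j assume "j \<in> {j. int L < \<bar>j\<bar> \<and> \<bar>j\<bar> \<le> int N}"
    then have "nat \<bar>j\<bar> \<in> {Suc L..N}" "j = int (nat \<bar>j\<bar>) \<or> j = - int (nat \<bar>j\<bar>)" by auto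
    then show "j \<in> int ` {Suc L..N} \<union> (\<lambda>j. - int j) ` {Suc L..N}" by blast
  qed auto
  moreover have "int ` {Suc L..N} \<inter> (\<lambda>j. - int j) ` {Suc L..N} = {}" by auto
  ultimately have "(\<Sum>j | int L < \<bar>j\<bar> \<and> \<bar>j\<bar> \<le> int N. f j) =
      sum f (int ` {Suc L..N}) + sum f ((\<lambda>j. - int j) ` {Suc L..N})"
    by (simp add: sum.union_disjoint)
  also have "\<dots> = 2 * (\<Sum>j=Suc L..N. f (int j))"
    by (subst (1 2) sum.reindex) (auto simp: inj_on_def assms)
  finally show ?thesis .
qed

text \<open>Distributions on \<^typ>\<open>nat\<close>, with lattice width \<open>a n\<close> after rescaling, whose characteristic
  functions about \<open>n\<close> are Gaussian at scale \<open>1 / r n\<close> and are controlled on bounded windows only.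
  Condition \<open>q_incr\<close> replaces the missing control at high frequencies.\<close>

locale lattice_family =
  fixes q :: "nat \<Rightarrow> nat \<Rightarrow> real" and a r :: "nat \<Rightarrow> real" and s :: real
  assumes a_pos: "a n > 0" and a_lim: "a \<longlonglongrightarrow> 0"
    and r_pos: "r n > 0" and r_lim: "filterlim r at_top sequentially"
    and s_pos: "s > 0"
    and q_nonneg: "q n m \<ge> 0" and q_summable: "summable (q n)"
    and q_incr: "m \<le> m' \<Longrightarrow> q n m * exp (a n * real m) \<le> q n m' * exp (a n * real m')"
    and char_lim: "(\<lambda>n. \<Sum>m. of_real (q n m) * cis (v / r n * a n * (real m - real n)))
                     \<longlonglongrightarrow> of_real (exp (- s * v\<^sup>2))"
    and char_dom: "T > 0 \<Longrightarrow> \<exists>c>0. \<forall>\<^sub>F n in sequentially. \<forall>u. \<bar>u\<bar> \<le> T \<longrightarrow>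
                     norm (\<Sum>m. of_real (q n m) * cis (u * a n * (real m - real n))) \<le> exp (- c * (r n * u)\<^sup>2)"
begin

definition ch :: "nat \<Rightarrow> real \<Rightarrow> complex" where
  "ch n u = (\<Sum>m. of_real (q n m) * cis (u * a n * (real m - real n)))"

text \<open>The window mean of \<open>q n\<close> about \<open>c\<close>. The Fourier transform of the Fejer kernel has bounded
  support, so only the controlled part of \<open>ch n\<close> enters.\<close>

definition W :: "real \<Rightarrow> nat \<Rightarrow> real \<Rightarrow> real" where
  "W T n c = (\<Sum>m. q n m * fejer T (a n * (real m - c)))"

text \<open>The characteristic function recentred from n to c. The real part suffices because it is
  paired with the even function \<open>triangle\<close>.\<close>

definition gshift :: "nat \<Rightarrow> real \<Rightarrow> real \<Rightarrow> real" where
  "gshift n c u = Re (ch n u * cis (u * a n * (real n - c)))"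

lemma gshift_sums: "(\<lambda>m. q n m * cos (u * (a n * (real m - c)))) sums gshift n c u"
proof -
  have "summable (\<lambda>m. norm (complex_of_real (q n m) * cis (u * a n * (real m - real n))))"
    using q_summable q_nonneg by (simp add: norm_mult)
  from summable_sums[OF summable_norm_cancel[OF this]]
  have "(\<lambda>m. of_real (q n m) * cis (u * a n * (real m - real n)) * cis (u * a n * (real n - c))) sums
        (ch n u * cis (u * a n * (real n - c)))"
    unfolding ch_def by (rule sums_mult2)
  also have "(\<lambda>m. of_real (q n m) * cis (u * a n * (real m - real n)) * cis (u * a n * (real n - c))) =
       (\<lambda>m. of_real (q n m) * cis (u * (a n * (real m - c))))"
    by (intro ext) (simp add: mult.assoc cis_mult algebra_simps)
  finally show ?thesis unfolding gshift_def by (drule_tac sums_Re) simp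
qed

lemma gshift_eq: "gshift n c u = (\<Sum>m. q n m * cos (u * (a n * (real m - c))))"
  using gshift_sums by (simp add: sums_iff)

lemma gshift_measurable [measurable]: "gshift n c \<in> borel_measurable borel"
  unfolding gshift_eq[abs_def] by measurable

lemma gshift_le: "\<bar>gshift n c u\<bar> \<le> norm (ch n u)"
proof -
  have "\<bar>gshift n c u\<bar> \<le> norm (ch n u * cis (u * a n * (real n - c)))"
    unfolding gshift_def by (rule abs_Re_le_cmod)
  then show ?thesis by (simp add: norm_mult)
qed

text \<open>Fubini for the sum over m and the integral over u: every term is dominated by
  \<open>q n m * triangle T u\<close>, which is summable in m and integrable in u.\<close>

lemma W_sums:
  assumes T: "T > 0"
  shows "(\<lambda>m. q n m * fejer T (a n * (real m - c))) sums (\<integral>u. triangle T u * gshift n c u \<partial>lborel)"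
proof -
  let ?f = "\<lambda>m u. triangle T u * (q n m * cos (u * (a n * (real m - c))))"
  have int: "integrable lborel (?f m)" for m
    by (rule integrable_triangle_mult[OF T]) (intro continuous_intros)
  have nle: "norm (?f m u) \<le> q n m * triangle T u" for m u
  proof -
    have "norm (?f m u) = (q n m * triangle T u) * \<bar>cos (u * (a n * (real m - c)))\<bar>"
      using q_nonneg[of n m] triangle_bounds(1)[of T u] by (simp add: abs_mult)
    also have "\<dots> \<le> q n m * triangle T u"
      using q_nonneg[of n m] triangle_bounds(1)[of T u] by (intro mult_left_le) auto
    finally show ?thesis .
  qed
  have "(\<lambda>m. integral\<^sup>L lborel (?f m)) sums (\<integral>u. (\<Sum>m. ?f m u) \<partial>lborel)"
  proof (rule sums_integral[OF int])
    show "AE u in lborel. summable (\<lambda>m. norm (?f m u))"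
      using nle q_summable by (intro AE_I2 summable_comparison_test'[OF summable_mult2[OF q_summable]]) auto
    show "summable (\<lambda>m. \<integral>u. norm (?f m u) \<partial>lborel)"
    proof (rule summable_comparison_test')
      show "summable (\<lambda>m. q n m * integral\<^sup>L lborel (triangle T))"
        by (intro summable_mult2 q_summable)
      fix m
      have "(\<integral>u. norm (?f m u) \<partial>lborel) \<le> (\<integral>u. q n m * triangle T u \<partial>lborel)"
        by (intro integral_mono integrable_norm int integrable_mult_right integrable_triangle T nle)
      then show "norm (\<integral>u. norm (?f m u) \<partial>lborel) \<le> q n m * integral\<^sup>L lborel (triangle T)" by simp
    qed
  qed
  moreover have "integral\<^sup>L lborel (?f m) = q n m * fejer T (a n * (real m - c))" for m
  proof -
    have "integral\<^sup>L lborel (?f m) = (\<integral>u. q n m * (triangle T u * cos (u * (a n * (real m - c)))) \<partial>lborel)"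
      by (simp only: mult.left_commute)
    then show ?thesis by (simp only: integral_mult_right_zero integral_triangle_cos[OF T])
  qed
  moreover have "(\<Sum>m. ?f m u) = triangle T u * gshift n c u" for u
    using sums_mult[OF gshift_sums[of n u c], of "triangle T u"] by (simp add: sums_iff)
  ultimately show ?thesis by simp
qed

lemma W_eq: "T > 0 \<Longrightarrow> W T n c = (\<integral>u. triangle T u * gshift n c u \<partial>lborel)"
  unfolding W_def using W_sums by (simp add: sums_iff)

lemma W_rescaled:
  assumes "T > 0"
  shows "r n * W T n c = (\<integral>v. triangle T (v / r n) * gshift n c (v / r n) \<partial>lborel)"
proof -
  have "W T n c = \<bar>1 / r n\<bar> *\<^sub>R (\<integral>v. triangle T (0 + 1 / r n * v) * gshift n c (0 + 1 / r n * v) \<partial>lborel)"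
    unfolding W_eq[OF assms] using r_pos[of n] by (intro lborel_integral_real_affine) auto
  then show ?thesis using r_pos[of n] by simp
qed

text \<open>Recentring multiplies the characteristic function by a phase only, so the Gaussian
  majorant from \<open>char_dom\<close> serves all centres c at once.\<close>

lemma W_bound:
  assumes T: "T > 0"
  shows "\<exists>C>0. \<forall>\<^sub>F n in sequentially. \<forall>c. r n * W T n c \<le> C"
proof -
  obtain d where d: "d > 0" "\<forall>\<^sub>F n in sequentially. \<forall>u. \<bar>u\<bar> \<le> T \<longrightarrow> norm (ch n u) \<le> exp (- d * (r n * u)\<^sup>2)"
    using char_dom[OF T] unfolding ch_def by blast
  let ?C = "\<integral>x. exp (- d * (x::real)\<^sup>2) \<partial>lborel"
  have "\<forall>\<^sub>F n in sequentially. \<forall>c. r n * W T n c \<le> ?C"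
    using d(2)
  proof eventually_elim
    case (elim n)
    show ?case
    proof
      fix c
      show "r n * W T n c \<le> ?C" unfolding W_rescaled[OF T]
      proof (rule integral_mono')
        show "integrable lborel (\<lambda>x. exp (- d * (x::real)\<^sup>2))" by (rule integrable_gauss[OF d(1)])
        fix v :: real
        show "triangle T (v / r n) * gshift n c (v / r n) \<le> exp (- d * v\<^sup>2)"
        proof (cases "\<bar>v / r n\<bar> \<le> T")
          case True
          have "triangle T (v / r n) * gshift n c (v / r n) \<le> triangle T (v / r n) * norm (ch n (v / r n))"
            using gshift_le[of n c "v / r n"] by (intro mult_left_mono triangle_bounds) auto
          also have "\<dots> \<le> 1 * norm (ch n (v / r n))"
            by (intro mult_right_mono triangle_bounds T) auto
          also have "\<dots> \<le> exp (- d * v\<^sup>2)" using elim[rule_format, OF True] r_pos[of n] by simp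
          finally show ?thesis .
        qed (simp add: triangle_eq_0[OF T])
      qed simp
    qed
  qed
  then show ?thesis using integrable_gauss(2)[OF d(1)] by blast
qed

text \<open>Dominated convergence after the substitution u = v / \<open>r n\<close>. A centre within
  bounded distance of n, in units of the lattice width, contributes a phase of size O(1 /
  \<open>r n\<close>), which disappears in the limit.\<close>

lemma W_lim:
  assumes T: "T > 0" and c: "\<And>n. \<bar>a n * (real n - c n)\<bar> \<le> B"
  shows "(\<lambda>n. r n * W T n (c n)) \<longlonglongrightarrow> (\<integral>x. exp (- s * x\<^sup>2) \<partial>lborel)"
proof -
  obtain d where d: "d > 0" "\<forall>\<^sub>F n in sequentially. \<forall>u. \<bar>u\<bar> \<le> T \<longrightarrow> norm (ch n u) \<le> exp (- d * (r n * u)\<^sup>2)"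
    using char_dom[OF T] unfolding ch_def by blast
  obtain N where N: "\<And>n u. n \<ge> N \<Longrightarrow> \<bar>u\<bar> \<le> T \<Longrightarrow> norm (ch n u) \<le> exp (- d * (r n * u)\<^sup>2)"
    using d(2) unfolding eventually_sequentially by blast
  \<comment> \<open>The majorant is valid from the index N on only, and dominated convergence wants
    it everywhere.\<close>
  have "(\<lambda>n. r (n + N) * W T (n + N) (c (n + N))) \<longlonglongrightarrow> (\<integral>x. exp (- s * x\<^sup>2) \<partial>lborel)"
    unfolding W_rescaled[OF T]
  proof (rule integral_dominated_convergence)
    show "integrable lborel (\<lambda>x. exp (- d * (x::real)\<^sup>2))" by (rule integrable_gauss[OF d(1)])
    show "AE v in lborel. norm (triangle T (v / r (n + N)) * gshift (n + N) (c (n + N)) (v / r (n + N))) \<le> exp (- d * v\<^sup>2)" for n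
    proof (rule AE_I2)
      fix v :: real
      let ?n = "n + N"
      show "norm (triangle T (v / r ?n) * gshift ?n (c ?n) (v / r ?n)) \<le> exp (- d * v\<^sup>2)"
      proof (cases "\<bar>v / r ?n\<bar> \<le> T")
        case True
        have "norm (triangle T (v / r ?n) * gshift ?n (c ?n) (v / r ?n)) \<le> 1 * norm (ch ?n (v / r ?n))"
          unfolding real_norm_def abs_mult
          using triangle_bounds[of T "v / r ?n"] T gshift_le by (intro mult_mono) auto
        also have "\<dots> \<le> exp (- d * v\<^sup>2)" using N[of ?n, OF _ True] r_pos[of ?n] by simp
        finally show ?thesis .
      qed (simp add: triangle_eq_0[OF T])
    qed
    show "AE v in lborel. (\<lambda>n. triangle T (v / r (n + N)) * gshift (n + N) (c (n + N)) (v / r (n + N)))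
             \<longlonglongrightarrow> exp (- s * v\<^sup>2)"
    proof (rule AE_I2)
      fix v :: real
      have v0: "(\<lambda>n. v / r n) \<longlonglongrightarrow> 0"
        by (intro tendsto_divide_0[OF tendsto_const] filterlim_at_top_imp_at_infinity r_lim)
      have tri: "(\<lambda>n. triangle T (v / r n)) \<longlonglongrightarrow> 1"
      proof -
        have "isCont (triangle T) 0"
          using continuous_triangle[of UNIV T] by (simp add: continuous_on_eq_continuous_at)
        then have "(\<lambda>n. triangle T (v / r n)) \<longlonglongrightarrow> triangle T 0"
          using v0 by (rule isCont_tendsto_compose)
        then show ?thesis by (simp add: triangle_def)
      qed
      have "(\<lambda>n. v / r n * (a n * (real n - c n))) \<longlonglongrightarrow> 0"
      proof (rule Lim_null_comparison)
        show "\<forall>\<^sub>F n in sequentially. norm (v / r n * (a n * (real n - c n))) \<le> \<bar>v / r n\<bar> * B"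
          unfolding real_norm_def abs_mult[of "v / r _"] using c
          by (intro always_eventually allI mult_left_mono) auto
        show "(\<lambda>n. \<bar>v / r n\<bar> * B) \<longlonglongrightarrow> 0"
          using tendsto_mult_left_zero[OF tendsto_rabs_zero[OF v0]] .
      qed
      moreover have "isCont cis 0"
        using continuous_on_cis[OF continuous_on_id, of UNIV] by (simp add: continuous_on_eq_continuous_at)
      ultimately have "(\<lambda>n. cis (v / r n * (a n * (real n - c n)))) \<longlonglongrightarrow> cis 0"
        by (rule isCont_tendsto_compose[rotated])
      then have "(\<lambda>n. cis (v / r n * (a n * (real n - c n)))) \<longlonglongrightarrow> 1" by simp
      moreover have "(\<lambda>n. ch n (v / r n)) \<longlonglongrightarrow> of_real (exp (- s * v\<^sup>2))"
        using char_lim[of v] by (simp add: ch_def)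
      ultimately have "(\<lambda>n. ch n (v / r n) * cis (v / r n * (a n * (real n - c n)))) \<longlonglongrightarrow> of_real (exp (- s * v\<^sup>2)) * 1"
        by (intro tendsto_mult)
      from tendsto_Re[OF this] have "(\<lambda>n. gshift n (c n) (v / r n)) \<longlonglongrightarrow> exp (- s * v\<^sup>2)"
        by (simp add: gshift_def mult.assoc)
      from tendsto_mult[OF tri this]
      have "(\<lambda>n. triangle T (v / r n) * gshift n (c n) (v / r n)) \<longlonglongrightarrow> exp (- s * v\<^sup>2)" by simp
      then show "(\<lambda>n. triangle T (v / r (n + N)) * gshift (n + N) (c (n + N)) (v / r (n + N))) \<longlonglongrightarrow> exp (- s * v\<^sup>2)"
        by (rule LIMSEQ_ignore_initial_segment)
    qed
  qed measurable
  then show ?thesis by (rule LIMSEQ_offset)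
qed

lemma q_decay:
  assumes "m \<le> m'"
  shows "q n m \<le> q n m' * exp (a n * (real m' - real m))"
proof -
  have "q n m = q n m * exp (a n * real m) * exp (- (a n * real m))" by (simp flip: exp_add add: mult.assoc)
  also have "\<dots> \<le> q n m' * exp (a n * real m') * exp (- (a n * real m))"
    using q_incr[OF assms, of n] by (intro mult_right_mono) auto
  also have "\<dots> = q n m' * exp (a n * (real m' - real m))"
    by (simp flip: exp_add add: mult.assoc algebra_simps)
  finally show ?thesis .
qed

text \<open>By \<open>q_incr\<close> a value at \<open>m0\<close> persists, up to the factor e, over
  the next 1 / \<open>a n\<close> positions, where the Fejer kernel centred at \<open>m0\<close> is
  at least cos 1. So the bounded window mean controls every single value.\<close>

lemma sup_bound: "\<exists>C>0. \<forall>\<^sub>F n in sequentially. \<forall>m. q n m * r n \<le> C * a n"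
proof -
  obtain C where C: "C > 0" "\<forall>\<^sub>F n in sequentially. \<forall>c. r n * W 1 n c \<le> C"
    using W_bound[of 1] by auto
  have c1: "cos 1 > (0::real)" using pi_gt3 by (intro cos_gt_zero_pi) auto
  let ?K = "C * exp 1 / cos 1"
  have "\<forall>\<^sub>F n in sequentially. \<forall>m. q n m * r n \<le> ?K * a n"
    using C(2)
  proof eventually_elim
    case (elim n)
    show ?case
    proof
      fix m0
      define L where "L = nat \<lfloor>1 / a n\<rfloor>"
      have L: "real L \<le> 1 / a n" "1 / a n \<le> real (L + 1)"
        using a_pos[of n] by (auto simp: L_def) linarith+
      have low: "q n m * fejer 1 (a n * (real m - real m0)) \<ge> q n m0 * exp (- 1) * cos 1"
        if "m \<in> {m0..m0+L}" for m
      proof -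
        have b: "a n * (real m - real m0) \<le> 1" "0 \<le> a n * (real m - real m0)"
        proof -
          have "a n * (real m - real m0) \<le> a n * (1 / a n)"
            using that L a_pos[of n] by (intro mult_left_mono) auto
          then show "a n * (real m - real m0) \<le> 1" using a_pos[of n] by simp
          show "0 \<le> a n * (real m - real m0)" using that a_pos[of n] by auto
        qed
        have "q n m0 * exp (- 1) \<le> q n m * exp (a n * (real m - real m0)) * exp (- 1)"
          using that by (intro mult_right_mono q_decay) auto
        also have "\<dots> = q n m * exp (a n * (real m - real m0) - 1)" by (simp flip: exp_add add: mult.assoc)
        also have "\<dots> \<le> q n m" using b q_nonneg[of n m] by (intro mult_left_le) auto
        finally have "q n m0 * exp (- 1) * cos 1 \<le> q n m * cos 1"
          using c1 by (intro mult_right_mono) auto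
        also have "\<dots> \<le> q n m * fejer 1 (a n * (real m - real m0))"
          using b by (intro mult_left_mono fejer_1_ge q_nonneg) auto
        finally show ?thesis .
      qed
      have "real (L + 1) * (q n m0 * exp (- 1) * cos 1) = (\<Sum>m\<in>{m0..m0+L}. q n m0 * exp (- 1) * cos 1)" by simp
      also have "\<dots> \<le> (\<Sum>m\<in>{m0..m0+L}. q n m * fejer 1 (a n * (real m - real m0)))"
        by (intro sum_mono low)
      also have "\<dots> \<le> W 1 n (real m0)"
        unfolding W_def
        by (intro sum_le_suminf sums_summable[OF W_sums]) (auto intro!: mult_nonneg_nonneg q_nonneg fejer_nonneg)
      finally have "r n * (real (L + 1) * (q n m0 * exp (- 1) * cos 1)) \<le> r n * W 1 n (real m0)"
        using r_pos[of n] by (intro mult_left_mono) auto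
      also have "\<dots> \<le> C" using elim by blast
      finally have "r n * (1 / a n * (q n m0 * exp (- 1) * cos 1)) \<le> C"
        using mult_left_mono[OF mult_right_mono[OF L(2), of "q n m0 * exp (- 1) * cos 1"], of "r n"]
          r_pos[of n] q_nonneg[of n m0] c1 by (auto intro: order.trans)
      then show "q n m0 * r n \<le> ?K * a n"
        using a_pos[of n] c1 by (simp add: exp_minus field_simps)
    qed
  qed
  then show ?thesis using C(1) c1 by (intro exI[of _ ?K]) auto
qed

text \<open>Depends on the lattice width but not on \<open>q\<close>. It is therefore shared by two
  families with the same \<open>a\<close> and cancels in their comparison without being
  evaluated.\<close>

definition Rsum :: "real \<Rightarrow> nat \<Rightarrow> nat \<Rightarrow> real" where
  "Rsum T n L = (\<Sum>j\<in>{- int L..int L}. fejer T (a n * of_int j))"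

text \<open>By monotonicity \<open>q n n\<close> is compared with the values to its right in a window centred at \<open>n + L\<close>,
  and with those to its left in one centred at \<open>n - L\<close>.\<close>

lemma W_ge:
  assumes T: "T > 0"
  shows "q n n * exp (- (2 * a n * real L)) * Rsum T n L \<le> W T n (real n + real L)"
proof -
  have "q n n * exp (- (2 * a n * real L)) * Rsum T n L =
      (\<Sum>m\<in>{n..n+2*L}. q n n * exp (- (2 * a n * real L)) * fejer T (a n * (real m - (real n + real L))))"
    unfolding Rsum_def sum_distrib_left
    by (rule sum.reindex_bij_witness[of _ "\<lambda>m. int m - int n - int L" "\<lambda>j. nat (j + int n + int L)"])
       (auto simp: nat_le_iff algebra_simps)
  also have "\<dots> \<le> (\<Sum>m\<in>{n..n+2*L}. q n m * fejer T (a n * (real m - (real n + real L))))"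
  proof (intro sum_mono mult_right_mono fejer_nonneg T)
    fix m assume m: "m \<in> {n..n+2*L}"
    have "q n n * exp (- (2 * a n * real L)) \<le> q n m * exp (a n * (real m - real n)) * exp (- (2 * a n * real L))"
      using m by (intro mult_right_mono q_decay) auto
    also have "\<dots> = q n m * exp (a n * (real m - real n - 2 * real L))"
      by (simp flip: exp_add add: mult.assoc algebra_simps)
    also have "\<dots> \<le> q n m"
      using m a_pos[of n] q_nonneg[of n m] by (intro mult_left_le) (auto simp: mult_le_0_iff)
    finally show "q n n * exp (- (2 * a n * real L)) \<le> q n m" .
  qed
  also have "\<dots> \<le> W T n (real n + real L)"
    unfolding W_def
    by (intro sum_le_suminf sums_summable[OF W_sums]) (auto intro!: mult_nonneg_nonneg q_nonneg fejer_nonneg T)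
  finally show ?thesis .
qed

lemma W_le:
  assumes T: "T > 0" and L: "L > 0" and S: "\<And>m. q n m \<le> S"
  shows "W T n (real n - real L) \<le> q n n * exp (2 * a n * real L) * Rsum T n L + 8 * S / (T * (a n)\<^sup>2 * real L)"
proof -
  have S0: "S \<ge> 0" using S[of 0] q_nonneg[of n 0] by linarith
  \<comment> \<open>A majorant in the offset j from the centre n - L. Inside the window no position
    exceeds n, so monotonicity gives a bound by \<open>q n n\<close>; outside, only the uniform
    bound S and the quadratic decay of the kernel are available.\<close>
  define u where "u j = (if \<bar>j\<bar> \<le> int L then q n n * exp (2 * a n * real L) * fejer T (a n * of_int j)
      else S * (4 / (T * (a n * of_int j)\<^sup>2)))" for j :: int
  have u0: "u j \<ge> 0" for j
    using q_nonneg[of n n] fejer_nonneg[OF T] S0 T by (auto simp: u_def)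
  have point: "q n m * fejer T (a n * (real m - (real n - real L))) \<le> u (int m - int n + int L)" for m
  proof -
    define j where "j = int m - int n + int L"
    have j: "real m - (real n - real L) = of_int j" by (simp add: j_def)
    show ?thesis
    proof (cases "\<bar>j\<bar> \<le> int L")
      case True
      then have m: "m \<le> n" "real n - real m \<le> 2 * real L" by (auto simp: j_def)
      have "q n m \<le> q n n * exp (a n * (real n - real m))" by (rule q_decay[OF m(1)])
      also have "\<dots> \<le> q n n * exp (a n * (2 * real L))"
        using m a_pos[of n] by (intro mult_left_mono q_nonneg) auto
      finally have "q n m * fejer T (a n * of_int j) \<le> q n n * exp (a n * (2 * real L)) * fejer T (a n * of_int j)"
        by (intro mult_right_mono fejer_nonneg T)
      then show ?thesis using True unfolding j by (simp add: u_def j_def[symmetric] mult_ac)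
    next
      case False
      then have "j \<noteq> 0" by auto
      then have "fejer T (a n * of_int j) \<le> 4 / (T * (a n * of_int j)\<^sup>2)"
        using a_pos[of n] by (intro fejer_le T) auto
      then have "q n m * fejer T (a n * of_int j) \<le> S * (4 / (T * (a n * of_int j)\<^sup>2))"
        by (intro mult_mono S S0 fejer_nonneg T)
      then show ?thesis using False unfolding j by (simp add: u_def j_def[symmetric])
    qed
  qed
  show ?thesis unfolding W_def
  proof (rule suminf_le_const[OF sums_summable[OF W_sums[OF T]]])
    fix N
    define K where "K = N + n + L"
    have "(\<Sum>m<N. q n m * fejer T (a n * (real m - (real n - real L)))) \<le> (\<Sum>m<N. u (int m - int n + int L))"
      by (intro sum_mono point)
    also have "\<dots> = sum u ((\<lambda>m. int m - int n + int L) ` {..<N})"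
      by (subst sum.reindex) (auto simp: inj_on_def)
    also have "\<dots> \<le> sum u {- int K..int K}"
      by (intro sum_mono2 u0) (auto simp: K_def)
    also have "{- int K..int K} = {- int L..int L} \<union> {j. int L < \<bar>j\<bar> \<and> \<bar>j\<bar> \<le> int K}"
      by (auto simp: K_def)
    also have "sum u \<dots> = sum u {- int L..int L} + sum u {j. int L < \<bar>j\<bar> \<and> \<bar>j\<bar> \<le> int K}"
    proof (rule sum.union_disjoint)
      show "finite {j. int L < \<bar>j\<bar> \<and> \<bar>j\<bar> \<le> int K}"
        by (rule finite_subset[of _ "{- int K..int K}"]) auto
    qed auto
    also have "sum u {- int L..int L} = q n n * exp (2 * a n * real L) * Rsum T n L"
      unfolding Rsum_def sum_distrib_left by (intro sum.cong) (auto simp: u_def)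
    also have "sum u {j. int L < \<bar>j\<bar> \<and> \<bar>j\<bar> \<le> int K} =
        (\<Sum>j | int L < \<bar>j\<bar> \<and> \<bar>j\<bar> \<le> int K. S * (4 / (T * (a n * of_int j)\<^sup>2)))"
      by (intro sum.cong) (auto simp: u_def)
    also have "\<dots> = 2 * (\<Sum>j=Suc L..K. S * (4 / (T * (a n * of_int (int j))\<^sup>2)))"
      by (rule sum_symmetric_int) simp
    \<comment> \<open>The constant 8 is the 4 of \<open>fejer_le\<close> times the two sides of the
      window.\<close>
    also have "\<dots> = 8 * S / (T * (a n)\<^sup>2) * (\<Sum>j=Suc L..K. 1 / (real j)\<^sup>2)"
      unfolding sum_distrib_left by (intro sum.cong) (auto simp: power_mult_distrib)
    also have "\<dots> \<le> 8 * S / (T * (a n)\<^sup>2) * (1 / real L)"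
      using S0 T by (intro mult_left_mono sum_inverse_squares_le L) auto
    finally show "(\<Sum>m<N. q n m * fejer T (a n * (real m - (real n - real L)))) \<le>
        q n n * exp (2 * a n * real L) * Rsum T n L + 8 * S / (T * (a n)\<^sup>2 * real L)" by simp
  qed
qed

lemma Rsum_pos: "T > 0 \<Longrightarrow> Rsum T n L > 0"
  unfolding Rsum_def by (rule sum_pos2[of _ 0]) (auto intro!: fejer_nonneg, simp add: fejer_def)

end

text \<open>\<open>q' n n\<close> is bounded above through a window to its right,
  \<open>q n n\<close> below through a window to its left. Both window means, times
  \<open>r n\<close>, have the same Gaussian limit D, and both windows carry the same kernel
  sum.\<close>

lemma (in lattice_family) ratio_le:
  fixes q' :: "nat \<Rightarrow> nat \<Rightarrow> real"
  assumes F: "lattice_family q' a r s" and e: "e > 0"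
  shows "\<forall>\<^sub>F n in sequentially. q' n n \<le> (1 + e) * q n n"
proof -
  interpret F: lattice_family q' a r s by (rule F)
  \<comment> \<open>The total loss: exp(2 \<delta>) from monotonicity for each of the two windows, 1
    + \<delta> and 1 - \<delta> from the two limits, and another \<delta> from the tail of the
    kernel.\<close>
  have "((\<lambda>\<delta>::real. exp (4 * \<delta>) * (1 + \<delta>) / (1 - 2 * \<delta>)) \<longlongrightarrow> exp (4 * 0) * (1 + 0) / (1 - 2 * 0)) (at_right 0)"
    by (intro tendsto_intros) auto
  then have "\<forall>\<^sub>F \<delta>::real in at_right 0. exp (4 * \<delta>) * (1 + \<delta>) / (1 - 2 * \<delta>) < 1 + e"
    using e by (intro order_tendstoD) auto
  moreover have "\<forall>\<^sub>F \<delta>::real in at_right 0. \<delta> < 1 / 2 \<and> 0 < \<delta>"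
    by (auto simp: eventually_at_right_less intro!: eventually_conj eventually_at_rightI[of 0 "1/2"])
  ultimately have "\<forall>\<^sub>F \<delta>::real in at_right 0. exp (4 * \<delta>) * (1 + \<delta>) / (1 - 2 * \<delta>) < 1 + e \<and> \<delta> < 1 / 2 \<and> 0 < \<delta>"
    by (rule eventually_conj)
  then obtain \<delta> where \<delta>: "exp (4 * \<delta>) * (1 + \<delta>) / (1 - 2 * \<delta>) < 1 + e" "\<delta> < 1 / 2" "0 < \<delta>"
    using eventually_happens'[OF trivial_limit_at_right_real] by blast
  define D where "D = (\<integral>x. exp (- s * (x::real)\<^sup>2) \<partial>lborel)"
  have D: "D > 0" unfolding D_def by (rule integrable_gauss(2)[OF s_pos])
  obtain C where C: "C > 0" "\<forall>\<^sub>F n in sequentially. \<forall>m. q n m * r n \<le> C * a n"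
    using sup_bound by blast
  \<comment> \<open>Chosen so that the kernel tail 8 C / (T \<delta> / 2) equals \<delta> D. The
    half-length of the window is about \<delta> / \<open>a n\<close>, so a fixed but large T must
    make the kernel narrow inside it.\<close>
  define T where "T = 16 * C / (\<delta> * (\<delta> * D))"
  have T: "T > 0" using C D \<delta> by (simp add: T_def)
  define L where "L n = nat \<lfloor>\<delta> / a n\<rfloor>" for n
  have L: "real (L n) \<le> \<delta> / a n" "\<delta> / a n \<le> real (L n) + 1" for n
    using a_pos[of n] \<delta> by (auto simp: L_def)
  have aL: "a n * real (L n) \<le> \<delta>" for n
    using L(1)[of n] a_pos[of n] by (simp add: field_simps)
  have W1: "(\<lambda>n. r n * F.W T n (real n + real (L n))) \<longlonglongrightarrow> D" unfolding D_def
    by (rule F.W_lim[OF T, where B = \<delta>]) (use aL a_pos in \<open>auto simp: abs_mult less_imp_le\<close>)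
  have W2: "(\<lambda>n. r n * W T n (real n - real (L n))) \<longlonglongrightarrow> D" unfolding D_def
    by (rule W_lim[OF T, where B = \<delta>]) (use aL a_pos in \<open>auto simp: abs_mult less_imp_le\<close>)
  have "D < D * (1 + \<delta>)" "D * (1 - \<delta>) < D" using D \<delta> by auto
  note ev = order_tendstoD(2)[OF W1 this(1)] order_tendstoD(1)[OF W2 this(2)]
  have "\<forall>\<^sub>F n in sequentially. a n < \<delta> / 2"
    using \<delta> by (intro order_tendstoD(2)[OF a_lim]) auto
  with ev C(2) show ?thesis
  proof eventually_elim
    case (elim n)
    have aL2: "a n * real (L n) \<ge> \<delta> / 2"
    proof -
      have "\<delta> \<le> a n * (real (L n) + 1)" using L(2)[of n] a_pos[of n] by (simp add: field_simps)
      then show ?thesis using elim by (simp add: algebra_simps)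
    qed
    then have L0: "L n > 0" using \<delta> by (cases "L n") auto
    define R where "R = Rsum T n (L n)"
    have R: "R > 0" unfolding R_def by (rule Rsum_pos[OF T])
    have FR: "F.Rsum T n (L n) = R" by (simp add: R_def Rsum_def F.Rsum_def)
    have e2: "exp (- (2 * \<delta>)) \<le> exp (- (2 * a n * real (L n)))" "exp (2 * a n * real (L n)) \<le> exp (2 * \<delta>)"
      using aL[of n] by auto
    have up: "r n * (q' n n * exp (- (2 * \<delta>)) * R) \<le> D * (1 + \<delta>)"
    proof -
      have "q' n n * exp (- (2 * \<delta>)) * R \<le> q' n n * exp (- (2 * a n * real (L n))) * R"
        using R e2 by (intro mult_right_mono mult_left_mono F.q_nonneg) auto
      also have "\<dots> \<le> F.W T n (real n + real (L n))"
        using F.W_ge[OF T, of n "L n"] by (simp add: FR)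
      finally have "r n * (q' n n * exp (- (2 * \<delta>)) * R) \<le> r n * F.W T n (real n + real (L n))"
        using r_pos[of n] by (intro mult_left_mono) auto
      then show ?thesis using elim by linarith
    qed
    have low: "D * (1 - 2 * \<delta>) \<le> r n * (q n n * exp (2 * \<delta>) * R)"
    proof -
      have S: "q n m \<le> C * a n / r n" for m
        using elim(3)[rule_format, of m] r_pos[of n] by (simp add: field_simps)
      have "W T n (real n - real (L n)) \<le> q n n * exp (2 * a n * real (L n)) * R + 8 * (C * a n / r n) / (T * (a n)\<^sup>2 * real (L n))"
        unfolding R_def by (rule W_le[OF T L0 S])
      also have "\<dots> \<le> q n n * exp (2 * \<delta>) * R + 8 * (C * a n / r n) / (T * (a n)\<^sup>2 * real (L n))"
        using R e2 by (intro add_right_mono mult_right_mono mult_left_mono q_nonneg) auto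
      finally have "r n * W T n (real n - real (L n)) \<le>
          r n * (q n n * exp (2 * \<delta>) * R + 8 * (C * a n / r n) / (T * (a n)\<^sup>2 * real (L n)))"
        using r_pos[of n] by (intro mult_left_mono) auto
      also have "\<dots> = r n * (q n n * exp (2 * \<delta>) * R) + 8 * C / (T * (a n * real (L n)))"
        using r_pos[of n] a_pos[of n] by (simp add: distrib_left power2_eq_square)
      also have "8 * C / (T * (a n * real (L n))) \<le> 8 * C / (T * (\<delta> / 2))"
        using aL2 T C \<delta> by (intro divide_left_mono mult_left_mono) auto
      also have "8 * C / (T * (\<delta> / 2)) = \<delta> * D"
        using C \<delta> D by (simp add: T_def)
      finally show ?thesis using elim(2) by (simp add: algebra_simps)
    qed
    define X where "X = r n * R * exp (2 * \<delta>)"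
    have X: "X > 0" using r_pos[of n] R by (simp add: X_def)
    have "exp (4 * \<delta>) = exp (2 * \<delta>) * exp (2 * \<delta>)" by (simp flip: exp_add)
    then have up': "q' n n * X \<le> exp (4 * \<delta>) * (D * (1 + \<delta>))"
      using mult_left_mono[OF up, of "exp (4 * \<delta>)"] by (simp add: X_def exp_minus field_simps)
    have low': "D \<le> q n n * X / (1 - 2 * \<delta>)"
      using low \<delta> by (simp add: X_def field_simps)
    have "q' n n * X \<le> exp (4 * \<delta>) * ((q n n * X / (1 - 2 * \<delta>)) * (1 + \<delta>))"
      using up' low' \<delta> by (meson add_nonneg_nonneg exp_ge_zero less_imp_le mult_left_mono mult_right_mono order.trans zero_le_one)
    also have "\<dots> = (exp (4 * \<delta>) * (1 + \<delta>) / (1 - 2 * \<delta>)) * (q n n * X)" by simp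
    also have "\<dots> \<le> (1 + e) * (q n n * X)"
      using \<delta> X q_nonneg[of n n] by (intro mult_right_mono) auto
    finally have "q' n n * X \<le> ((1 + e) * q n n) * X" by (simp only: mult.assoc)
    then show ?case using X by simp
  qed
qed

text \<open>The one-sided comparison applies with the roles of the families exchanged as
  well.\<close>

lemma (in lattice_family) ratio_tendsto:
  assumes F: "lattice_family q' a r s" and pos: "\<forall>\<^sub>F n in sequentially. q n n > 0"
  shows "(\<lambda>n. q' n n / q n n) \<longlonglongrightarrow> 1"
proof (rule tendstoI)
  fix e :: real assume e: "e > 0"
  interpret F: lattice_family q' a r s by (rule F)
  have 1: "\<forall>\<^sub>F n in sequentially. q' n n \<le> (1 + e / 2) * q n n"
    using e by (intro ratio_le F) auto
  have 2: "\<forall>\<^sub>F n in sequentially. q n n \<le> (1 + e / 2) * q' n n"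
    using e by (intro F.ratio_le lattice_family_axioms) auto
  from 1 2 pos show "\<forall>\<^sub>F n in sequentially. dist (q' n n / q n n) 1 < e"
  proof eventually_elim
    case (elim n)
    define x where "x = q' n n / q n n"
    have "x \<le> 1 + e / 2" using elim by (simp add: x_def field_simps)
    moreover have "1 \<le> x + e / 2 * x" using elim by (simp add: x_def field_simps)
    moreover have "e / 2 * x \<le> e / 2" if "x \<le> 1"
      using mult_left_mono[OF that, of "e / 2"] e by simp
    ultimately show ?case unfolding x_def[symmetric] dist_real_def using e by linarith
  qed
qed

section \<open>Sums over multiples and first-order asymptotics\<close>

text \<open>The function has its maximum at u = a / b; the inequality ln x \<le> x - 1 at x = u b /
  a gives the bound without differentiation.\<close>

lemma powr_exp_bounded:
  fixes a b :: real
  assumes "a \<ge> 0" "b > 0"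
  obtains K where "K > 0" "\<And>u. u > 0 \<Longrightarrow> u powr a * exp (- (b * u)) \<le> K"
proof (cases "a = 0")
  case True
  show ?thesis by (rule that[of 1]) (use True assms in auto)
next
  case False
  then have a: "a > 0" using assms by simp
  show ?thesis
  proof (rule that[of "exp (a * ln (a / b))"])
    fix u :: real assume u: "u > 0"
    have "ln (u * b / a) \<le> u * b / a - 1"
      using u a assms by (intro ln_le_minus_one) auto
    then have "a * ln (u * b / a) \<le> u * b - a"
      using mult_left_mono[of _ _ a] a by (fastforce simp: right_diff_distrib)
    moreover have "ln (u * b / a) = ln u - ln (a / b)"
      using u a assms by (simp add: ln_div ln_mult)
    ultimately have "a * ln u - b * u \<le> a * ln (a / b)"
      using a by (simp only: right_diff_distrib) (simp add: mult.commute)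
    then show "u powr a * exp (- (b * u)) \<le> exp (a * ln (a / b))"
      using u by (simp add: powr_def flip: exp_add)
  qed auto
qed

lemma set_integrable_Gamma_complex:
  assumes "Re z > 0" "b > 0"
  shows "set_integrable lborel {0<..} (\<lambda>t. complex_of_real t powr (z - 1) * of_real (exp (- (b * t))))"
proof -
  have "set_integrable lebesgue {0<..} (\<lambda>t. complex_of_real t powr (z - 1) / of_real (exp (b * t)))"
    by (rule absolutely_integrable_Gamma_integral[OF assms])
  then have "set_integrable lborel {0<..} (\<lambda>t. complex_of_real t powr (z - 1) / of_real (exp (b * t)))"
    unfolding set_integrable_def by (subst (asm) integrable_completion) auto
  then show ?thesis by (simp add: exp_minus divide_inverse)
qed

lemma norm_of_real_powr: "t > 0 \<Longrightarrow> norm (complex_of_real t powr z) = t powr Re z"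
  by (simp add: norm_powr_real_powr)

lemma set_integrable_Gamma:
  fixes s b :: real
  assumes "s > 0" "b > 0"
  shows "set_integrable lborel {0<..} (\<lambda>t. t powr (s - 1) * exp (- (b * t)))"
proof -
  have "set_integrable lborel {0<..} (\<lambda>t. norm (complex_of_real t powr (of_real s - 1) * of_real (exp (- (b * t)))))"
    by (intro set_integrable_norm set_integrable_Gamma_complex) (use assms in auto)
  also have "?this \<longleftrightarrow> ?thesis"
    by (intro set_integrable_cong) (auto simp: norm_mult norm_of_real_powr)
  finally show ?thesis .
qed

lemma set_integral_Gamma:
  assumes z: "Re z > 0" and b: "b > 0"
  shows "(LINT t:{0<..}|lborel. complex_of_real t powr (z - 1) * of_real (exp (- (b * t)))) = Gamma z * of_real b powr (- z)"
proof -
  have 1: "(LINT t:{0<..}|lborel. complex_of_real t powr (z - 1) * of_real (exp (- t))) = Gamma z"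
  proof -
    have "set_integrable lborel {0<..} (\<lambda>t. complex_of_real t powr (z - 1) * of_real (exp (- t)))"
      using set_integrable_Gamma_complex[OF z, of 1] by simp
    from set_borel_integral_eq_integral(2)[OF this] Gamma_integral_complex'[OF z]
    show ?thesis by (simp add: exp_minus divide_inverse integral_unique)
  qed
  have "Gamma z = \<bar>b\<bar> *\<^sub>R (\<integral>t. indicator {0<..} (0 + b * t) *\<^sub>R (complex_of_real (0 + b * t) powr (z - 1) * of_real (exp (- (0 + b * t)))) \<partial>lborel)"
    unfolding 1[symmetric] set_lebesgue_integral_def
    by (rule lborel_integral_real_affine) (use b in auto)
  also have "(\<lambda>t. indicator {0<..} (0 + b * t) *\<^sub>R (complex_of_real (0 + b * t) powr (z - 1) * of_real (exp (- (0 + b * t))))) =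
      (\<lambda>t. of_real b powr (z - 1) * (indicator {0<..} t *\<^sub>R (complex_of_real t powr (z - 1) * of_real (exp (- (b * t))))))"
  proof
    fix t :: real
    show "indicator {0<..} (0 + b * t) *\<^sub>R (complex_of_real (0 + b * t) powr (z - 1) * of_real (exp (- (0 + b * t)))) =
      of_real b powr (z - 1) * (indicator {0<..} t *\<^sub>R (complex_of_real t powr (z - 1) * of_real (exp (- (b * t)))))"
      using b by (cases "t > 0") (simp_all add: powr_times_real indicator_def zero_less_mult_iff)
  qed
  finally have "Gamma z = of_real b powr z * (LINT t:{0<..}|lborel. complex_of_real t powr (z - 1) * of_real (exp (- (b * t))))"
    using b unfolding set_lebesgue_integral_def integral_mult_right_zero by (simp add: powr_diff scaleR_conv_of_real)
  then show ?thesis using b by (simp add: powr_minus field_simps)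
qed

text \<open>The Riemann sum is exactly the integral of the step function that takes the value of g
  at the right end of each cell. Right ends lie beyond u, so the decreasing majorant \<phi>
  dominates all step functions simultaneously, even if g is unbounded near 0.\<close>

lemma riemann_sum_limit:
  fixes g \<phi> :: "real \<Rightarrow> real"
  assumes gm [measurable]: "g \<in> borel_measurable borel" and cont: "\<And>u. u > 0 \<Longrightarrow> isCont g u"
    and dom: "\<And>u. u > 0 \<Longrightarrow> \<bar>g u\<bar> \<le> \<phi> u"
    and anti: "\<And>u v. 0 < u \<Longrightarrow> u \<le> v \<Longrightarrow> \<phi> v \<le> \<phi> u"
    and int: "set_integrable lborel {0<..} \<phi>"
    and summ: "\<And>t. t > 0 \<Longrightarrow> summable (\<lambda>r. g (real (Suc r) * t))"
  shows "((\<lambda>t. t * (\<Sum>r. g (real (Suc r) * t))) \<longlongrightarrow> (LINT u:{0<..}|lborel. g u)) (at_right 0)"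
proof -
  define S where "S t u = g (t * of_int \<lceil>u / t\<rceil>)" for t u :: real
  have [measurable]: "S t \<in> borel_measurable borel" for t unfolding S_def by measurable
  have ceil: "0 < u" "u \<le> t * of_int \<lceil>u / t\<rceil>" "t * of_int \<lceil>u / t\<rceil> \<le> u + t" if "t > 0" "u > 0" for t u :: real
  proof -
    have "u / t \<le> of_int \<lceil>u / t\<rceil>" by (rule le_of_int_ceiling)
    then show "u \<le> t * of_int \<lceil>u / t\<rceil>" using that by (simp only: pos_divide_le_eq mult.commute)
    have "of_int \<lceil>u / t\<rceil> \<le> u / t + 1" by linarith
    then have "t * of_int \<lceil>u / t\<rceil> \<le> t * (u / t + 1)" using that by (intro mult_left_mono) auto
    then show "t * of_int \<lceil>u / t\<rceil> \<le> u + t" using that by (simp add: distrib_left)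
  qed (use that in auto)
  have Sdom: "\<bar>S t u\<bar> \<le> \<phi> u" if "t > 0" "u > 0" for t u
  proof -
    have "\<bar>S t u\<bar> \<le> \<phi> (t * of_int \<lceil>u / t\<rceil>)"
      unfolding S_def using ceil[OF that] by (intro dom) linarith
    also have "\<dots> \<le> \<phi> u" using ceil[OF that] by (intro anti)
    finally show ?thesis .
  qed
  have Sint: "set_integrable lborel {0<..} (S t)" if "t > 0" for t
  proof (rule set_integrable_bound[OF int])
    show "AE u in lborel. u \<in> {0<..} \<longrightarrow> norm (S t u) \<le> norm (\<phi> u)"
      using Sdom[OF that] by (auto intro!: AE_I2 order.trans[OF _ abs_ge_self])
  qed (simp add: set_borel_measurable_def)
  have sum: "t * (\<Sum>r. g (real (Suc r) * t)) = (LINT u:{0<..}|lborel. S t u)" if t: "t > 0" for t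
  proof -
    define A where "A r = {real r * t<..real (Suc r) * t}" for r
    have UA: "(\<Union>r. A r) = {0<..}"
    proof (intro equalityI subsetI)
      fix u assume "u \<in> (\<Union>r. A r)"
      then obtain r where "real r * t < u" by (auto simp: A_def)
      moreover have "0 \<le> real r * t" using t by simp
      ultimately show "u \<in> {0<..}" by (simp only: greaterThan_iff)
    next
      fix u :: real assume u: "u \<in> {0<..}"
      define r where "r = nat (\<lceil>u / t\<rceil> - 1)"
      have "\<lceil>u / t\<rceil> \<ge> 1" using u t by simp
      then have r: "of_int \<lceil>u / t\<rceil> = real r + 1" by (simp add: r_def)
      have "u / t \<le> real r + 1" "real r < u / t" using r by linarith+
      then have "u \<in> A r" using t by (simp add: A_def field_simps)
      then show "u \<in> (\<Union>r. A r)" by blast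
    qed
    have ceilA: "of_int \<lceil>u / t\<rceil> = real (Suc r)" if "u \<in> A r" for u r
    proof -
      have "real r < u / t" "u / t \<le> real (Suc r)" using that t by (auto simp: A_def field_simps)
      then have "\<lceil>u / t\<rceil> = int (Suc r)" by (intro ceiling_unique) auto
      then show ?thesis by simp
    qed
    have disj: "A i \<inter> A j = {}" if "i \<noteq> j" for i j
      using ceilA[of _ i] ceilA[of _ j] that by (metis Suc_inject disjoint_iff of_nat_eq_iff)
    have "(LINT u:{0<..}|lborel. S t u) = (\<Sum>r. LINT u:A r|lborel. S t u)"
      unfolding UA[symmetric]
      by (rule lebesgue_integral_countable_add) (use disj Sint[OF t] UA in \<open>auto simp: A_def\<close>)
    also have "(\<lambda>r. LINT u:A r|lborel. S t u) = (\<lambda>r. t * g (real (Suc r) * t))"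
    proof
      fix r
      have "(LINT u:A r|lborel. S t u) = (LINT u:A r|lborel. g (real (Suc r) * t))"
        by (rule set_lebesgue_integral_cong) (auto simp: S_def ceilA mult.commute, simp add: A_def)
      also have "\<dots> = measure lborel (A r) * g (real (Suc r) * t)"
        using t by (simp add: set_lebesgue_integral_def A_def algebra_simps)
      also have "measure lborel (A r) = t" using t by (simp add: A_def algebra_simps)
      finally show "(LINT u:A r|lborel. S t u) = t * g (real (Suc r) * t)" .
    qed
    also have "(\<Sum>r. t * g (real (Suc r) * t)) = t * (\<Sum>r. g (real (Suc r) * t))"
      by (rule suminf_mult[OF summ[OF t]])
    finally show ?thesis ..
  qed
  show ?thesis unfolding tendsto_at_iff_sequentially
  proof (intro allI impI)
    fix X :: "nat \<Rightarrow> real" assume X: "\<forall>i. X i \<in> {0<..} - {0}" "X \<longlonglongrightarrow> 0"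
    then have Xp: "X i > 0" for i by auto
    have "(\<lambda>i. LINT u:{0<..}|lborel. S (X i) u) \<longlonglongrightarrow> (LINT u:{0<..}|lborel. g u)"
      unfolding set_lebesgue_integral_def
    proof (rule integral_dominated_convergence)
      show "integrable lborel (\<lambda>u. indicator {0<..} u *\<^sub>R \<phi> u)" using int by (simp add: set_integrable_def)
      show "AE u in lborel. norm (indicator {0<..} u *\<^sub>R S (X i) u) \<le> indicator {0<..} u *\<^sub>R \<phi> u" for i
        using Sdom[OF Xp] by (auto intro!: AE_I2 simp: indicator_def)
      show "AE u in lborel. (\<lambda>i. indicator {0<..} u *\<^sub>R S (X i) u) \<longlonglongrightarrow> indicator {0<..} u *\<^sub>R g u"
      proof (rule AE_I2)
        fix u :: real
        show "(\<lambda>i. indicator {0<..} u *\<^sub>R S (X i) u) \<longlonglongrightarrow> indicator {0<..} u *\<^sub>R g u"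
        proof (cases "u > 0")
          case True
          have "(\<lambda>i. X i * of_int \<lceil>u / X i\<rceil>) \<longlonglongrightarrow> u"
          proof (rule tendsto_sandwich[where f = "\<lambda>_. u" and h = "\<lambda>i. u + X i"])
            show "(\<lambda>i. u + X i) \<longlonglongrightarrow> u" using tendsto_add[OF tendsto_const X(2), of u] by simp
          qed (use ceil[OF Xp True] in \<open>auto intro!: always_eventually\<close>)
          then have "(\<lambda>i. g (X i * of_int \<lceil>u / X i\<rceil>)) \<longlonglongrightarrow> g u"
            by (rule isCont_tendsto_compose[OF cont[OF True]])
          then show ?thesis using True by (simp add: S_def)
        qed simp
      qed
    qed measurable
    then show "((\<lambda>t. t * (\<Sum>r. g (real (Suc r) * t))) \<circ> X) \<longlonglongrightarrow> (LINT u:{0<..}|lborel. g u)"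
      by (simp only: o_def sum[OF Xp])
  qed
qed

lemma summable_Suc_powr: "q < -1 \<Longrightarrow> summable (\<lambda>r. real (Suc r) powr q)"
  by (subst summable_Suc_iff[of "\<lambda>r. real r powr q"]) (simp add: summable_real_powr_iff)

lemma at_right_0_mult: "k > 0 \<Longrightarrow> filterlim (\<lambda>t. k * t) (at_right 0) (at_right (0::real))"
  unfolding filterlim_at
proof
  assume "k > 0"
  then show "\<forall>\<^sub>F t in at_right 0. k * t \<in> {0<..} \<and> k * t \<noteq> 0"
    by (intro eventually_mono[OF eventually_at_right_less]) auto
qed (auto intro!: tendsto_eq_intros)

lemma tendsto_powr_at_right_0: "q > 0 \<Longrightarrow> ((\<lambda>t. t powr q) \<longlongrightarrow> 0) (at_right (0::real))"
  by real_asymp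

context part_seq_summable
begin

lemma isCont_Theta:
  assumes "u > 0"
  shows "isCont \<theta> u"
proof -
  have "uniform_limit {u/2<..} (\<lambda>n t. \<Sum>j<n. exp (- real (\<Lambda> j) * t)) \<theta> sequentially"
    unfolding Theta_def[abs_def]
  proof (rule Weierstrass_m_test[OF _ summ[of "u / 2"]])
    fix n t assume "t \<in> {u / 2<..}"
    then have "real (\<Lambda> n) * (u / 2) \<le> real (\<Lambda> n) * t" by (intro mult_left_mono) auto
    then show "norm (exp (- real (\<Lambda> n) * t)) \<le> exp (- real (\<Lambda> n) * (u / 2))" by simp
  qed (use assms in auto)
  then have "continuous_on {u/2<..} \<theta>"
    by (rule uniform_limit_theorem[rotated]) (auto intro!: always_eventually continuous_intros)
  then show ?thesis using assms by (simp add: continuous_on_eq_continuous_at)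
qed

lemma Theta_measurable [measurable]: "\<theta> \<in> borel_measurable borel"
  unfolding Theta_def[abs_def] by measurable

end

text \<open>Only the leading behaviour of \<open>Theta\<close> at 0 is assumed here, together with
  an element 1 of the sequence. The local limit theorem and the saddle point need nothing
  more.\<close>

locale first_order = part_seq_summable +
  fixes \<mu> c :: real
  assumes mu: "\<mu> > 0" and c: "c > 0" and Theta_lim: "((\<lambda>t. t powr \<mu> * \<theta> t) \<longlongrightarrow> c) (at_right 0)"
    and one: "1 \<in> range \<Lambda>"
begin

text \<open>Near 0 this is the leading term. Away from 0 one half of the decay exp(-t) absorbs the
  power of t and the other half remains.\<close>

lemma Theta_bound: "\<exists>C>0. \<forall>t>0. \<theta> t \<le> C * t powr (- \<mu>) * exp (- (t / 2))"
proof -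
  have "\<forall>\<^sub>F t in at_right 0. t powr \<mu> * \<theta> t < c + 1"
    using Theta_lim by (rule order_tendstoD) auto
  then obtain d0 where d0: "d0 > 0" "\<And>t. 0 < t \<Longrightarrow> t < d0 \<Longrightarrow> t powr \<mu> * \<theta> t < c + 1"
    unfolding eventually_at_right_field by blast
  define d where "d = min (d0 / 2) 1"
  have d: "d > 0" "d < d0" "d \<le> 1" using d0 by (auto simp: d_def)
  obtain K where K: "K > 0" "\<And>u. u > 0 \<Longrightarrow> u powr \<mu> * exp (- (1 / 2 * u)) \<le> K"
    by (rule powr_exp_bounded[of \<mu> "1 / 2"]) (use mu in simp_all)
  define C where "C = (c + 1) * exp (1 / 2) + exp d * \<theta> d * K"
  have C: "C > 0" unfolding C_def using c K Theta_pos[OF d(1)] by (intro add_pos_pos mult_pos_pos) simp_all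
  have "\<theta> t \<le> C * t powr (- \<mu>) * exp (- (t / 2))" if t: "t > 0" for t
  proof (cases "t \<le> d")
    case True
    have "\<theta> t \<le> (c + 1) * t powr (- \<mu>)"
      using d0(2)[of t] t True d by (simp add: powr_minus field_simps)
    also have "\<dots> \<le> (c + 1) * t powr (- \<mu>) * (exp (1 / 2) * exp (- (t / 2)))"
    proof -
      have "1 \<le> exp (1 / 2) * exp (- (t / 2))" using True d by (simp flip: exp_add)
      then show ?thesis using mult_left_mono[of 1 _ "(c + 1) * t powr (- \<mu>)"] c by simp
    qed
    also have "\<dots> = (c + 1) * exp (1 / 2) * t powr (- \<mu>) * exp (- (t / 2))" by simp
    also have "\<dots> \<le> C * t powr (- \<mu>) * exp (- (t / 2))"
      unfolding C_def using K d Theta_pos[of d] by (intro mult_right_mono) auto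
    finally show ?thesis .
  next
    case False
    then have "\<theta> t \<le> exp (- (t - d)) * \<theta> d" by (intro Theta_decay d) auto
    also have "exp (- (t - d)) = exp d * exp (- (1 / 2 * t)) * exp (- (t / 2))" by (simp flip: exp_add)
    also have "exp (- (1 / 2 * t)) \<le> K * t powr (- \<mu>)"
      using K(2)[OF t] t by (simp add: powr_minus field_simps)
    also have "exp d * (K * t powr (- \<mu>)) * exp (- (t / 2)) * \<theta> d = exp d * \<theta> d * K * t powr (- \<mu>) * exp (- (t / 2))" by simp
    also have "\<dots> \<le> C * t powr (- \<mu>) * exp (- (t / 2))"
      unfolding C_def using c by (intro mult_right_mono) auto
    finally show ?thesis using Theta_pos[OF d(1)] by simp
  qed
  with C show ?thesis by blast
qed

text \<open>Any exponent from \<mu> on is possible globally: near 0 the larger power is weaker, and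
  at infinity the exponential decay covers it.\<close>

lemma Theta_le_powr:
  assumes "m \<ge> \<mu>"
  obtains C where "C > 0" "\<And>t. t > 0 \<Longrightarrow> \<theta> t \<le> C * t powr (- m)"
proof -
  obtain C where C: "C > 0" "\<And>t. t > 0 \<Longrightarrow> \<theta> t \<le> C * t powr (- \<mu>) * exp (- (t / 2))"
    using Theta_bound by blast
  obtain K where K: "K > 0" "\<And>u. u > 0 \<Longrightarrow> u powr (m - \<mu>) * exp (- (1 / 2 * u)) \<le> K"
    by (rule powr_exp_bounded[of "m - \<mu>" "1 / 2"]) (use assms in simp_all)
  show ?thesis
  proof (rule that[of "C * K"])
    fix t :: real assume t: "t > 0"
    have "\<theta> t \<le> C * t powr (- \<mu>) * exp (- (t / 2))" by (rule C(2)[OF t])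
    also have "t powr (- \<mu>) = t powr (m - \<mu>) * t powr (- m)" using t by (simp flip: powr_add)
    also have "C * (t powr (m - \<mu>) * t powr (- m)) * exp (- (t / 2)) = C * (t powr (m - \<mu>) * exp (- (1 / 2 * t))) * t powr (- m)"
      by simp
    also have "\<dots> \<le> C * K * t powr (- m)"
      using C K(2)[OF t] by (intro mult_right_mono mult_left_mono) auto
    finally show "\<theta> t \<le> C * K * t powr (- m)" .
  qed (use C K in auto)
qed

lemma kap_le:
  assumes p: "p < \<mu> - 1"
  obtains K where "K > 0" "\<And>t. t > 0 \<Longrightarrow> t powr \<mu> * kap p t \<le> K"
proof -
  obtain C where C: "C > 0" "\<And>t. t > 0 \<Longrightarrow> \<theta> t \<le> C * t powr (- \<mu>)"
    using Theta_le_powr[of \<mu>] by auto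
  have sm: "summable (\<lambda>r. real (Suc r) powr (p - \<mu>))" using p by (intro summable_Suc_powr) auto
  define K where "K = C * (\<Sum>r. real (Suc r) powr (p - \<mu>))"
  show ?thesis
  proof (rule that[of K])
    have "(\<Sum>r. real (Suc r) powr (p - \<mu>)) > 0" by (rule suminf_pos[OF sm]) simp
    then show "K > 0" using C by (simp add: K_def)
    fix t :: real assume t: "t > 0"
    have "kap p t \<le> (\<Sum>r. (C * t powr (- \<mu>)) * real (Suc r) powr (p - \<mu>))"
      unfolding kap_def
    proof (rule suminf_le[OF _ summable_Theta[OF t] summable_mult[OF sm]])
      fix r
      have "real (Suc r) powr p * \<theta> (real (Suc r) * t) \<le> real (Suc r) powr p * (C * (real (Suc r) * t) powr (- \<mu>))"
        using t by (intro mult_left_mono C) auto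
      also have "\<dots> = (C * t powr (- \<mu>)) * (real (Suc r) powr p * real (Suc r) powr (- \<mu>))"
        using t by (subst powr_mult) auto
      also have "real (Suc r) powr p * real (Suc r) powr (- \<mu>) = real (Suc r) powr (p - \<mu>)" by (simp flip: powr_add)
      finally show "real (Suc r) powr p * \<theta> (real (Suc r) * t) \<le> (C * t powr (- \<mu>)) * real (Suc r) powr (p - \<mu>)" .
    qed
    also have "\<dots> = t powr (- \<mu>) * K" unfolding suminf_mult[OF sm] K_def by simp
    finally have "t powr \<mu> * kap p t \<le> t powr \<mu> * (t powr (- \<mu>) * K)" by (intro mult_left_mono) auto
    also have "\<dots> = K" using t by (simp flip: powr_add mult.assoc)
    finally show "t powr \<mu> * kap p t \<le> K" .
  qed
qed

lemma kap_pos: "t > 0 \<Longrightarrow> kap p t > 0"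
  unfolding kap_def using Theta_pos by (intro suminf_pos summable_Theta) auto

text \<open>Tannery's theorem: the terms are dominated by r to the power p - \<mu>, and each
  converges separately. The case p = -1 gives the growth of log \<open>T\<^sub>0\<close>; for \<mu>
  > 1 the case p = 0 produces the value of the Riemann zeta function at \<mu>.\<close>

lemma kap_lim_small:
  assumes p: "p < \<mu> - 1"
  shows "((\<lambda>t. t powr \<mu> * kap p t) \<longlongrightarrow> c * (\<Sum>r. real (Suc r) powr (p - \<mu>))) (at_right 0)"
proof -
  obtain C where C: "C > 0" "\<And>t. t > 0 \<Longrightarrow> \<theta> t \<le> C * t powr (- \<mu>)"
    using Theta_le_powr[of \<mu>] by auto
  define a where "a r t = real (Suc r) powr (p - \<mu>) * ((real (Suc r) * t) powr \<mu> * \<theta> (real (Suc r) * t))" for r t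
  have pos: "\<forall>\<^sub>F t in at_right (0::real). t > 0" by (simp add: eventually_at_right_less)
  have "norm (a r t) \<le> C * real (Suc r) powr (p - \<mu>)" if t: "t > 0" for r t
  proof -
    have rt: "real (Suc r) * t > 0" using t by simp
    have "(real (Suc r) * t) powr \<mu> * \<theta> (real (Suc r) * t) \<le> C"
      using C(2)[OF rt] rt by (simp add: powr_minus field_simps)
    then have "real (Suc r) powr (p - \<mu>) * ((real (Suc r) * t) powr \<mu> * \<theta> (real (Suc r) * t)) \<le> real (Suc r) powr (p - \<mu>) * C"
      by (intro mult_left_mono) auto
    then show ?thesis
      using Theta_pos[OF rt] by (simp add: a_def abs_mult mult.commute)
  qed
  then have "\<forall>\<^sub>F (r, t) in at_top \<times>\<^sub>F at_right 0. norm (a r t) \<le> C * real (Suc r) powr (p - \<mu>)"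
    using eventually_prodI[OF eventually_True[of sequentially] pos] by (auto elim!: eventually_mono)
  moreover have "summable (\<lambda>r. C * real (Suc r) powr (p - \<mu>))"
    using p by (intro summable_mult summable_Suc_powr) auto
  moreover have "((\<lambda>t. a r t) \<longlongrightarrow> real (Suc r) powr (p - \<mu>) * c) (at_right 0)" for r
    unfolding a_def
    by (intro tendsto_mult tendsto_const filterlim_compose[OF Theta_lim at_right_0_mult]) auto
  ultimately have "((\<lambda>t. suminf (\<lambda>r. a r t)) \<longlongrightarrow> (\<Sum>r. real (Suc r) powr (p - \<mu>) * c)) (at_right 0)"
    using tannerys_theorem[of a "\<lambda>r. real (Suc r) powr (p - \<mu>) * c" "at_right 0" "\<lambda>r. C * real (Suc r) powr (p - \<mu>)"] by simp
  also have "(\<Sum>r. real (Suc r) powr (p - \<mu>) * c) = c * (\<Sum>r. real (Suc r) powr (p - \<mu>))"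
    using p by (subst suminf_mult2[symmetric, OF summable_Suc_powr]) (auto simp: mult.commute)
  finally show ?thesis
  proof (rule Lim_transform_eventually)
    show "\<forall>\<^sub>F t in at_right 0. (\<Sum>r. a r t) = t powr \<mu> * kap p t"
      unfolding eventually_at_right_field
    proof (intro exI[of _ 1] conjI allI impI)
      fix t :: real assume t: "0 < t" "t < 1"
      have "a r t = t powr \<mu> * (real (Suc r) powr p * \<theta> (real (Suc r) * t))" for r
      proof -
        have "a r t = (real (Suc r) powr (p - \<mu>) * real (Suc r) powr \<mu>) * t powr \<mu> * \<theta> (real (Suc r) * t)"
          unfolding a_def using t by (subst powr_mult) auto
        also have "real (Suc r) powr (p - \<mu>) * real (Suc r) powr \<mu> = real (Suc r) powr p"
          by (simp flip: powr_add)
        finally show ?thesis by simp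
      qed
      then show "(\<Sum>r. a r t) = t powr \<mu> * kap p t"
        unfolding kap_def using summable_Theta[of t p] t by (simp add: suminf_mult)
    qed auto
  qed
qed

lemma set_integrable_decay:
  fixes C \<eta> :: real
  assumes "\<eta> > 0"
  shows "set_integrable lborel {0<..} (\<lambda>u. C * (u powr (\<eta> - 1) * exp (- (1 / 4 * u))))"
  using assms by (intro set_integrable_mult_right set_integrable_Gamma) auto

lemma decay_antimono:
  assumes "\<eta> \<le> 1" "C \<ge> 0" "0 < u" "u \<le> v"
  shows "C * (v powr (\<eta> - 1) * exp (- (1 / 4 * v))) \<le> C * (u powr (\<eta> - 1) * exp (- (1 / 4 * u :: real)))"
  using assms by (intro mult_left_mono mult_mono powr_mono2') auto

text \<open>The exponent \<eta> is capped at 1 so that the majorant decreases, as a Riemann sum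
  requires; the surplus power of u goes into half of the exponential.\<close>

lemma Theta_powr_bound:
  assumes p: "p > \<mu> - 1"
  obtains C \<eta> where "C > 0" "\<eta> > 0" "\<eta> \<le> 1"
    "\<And>u. u > 0 \<Longrightarrow> u powr p * \<theta> u \<le> C * (u powr (\<eta> - 1) * exp (- (1 / 4 * u)))"
proof -
  obtain C where C: "C > 0" "\<And>t. t > 0 \<Longrightarrow> \<theta> t \<le> C * t powr (- \<mu>) * exp (- (t / 2))"
    using Theta_bound by blast
  define \<eta> where "\<eta> = min (p - \<mu> + 1) 1"
  obtain K where K: "K > 0" "\<And>u. u > 0 \<Longrightarrow> u powr (p - \<mu> + 1 - \<eta>) * exp (- (1 / 4 * u)) \<le> K"
    by (rule powr_exp_bounded[of "p - \<mu> + 1 - \<eta>" "1 / 4"]) (simp_all add: \<eta>_def)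
  show ?thesis
  proof (rule that[of "C * K" \<eta>])
    fix u :: real assume u: "u > 0"
    have "u powr p * \<theta> u \<le> u powr p * (C * u powr (- \<mu>) * exp (- (u / 2)))"
      by (intro mult_left_mono C u) auto
    also have "\<dots> = C * (u powr (p - \<mu> + 1 - \<eta>) * exp (- (1 / 4 * u))) * (u powr (\<eta> - 1) * exp (- (1 / 4 * u)))"
    proof -
      have "u powr p * u powr (- \<mu>) = u powr (p - \<mu> + 1 - \<eta>) * u powr (\<eta> - 1)" by (simp flip: powr_add)
      moreover have "exp (- (u / 2)) = exp (- (1 / 4 * u)) * exp (- (1 / 4 * u))" by (simp flip: exp_add)
      ultimately show ?thesis by (simp add: mult_ac)
    qed
    also have "\<dots> \<le> C * K * (u powr (\<eta> - 1) * exp (- (1 / 4 * u)))"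
      using C K(2)[OF u] by (intro mult_right_mono mult_left_mono) auto
    finally show "u powr p * \<theta> u \<le> C * K * (u powr (\<eta> - 1) * exp (- (1 / 4 * u)))" .
  qed (use C K p in \<open>auto simp: \<eta>_def\<close>)
qed

lemma kap_lim_large:
  assumes p: "p > \<mu> - 1"
  shows "((\<lambda>t. t powr (p + 1) * kap p t) \<longlongrightarrow> (LINT u:{0<..}|lborel. u powr p * \<theta> u)) (at_right 0)"
proof -
  obtain C \<eta> where C: "C > 0" "\<eta> > 0" "\<eta> \<le> 1"
    "\<And>u. u > 0 \<Longrightarrow> u powr p * \<theta> u \<le> C * (u powr (\<eta> - 1) * exp (- (1 / 4 * u)))"
    using Theta_powr_bound[OF p] by blast
  have eq: "(real (Suc r) * t) powr p * \<theta> (real (Suc r) * t) = t powr p * (real (Suc r) powr p * \<theta> (real (Suc r) * t))"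
    if "t > 0" for r t using that by (simp add: powr_mult)
  have "((\<lambda>t. t * (\<Sum>r. (real (Suc r) * t) powr p * \<theta> (real (Suc r) * t))) \<longlongrightarrow> (LINT u:{0<..}|lborel. u powr p * \<theta> u)) (at_right 0)"
  proof (rule riemann_sum_limit[where \<phi> = "\<lambda>u. C * (u powr (\<eta> - 1) * exp (- (1 / 4 * u)))"])
    show "isCont (\<lambda>u. u powr p * \<theta> u) u" if "u > 0" for u
      using that isCont_Theta[OF that] by (intro continuous_intros) auto
    show "\<bar>u powr p * \<theta> u\<bar> \<le> C * (u powr (\<eta> - 1) * exp (- (1 / 4 * u)))" if "u > 0" for u
      using C(4)[OF that] Theta_pos[OF that] by (simp add: abs_mult)
    show "set_integrable lborel {0<..} (\<lambda>u. C * (u powr (\<eta> - 1) * exp (- (1 / 4 * u))))"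
      by (rule set_integrable_decay[OF C(2)])
    show "summable (\<lambda>r. (real (Suc r) * t) powr p * \<theta> (real (Suc r) * t))" if "t > 0" for t
      unfolding eq[OF that] by (rule summable_mult[OF summable_Theta[OF that]])
  qed (use C decay_antimono in auto)
  then show ?thesis
  proof (rule Lim_transform_eventually)
    show "\<forall>\<^sub>F t in at_right 0. t * (\<Sum>r. (real (Suc r) * t) powr p * \<theta> (real (Suc r) * t)) = t powr (p + 1) * kap p t"
      unfolding eventually_at_right_field
    proof (intro exI[of _ 1] conjI allI impI)
      fix t :: real assume t: "0 < t" "t < 1"
      show "t * (\<Sum>r. (real (Suc r) * t) powr p * \<theta> (real (Suc r) * t)) = t powr (p + 1) * kap p t"
        unfolding eq[OF t(1)] kap_def suminf_mult[OF summable_Theta[OF t(1)]]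
        using t by (simp add: powr_add)
    qed auto
  qed
qed

text \<open>For \<mu> > 1 every cumulant beyond the first is of smaller order than the corresponding
  power of the first. A single bound covers all positions of p + 1 relative to \<mu>, including
  equality, where a logarithm occurs.\<close>

lemma kap_lim_mid:
  assumes m1: "\<mu> > 1" and p: "p \<ge> 1"
  shows "((\<lambda>t. t powr ((p + 1) * \<mu>) * kap p t) \<longlongrightarrow> 0) (at_right 0)"
proof -
  \<comment> \<open>Any exponent strictly between max(p + 1, \<mu>) and (p + 1) \<mu> would do:
    above p + 1 the sum over r converges, below (p + 1) \<mu> a positive power of t is left
    over.\<close>
  define m where "m = ((p + 1) * \<mu> + max (p + 1) \<mu>) / 2"
  have "(p + 1) * \<mu> > (p + 1) * 1" "(p + 1) * \<mu> > 1 * \<mu>"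
    using m1 p by (intro mult_strict_left_mono mult_strict_right_mono; simp)+
  then have m: "m \<ge> \<mu>" "m > p + 1" "m < (p + 1) * \<mu>" unfolding m_def max_def by (simp_all split: if_splits add: mult.commute)
  obtain C where C: "C > 0" "\<And>t. t > 0 \<Longrightarrow> \<theta> t \<le> C * t powr (- m)"
    using Theta_le_powr[OF m(1)] by blast
  define K where "K = C * (\<Sum>r. real (Suc r) powr (p - m))"
  have sm: "summable (\<lambda>r. real (Suc r) powr (p - m))" using m by (intro summable_Suc_powr) auto
  have kap: "0 \<le> kap p t" "kap p t \<le> t powr (- m) * K" if t: "t > 0" for t
  proof -
    show "0 \<le> kap p t" unfolding kap_def
      using t Theta_pos by (intro suminf_nonneg summable_Theta) (auto intro!: mult_nonneg_nonneg less_imp_le)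
    have "kap p t \<le> (\<Sum>r. (C * t powr (- m)) * real (Suc r) powr (p - m))"
      unfolding kap_def
    proof (rule suminf_le[OF _ summable_Theta[OF t] summable_mult[OF sm]])
      fix r
      have "real (Suc r) powr p * \<theta> (real (Suc r) * t) \<le> real (Suc r) powr p * (C * (real (Suc r) * t) powr (- m))"
        using t by (intro mult_left_mono C) auto
      also have "\<dots> = (C * t powr (- m)) * (real (Suc r) powr p * real (Suc r) powr (- m))"
        using t by (subst powr_mult) auto
      also have "real (Suc r) powr p * real (Suc r) powr (- m) = real (Suc r) powr (p - m)" by (simp flip: powr_add)
      finally show "real (Suc r) powr p * \<theta> (real (Suc r) * t) \<le> (C * t powr (- m)) * real (Suc r) powr (p - m)" .
    qed
    also have "\<dots> = t powr (- m) * K" unfolding suminf_mult[OF sm] K_def by simp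
    finally show "kap p t \<le> t powr (- m) * K" .
  qed
  have "((\<lambda>t. t powr ((p + 1) * \<mu> - m) * K) \<longlongrightarrow> 0 * K) (at_right 0)"
    using m by (intro tendsto_mult tendsto_const tendsto_powr_at_right_0) auto
  then have lim: "((\<lambda>t. t powr ((p + 1) * \<mu> - m) * K) \<longlongrightarrow> 0) (at_right 0)" by simp
  have ev: "\<forall>\<^sub>F t in at_right (0::real). t > 0" by (simp add: eventually_at_right_less)
  show ?thesis
  proof (rule tendsto_sandwich[OF _ _ tendsto_const lim])
    show "\<forall>\<^sub>F t in at_right 0. 0 \<le> t powr ((p + 1) * \<mu>) * kap p t"
      using ev by eventually_elim (use kap in auto)
    show "\<forall>\<^sub>F t in at_right 0. t powr ((p + 1) * \<mu>) * kap p t \<le> t powr ((p + 1) * \<mu> - m) * K"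
      using ev
    proof eventually_elim
      case (elim t)
      have "t powr ((p + 1) * \<mu>) * kap p t \<le> t powr ((p + 1) * \<mu>) * (t powr (- m) * K)"
        by (intro mult_left_mono kap elim) auto
      also have "\<dots> = t powr ((p + 1) * \<mu> - m) * K"
        by (simp flip: powr_add mult.assoc)
      finally show ?case .
    qed
  qed
qed

lemma ln_one_minus_exp_sums:
  assumes t: "t > (0::real)"
  shows "(\<lambda>r. exp (- (real (Suc r) * t)) / real (Suc r)) sums (- ln (1 - exp (- t)))"
proof -
  have e: "exp (- t) < 1" using t by simp
  have eq: "((- 1) ^ r) * (1 / real (r + 1)) * ((1 - exp (- t)) - 1) ^ Suc r = - (exp (- (real (Suc r) * t)) / real (Suc r))" for r
  proof -
    have "((1 - exp (- t)) - 1) ^ Suc r = - ((-1) ^ r * exp (- t) ^ Suc r)"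
      by (simp add: power_minus[of "exp (- t)" r])
    moreover have "exp (- t) ^ Suc r = exp (- (real (Suc r) * t))" by (simp only: exp_of_nat_mult[symmetric]) simp
    ultimately have pow: "((1 - exp (- t)) - 1) ^ Suc r = - ((-1) ^ r * exp (- (real (Suc r) * t)))" by simp
    have gen: "s * (1 / N) * (- (s * E)) = - ((s * s) * (E / N))" for s N E :: real by simp
    have "((- 1) ^ r) * (1 / real (r + 1)) * ((1 - exp (- t)) - 1) ^ Suc r =
       - (((- 1) ^ r * (- 1) ^ r) * (exp (- (real (Suc r) * t)) / real (Suc r)))" unfolding pow gen by simp
    also have "(- 1 :: real) ^ r * (- 1) ^ r = 1" by (simp flip: power_mult_distrib)
    finally show ?thesis by simp
  qed
  have sm: "summable (\<lambda>r. exp (- (real (Suc r) * t)) / real (Suc r))"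
  proof (rule summable_comparison_test')
    show "summable (\<lambda>r. exp (- t) * exp (- t) ^ r)" using e by (intro summable_mult summable_geometric) auto
    fix r
    have "exp (- (real (Suc r) * t)) / real (Suc r) \<le> exp (- (real (Suc r) * t)) / 1"
      by (intro divide_left_mono) auto
    also have "\<dots> = exp (- t) * exp (- t) ^ r" by (simp flip: exp_of_nat_mult exp_add add: algebra_simps)
    finally show "norm (exp (- (real (Suc r) * t)) / real (Suc r)) \<le> exp (- t) * exp (- t) ^ r" by simp
  qed
  have "ln (1 - exp (- t)) = (\<Sum>r. ((- 1) ^ r) * (1 / real (r + 1)) * ((1 - exp (- t)) - 1) ^ Suc r)"
    using e exp_gt_zero[of "- t"] by (intro ln_series) linarith+
  also have "\<dots> = - (\<Sum>r. exp (- (real (Suc r) * t)) / real (Suc r))"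
    unfolding eq by (rule suminf_minus[OF sm])
  finally show ?thesis using summable_sums[OF sm] by simp
qed

text \<open>The second-order bound makes the difference g integrable at 0, so
  \<open>riemann_sum_limit\<close> applies to it. The subtracted part sums to a logarithm in closed
  form.\<close>

lemma kap_lim_log:
  assumes m1: "\<mu> = 1" and eta: "0 < \<eta>" "\<eta> < 1"
    and second: "\<And>u. 0 < u \<Longrightarrow> u \<le> 1 \<Longrightarrow> \<bar>\<theta> u - c / u\<bar> \<le> B * u powr (\<eta> - 1)"
  shows "((\<lambda>t. t * kap 0 t + c * ln t) \<longlongrightarrow> (LINT u:{0<..}|lborel. \<theta> u - c * exp (- u) / u)) (at_right 0)"
proof -
  obtain C where C: "C > 0" "\<And>t. t > 0 \<Longrightarrow> \<theta> t \<le> C * t powr (- \<mu>) * exp (- (t / 2))"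
    using Theta_bound by blast
  obtain K where K: "K > 0" "\<And>u. u > 0 \<Longrightarrow> u powr (1 - \<eta>) * exp (- (1 / 4 * u)) \<le> K"
    by (rule powr_exp_bounded[of "1 - \<eta>" "1 / 4"]) (use eta in simp_all)
  have B0: "B \<ge> 0" using second[of 1] by simp
  define g where "g u = \<theta> u - c * exp (- u) / u" for u
  define D where "D = (B + c) * exp (1 / 4) + (C + c) * K"
  have "B + c > 0" using B0 c by simp
  then have D: "D > 0" unfolding D_def using c C K by (intro add_pos_pos[OF mult_pos_pos mult_pos_pos]) simp_all
  have dom: "\<bar>g u\<bar> \<le> D * (u powr (\<eta> - 1) * exp (- (1 / 4 * u)))" if u: "u > 0" for u
  proof (cases "u \<le> 1")
    case True
    have "\<bar>g u\<bar> \<le> \<bar>\<theta> u - c / u\<bar> + \<bar>c / u - c * exp (- u) / u\<bar>" 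
      using abs_triangle_ineq[of "\<theta> u - c / u" "c / u - c * exp (- u) / u"] by (simp add: g_def)
    also have "c / u - c * exp (- u) / u = c * ((1 - exp (- u)) / u)" unfolding diff_divide_distrib right_diff_distrib by simp
    also have "\<bar>\<dots>\<bar> = c * ((1 - exp (- u)) / u)" using c u by (simp add: abs_mult)
    also have "(1 - exp (- u)) / u \<le> 1" using u exp_ge_add_one_self[of "- u"] by (simp add: field_simps)
    also have "\<bar>\<theta> u - c / u\<bar> \<le> B * u powr (\<eta> - 1)" by (rule second[OF u True])
    also have "c * 1 \<le> c * u powr (\<eta> - 1)"
      using powr_mono2'[of "\<eta> - 1" u 1] c u True eta by (intro mult_left_mono) auto
    finally have "\<bar>g u\<bar> \<le> (B + c) * u powr (\<eta> - 1)" using c by (simp add: distrib_right)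
    also have "\<dots> \<le> (B + c) * u powr (\<eta> - 1) * (exp (1 / 4) * exp (- (1 / 4 * u)))"
    proof -
      have "1 \<le> exp (1 / 4) * exp (- (1 / 4 * u))" using True by (simp flip: exp_add)
      then show ?thesis using mult_left_mono[of 1 _ "(B + c) * u powr (\<eta> - 1)"] B0 c by simp
    qed
    also have "\<dots> = ((B + c) * exp (1 / 4)) * (u powr (\<eta> - 1) * exp (- (1 / 4 * u)))" by simp
    also have "\<dots> \<le> D * (u powr (\<eta> - 1) * exp (- (1 / 4 * u)))"
      unfolding D_def using C K c by (intro mult_right_mono) auto
    finally show ?thesis .
  next
    case False
    have "\<bar>g u\<bar> \<le> \<theta> u + c * exp (- u) / u" using Theta_pos[OF u] c u unfolding g_def by (auto simp: abs_if)
    also have "\<theta> u \<le> C * exp (- (u / 2))"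
    proof -
      have "\<theta> u \<le> C * (u powr (- \<mu>)) * exp (- (u / 2))" by (rule C(2)[OF u])
      also have "\<dots> \<le> C * 1 * exp (- (u / 2))"
        using C False m1 by (intro mult_right_mono mult_left_mono) (auto simp: powr_minus field_simps)
      finally show ?thesis by simp
    qed
    also have "c * exp (- u) / u \<le> c * exp (- (u / 2))"
    proof -
      have "c * exp (- u) / u \<le> c * exp (- (u / 2)) / 1"
        using c False by (intro frac_le mult_left_mono) auto
      then show ?thesis by simp
    qed
    also have "C * exp (- (u / 2)) + c * exp (- (u / 2)) = (C + c) * (u powr (1 - \<eta>) * exp (- (1 / 4 * u))) * (u powr (\<eta> - 1) * exp (- (1 / 4 * u)))"
    proof -
      have "u powr (1 - \<eta>) * u powr (\<eta> - 1) = 1" using u by (simp flip: powr_add)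
      moreover have "exp (- (u / 2)) = exp (- (1 / 4 * u)) * exp (- (1 / 4 * u))" by (simp flip: exp_add)
      moreover have "x * (y * e) * (z * e) = (y * z) * (x * (e * e))" for x y z e :: real by simp
      ultimately show ?thesis by (simp only: distrib_right mult_1)
    qed
    also have "\<dots> \<le> (C + c) * K * (u powr (\<eta> - 1) * exp (- (1 / 4 * u)))"
      using C c K(2)[OF u] by (intro mult_right_mono mult_left_mono) auto
    also have "\<dots> \<le> D * (u powr (\<eta> - 1) * exp (- (1 / 4 * u)))"
      unfolding D_def using B0 c by (intro mult_right_mono) auto
    finally show ?thesis by simp
  qed
  have gm [measurable]: "g \<in> borel_measurable borel" unfolding g_def by measurable
  have int: "set_integrable lborel {0<..} (\<lambda>u. D * (u powr (\<eta> - 1) * exp (- (1 / 4 * u))))"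
    by (rule set_integrable_decay[OF eta(1)])
  have s1: "summable (\<lambda>r. \<theta> (real (Suc r) * t))" if "t > 0" for t
    using summable_Theta[OF that, of 0] by simp
  have s2: "(\<lambda>r. c * exp (- (real (Suc r) * t)) / (real (Suc r) * t)) sums (c / t * - ln (1 - exp (- t)))" if "t > 0" for t
    using sums_mult[OF ln_one_minus_exp_sums[OF that], of "c / t"] by (simp add: field_simps)
  have "((\<lambda>t. t * (\<Sum>r. g (real (Suc r) * t))) \<longlongrightarrow> (LINT u:{0<..}|lborel. g u)) (at_right 0)"
  proof (rule riemann_sum_limit[OF gm _ dom _ int])
    show "isCont g u" if "u > 0" for u
      unfolding g_def using that isCont_Theta[OF that] by (intro continuous_intros) auto
    show "summable (\<lambda>r. g (real (Suc r) * t))" if "t > 0" for t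
      unfolding g_def by (intro summable_diff s1 that sums_summable[OF s2])
  qed (use eta D decay_antimono in auto)
  \<comment> \<open>By the logarithmic series t times the subtracted sum is -c ln(1 - exp(-t)),
    which may be replaced by -c ln t because 1 - exp(-t) is asymptotic to t.\<close>
  moreover have "((\<lambda>t::real. - c * (ln (1 - exp (- t)) - ln t)) \<longlongrightarrow> 0) (at_right 0)"
    by real_asymp
  ultimately have "((\<lambda>t. t * (\<Sum>r. g (real (Suc r) * t)) + - c * (ln (1 - exp (- t)) - ln t)) \<longlongrightarrow> (LINT u:{0<..}|lborel. g u) + 0) (at_right 0)"
    by (rule tendsto_add)
  then have "((\<lambda>t. t * kap 0 t + c * ln t) \<longlongrightarrow> (LINT u:{0<..}|lborel. g u) + 0) (at_right 0)"
  proof (rule Lim_transform_eventually)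
    show "\<forall>\<^sub>F t in at_right 0. t * (\<Sum>r. g (real (Suc r) * t)) + - c * (ln (1 - exp (- t)) - ln t) = t * kap 0 t + c * ln t"
      unfolding eventually_at_right_field
    proof (intro exI[of _ 1] conjI allI impI)
      fix t :: real assume t: "0 < t" "t < 1"
      have "(\<Sum>r. g (real (Suc r) * t)) = kap 0 t - c / t * - ln (1 - exp (- t))"
        unfolding g_def kap_def using suminf_diff[OF s1[OF t(1)] sums_summable[OF s2[OF t(1)]]] sums_unique[OF s2[OF t(1)]]
        by simp
      then show "t * (\<Sum>r. g (real (Suc r) * t)) + - c * (ln (1 - exp (- t)) - ln t) = t * kap 0 t + c * ln t"
        using t by (simp add: field_simps)
    qed auto
  qed
  then show "((\<lambda>t. t * kap 0 t + c * ln t) \<longlongrightarrow> (LINT u:{0<..}|lborel. \<theta> u - c * exp (- u) / u)) (at_right 0)"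
    by (simp add: g_def)
qed

end

section \<open>Characteristic functions of the tilted moments\<close>

text \<open>If uniform convergence failed on K, some subsequence would stay e away from g there. By
  Montel a further subsequence converges locally uniformly; its limit agrees with g on U, hence on
  all of S, a contradiction.\<close>

lemma vitali_limit:
  fixes f :: "nat \<Rightarrow> complex \<Rightarrow> complex"
  assumes S: "open S" "connected S" and holo: "\<And>n. f n holomorphic_on S"
    and bdd: "\<And>K. compact K \<Longrightarrow> K \<subseteq> S \<Longrightarrow> \<exists>B. \<forall>n. \<forall>z\<in>K. norm (f n z) \<le> B"
    and g: "g holomorphic_on S" and U: "U \<subseteq> S" "\<xi> \<in> S" "\<xi> islimpt U"
    and lim: "\<And>z. z \<in> U \<Longrightarrow> (\<lambda>n. f n z) \<longlonglongrightarrow> g z"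
    and K: "compact K" "K \<subseteq> S"
  shows "uniform_limit K f g sequentially"
proof (rule ccontr)
  assume "\<not> ?thesis"
  then obtain e where e: "e > 0" "\<not> (\<forall>\<^sub>F n in sequentially. \<forall>z\<in>K. dist (f n z) (g z) < e)"
    unfolding uniform_limit_iff by blast
  have "infinite {n. \<not> (\<forall>z\<in>K. dist (f n z) (g z) < e)}"
  proof
    assume "finite {n. \<not> (\<forall>z\<in>K. dist (f n z) (g z) < e)}"
    then have "\<forall>\<^sub>F n in cofinite. \<forall>z\<in>K. dist (f n z) (g z) < e"
      by (simp add: eventually_cofinite)
    then show False using e(2) by (simp add: cofinite_eq_sequentially)
  qed
  from infinite_enumerate[OF this] obtain s :: "nat \<Rightarrow> nat"
    where s: "strict_mono s" "\<And>n. \<not> (\<forall>z\<in>K. dist (f (s n) z) (g z) < e)" by blast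
  obtain g' r where g': "g' holomorphic_on S" and r: "strict_mono (r :: nat \<Rightarrow> nat)"
    and ptw: "\<And>x. x \<in> S \<Longrightarrow> (\<lambda>n. f (s (r n)) x) \<longlonglongrightarrow> g' x"
    and unif: "\<And>K. compact K \<Longrightarrow> K \<subseteq> S \<Longrightarrow> uniform_limit K ((\<lambda>n. f (s n)) \<circ> r) g' sequentially"
  proof (rule Montel[of S "range f" "\<lambda>n. f (s n)"])
    show "\<exists>B. \<forall>h\<in>range f. \<forall>z\<in>K. norm (h z) \<le> B" if "compact K" "K \<subseteq> S" for K
      using bdd[OF that] by blast
  qed (use S holo in auto)
  have eq: "g' z = g z" if "z \<in> S" for z
  proof -
    have "g' z - g z = 0"
    proof (rule analytic_continuation[of "\<lambda>z. g' z - g z" S U \<xi>])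
      show "g' z - g z = 0" if z: "z \<in> U" for z
      proof -
        have "strict_mono (s \<circ> r)" by (rule strict_mono_o[OF s(1) r])
        from LIMSEQ_subseq_LIMSEQ[OF lim[OF z] this] have "(\<lambda>n. f (s (r n)) z) \<longlonglongrightarrow> g z" by (simp add: o_def)
        moreover have "(\<lambda>n. f (s (r n)) z) \<longlonglongrightarrow> g' z" using z U by (intro ptw) auto
        ultimately show ?thesis using LIMSEQ_unique by fastforce
      qed
    qed (use S g g' U that in \<open>auto intro!: holomorphic_intros\<close>)
    then show ?thesis by simp
  qed
  have "\<forall>\<^sub>F n in sequentially. \<forall>z\<in>K. dist (f (s (r n)) z) (g' z) < e"
    using uniform_limitD[OF unif[OF K] e(1)] by (simp add: o_def)
  then obtain n where "\<forall>z\<in>K. dist (f (s (r n)) z) (g' z) < e"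
    by (auto simp: eventually_sequentially)
  then show False using s(2)[of "r n"] eq K by (metis subsetD)
qed

lemma norm_less_radius:
  "norm z < 1 \<Longrightarrow> fps_conv_radius F \<ge> 1 \<Longrightarrow> ereal (norm z) < fps_conv_radius F"
  by (rule order_less_le_trans[of _ 1]) (simp_all add: one_ereal_def)

lemma ereal_less_radius: "x < 1 \<Longrightarrow> fps_conv_radius F \<ge> 1 \<Longrightarrow> ereal x < fps_conv_radius F"
  by (rule order_less_le_trans[of _ 1]) (simp_all add: one_ereal_def)

lemma cball_half_subset: "cball 1 (1 / 2) \<subseteq> {z::complex. Re z > 0}"
proof
  fix z :: complex assume "z \<in> cball 1 (1 / 2)"
  then have "\<bar>1 - Re z\<bar> \<le> 1 / 2" using abs_Re_le_cmod[of "1 - z"] by (simp add: dist_norm)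
  then have "Re z > 0" by linarith
  then show "z \<in> {z. Re z > 0}" by simp
qed

lemma nonneg_fps_eval:
  assumes F: "nonneg_fps F" "fps_conv_radius F \<ge> 1" and x: "0 \<le> x" "x < 1"
  shows "(\<lambda>n. norm (fps_nth F n) * x ^ n) sums Re (eval_fps F (of_real x))"
    and "eval_fps F (of_real x) = of_real (Re (eval_fps F (of_real x)))"
proof -
  have "summable (\<lambda>n. fps_nth F n * of_real x ^ n)"
    by (rule summable_fps, rule norm_less_radius) (use x F in auto)
  then have "(\<lambda>n. fps_nth F n * of_real x ^ n) sums eval_fps F (of_real x)"
    unfolding eval_fps_def by (rule summable_sums)
  also have "(\<lambda>n. fps_nth F n * of_real x ^ n) = (\<lambda>n. of_real (norm (fps_nth F n) * x ^ n))"
  proof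
    fix n
    have "fps_nth F n = of_real (norm (fps_nth F n))"
      using F(1) unfolding nonneg_fps_def by (metis complex_nonneg_Reals_iff complex_is_Real_iff abs_of_nonneg nonneg_Reals_cases norm_of_real)
    then show "fps_nth F n * of_real x ^ n = of_real (norm (fps_nth F n) * x ^ n)" by simp
  qed
  finally have s: "(\<lambda>n. complex_of_real (norm (fps_nth F n) * x ^ n)) sums eval_fps F (of_real x)" .
  from sums_Re[OF s] show r: "(\<lambda>n. norm (fps_nth F n) * x ^ n) sums Re (eval_fps F (of_real x))" by simp
  from sums_unique2[OF s sums_of_real[OF r]]
  show "eval_fps F (of_real x) = of_real (Re (eval_fps F (of_real x)))" .
qed

lemma nonneg_fps_norm_le:
  assumes F: "nonneg_fps F" "fps_conv_radius F \<ge> 1" and z: "norm z < 1"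
  shows "norm (eval_fps F z) \<le> Re (eval_fps F (of_real (norm z)))"
proof -
  note s = nonneg_fps_eval(1)[OF F norm_ge_zero z]
  have "norm (eval_fps F z) \<le> (\<Sum>n. norm (fps_nth F n) * norm z ^ n)"
    unfolding eval_fps_def using sums_summable[OF s]
    by (intro order.trans[OF summable_norm]) (simp_all add: norm_mult norm_power)
  then show ?thesis using s by (simp add: sums_iff)
qed

text \<open>Rotating the n-th term by the angle n u a costs at most |u| n a, and n a is at most
  twice exp(n a / 2). So a change of argument is paid by the value at a / 2 instead of a derivative,
  which is the form that a doubling bound can use.\<close>

lemma nonneg_fps_rotate:
  assumes F: "nonneg_fps F" "fps_conv_radius F \<ge> 1" and a: "a > 0"
  shows "norm (eval_fps F (exp (- (of_real a * (1 - \<i> * of_real u)))) - eval_fps F (exp (- of_real a))) \<le>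
         \<bar>u\<bar> * (2 * Re (eval_fps F (of_real (exp (- (a / 2))))))"
proof -
  let ?w = "exp (- (of_real a * (1 - \<i> * of_real u)))" and ?x = "exp (- a)" and ?y = "exp (- (a / 2))"
  have w: "?w = of_real ?x * cis (u * a)"
    by (simp add: cis_conv_exp exp_of_real[symmetric] right_diff_distrib mult_ac flip: exp_add)
  have x1: "?x < 1" "?y < 1" using a by auto
  have sx: "(\<lambda>n. fps_nth F n * ?w ^ n) sums eval_fps F ?w" "(\<lambda>n. fps_nth F n * of_real ?x ^ n) sums eval_fps F (of_real ?x)"
    unfolding eval_fps_def
    by (intro summable_sums summable_fps norm_less_radius F; use x1 in \<open>simp add: w norm_mult\<close>)+
  have d: "(\<lambda>n. fps_nth F n * ?w ^ n - fps_nth F n * of_real ?x ^ n) sums (eval_fps F ?w - eval_fps F (of_real ?x))"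
    by (rule sums_diff[OF sx])
  have y: "(\<lambda>n. (\<bar>u\<bar> * 2) * (norm (fps_nth F n) * ?y ^ n)) sums ((\<bar>u\<bar> * 2) * Re (eval_fps F (of_real ?y)))"
    by (intro sums_mult nonneg_fps_eval(1)[OF F] less_imp_le x1) auto
  have le: "norm (fps_nth F n * ?w ^ n - fps_nth F n * of_real ?x ^ n) \<le> (\<bar>u\<bar> * 2) * (norm (fps_nth F n) * ?y ^ n)" for n
  proof -
    have "fps_nth F n * ?w ^ n - fps_nth F n * of_real ?x ^ n = fps_nth F n * of_real (?x ^ n) * (cis (real n * (u * a)) - 1)"
    proof -
      have "?w ^ n = of_real (?x ^ n) * cis (real n * (u * a))"
        unfolding w power_mult_distrib Complex.DeMoivre of_real_power ..
      then show ?thesis by (simp only: of_real_power right_diff_distrib mult.assoc mult_1_right)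
    qed
    then have "norm (fps_nth F n * ?w ^ n - fps_nth F n * of_real ?x ^ n) = norm (fps_nth F n) * ?x ^ n * norm (cis (real n * (u * a)) - 1)"
      by (simp add: norm_mult norm_power)
    also have "norm (cis (real n * (u * a)) - 1) \<le> \<bar>real n * (u * a)\<bar>"
    proof -
      have "2 * \<bar>sin (real n * (u * a) / 2)\<bar> \<le> 2 * \<bar>real n * (u * a) / 2\<bar>"
        by (intro mult_left_mono abs_sin_x_le_abs_x) auto
      then show ?thesis using dist_exp_i_1[of "real n * (u * a)"] by (simp add: cis_conv_exp)
    qed
    also have "\<dots> = \<bar>u\<bar> * (real n * a)" using a by (simp add: abs_mult)
    also have "real n * a \<le> 2 * exp (real n * a / 2)"
      using exp_ge_add_one_self[of "real n * a / 2"] by linarith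
    also have "norm (fps_nth F n) * ?x ^ n * (\<bar>u\<bar> * (2 * exp (real n * a / 2))) = (\<bar>u\<bar> * 2) * (norm (fps_nth F n) * (?x ^ n * exp (real n * a / 2)))"
      by simp
    also have "?x ^ n * exp (real n * a / 2) = ?y ^ n"
      by (simp flip: exp_of_nat_mult exp_add)
    finally show ?thesis by (simp add: mult_left_mono)
  qed
  have "norm (eval_fps F ?w - eval_fps F (of_real ?x)) \<le> (\<bar>u\<bar> * 2) * Re (eval_fps F (of_real ?y))"
    unfolding sums_unique[OF d] sums_unique[OF y]
    by (rule norm_suminf_le[OF le sums_summable[OF y]])
  then show ?thesis by (simp add: exp_of_real[symmetric] mult.assoc)
qed

section \<open>The logarithm of the generating function on the right half-plane\<close>

context first_order
begin

text \<open>The leading coefficient of log \<open>T\<^sub>0\<close> at 0, namely c times the Riemann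
  zeta function at \<mu> + 1.\<close>

definition C0 :: real where
  "C0 = c * (\<Sum>r. real (Suc r) powr (- 1 - \<mu>))"

lemma C0_pos: "C0 > 0"
proof -
  have "summable (\<lambda>r. real (Suc r) powr (- 1 - \<mu>))" using mu by (intro summable_Suc_powr) auto
  then show ?thesis unfolding C0_def using c by (intro mult_pos_pos suminf_pos) auto
qed

text \<open>\<open>log T\<^sub>0\<close> at \<open>t = a z\<close>, normalised so that it converges to \<open>h_lim\<close> as \<open>a\<close> tends to 0.\<close>

definition h :: "real \<Rightarrow> complex \<Rightarrow> complex" where
  "h a z = of_real (a powr \<mu>) * eval_fps logF (exp (- (of_real a * z)))"

definition h_lim :: "complex \<Rightarrow> complex" where
  "h_lim z = of_real C0 * z powr (- of_real \<mu>)"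

lemma open_right: "open {z. Re z > 0}" and connected_right: "connected {z. Re z > 0}"
  by (simp_all add: open_halfspace_Re_gt convex_connected convex_halfspace_Re_gt)

lemma logF_radius: "fps_conv_radius logF \<ge> 1"
  by (simp add: logF_def powK_radius)

lemma h_holo:
  assumes "a > 0"
  shows "h a holomorphic_on {z. Re z > 0}"
proof -
  have "(\<lambda>z. exp (- (complex_of_real a * z))) ` {z. Re z > 0} \<subseteq> eball 0 (fps_conv_radius logF)"
    using assms by (auto intro!: ereal_less_radius logF_radius)
  moreover have "(\<lambda>z. exp (- (complex_of_real a * z))) holomorphic_on {z. Re z > 0}"
    by (intro holomorphic_intros)
  ultimately have "(eval_fps logF \<circ> (\<lambda>z. exp (- (complex_of_real a * z)))) holomorphic_on {z. Re z > 0}"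
    by (intro holomorphic_on_compose_gen[OF _ holomorphic_on_eval_fps[OF order_refl]])
  then have "(\<lambda>z. of_real (a powr \<mu>) * eval_fps logF (exp (- (of_real a * z)))) holomorphic_on {z. Re z > 0}"
    by (intro holomorphic_on_mult holomorphic_on_const) (simp add: o_def)
  then show ?thesis by (simp add: h_def[abs_def])
qed

lemma h_lim_holo: "h_lim holomorphic_on {z. Re z > 0}"
  unfolding h_lim_def by (intro holomorphic_intros) (auto simp: complex_nonpos_Reals_iff)

lemma h_real:
  assumes "a > 0" "x > 0"
  shows "h a (of_real x) = of_real (a powr \<mu> * kap (- 1) (a * x))"
proof -
  have "exp (- (complex_of_real a * of_real x)) = of_real (exp (- (a * x)))"
    by (metis exp_of_real of_real_minus of_real_mult)
  then show ?thesis using eval_powK[of "a * x" 0] assms by (simp add: h_def logF_def)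
qed

lemma h_norm_le:
  assumes "a > 0" "Re z > 0"
  shows "norm (h a z) \<le> a powr \<mu> * kap (- 1) (a * Re z)"
proof -
  have n: "norm (exp (- (complex_of_real a * z))) = exp (- (a * Re z))" by simp
  have "norm (eval_fps logF (exp (- (of_real a * z)))) \<le> Re (eval_fps logF (of_real (norm (exp (- (complex_of_real a * z))))))"
    by (rule nonneg_fps_norm_le) (use assms logF_radius nonneg_powK n in \<open>auto simp: logF_def\<close>)
  also have "\<dots> = kap (- 1) (a * Re z)"
    unfolding n using eval_powK[of "a * Re z" 0] assms by (simp add: logF_def)
  finally show ?thesis by (simp add: h_def norm_mult mult_left_mono)
qed

text \<open>On a compact set the real parts stay away from 0, so the comparison with the positive
  axis and the global bound \<open>kap_le\<close> give a bound uniform in n. Convergence is known on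
  the positive axis, and Vitali's theorem spreads it.\<close>

lemma h_uniform:
  assumes a: "\<And>n. a n > 0" "a \<longlonglongrightarrow> 0" and K: "compact K" "K \<subseteq> {z. Re z > 0}"
  shows "\<exists>B. \<forall>n. \<forall>z\<in>K. norm (h (a n) z) \<le> B" "uniform_limit K (\<lambda>n. h (a n)) h_lim sequentially"
proof -
  obtain C where C: "C > 0" "\<And>t. t > 0 \<Longrightarrow> t powr \<mu> * kap (- 1) t \<le> C"
    by (rule kap_le[of "-1"]) (use mu in auto)
  have bdd: "\<exists>B. \<forall>n. \<forall>z\<in>K. norm (h (a n) z) \<le> B" if K: "compact K" "K \<subseteq> {z. Re z > 0}" for K
  proof (cases "K = {}")
    case False
    have "compact (Re ` K)" by (intro compact_continuous_image continuous_intros K)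
    then obtain z0 where z0: "z0 \<in> K" "\<And>z. z \<in> K \<Longrightarrow> Re z0 \<le> Re z"
      using compact_attains_inf[of "Re ` K"] False by auto
    have "norm (h (a n) z) \<le> C * Re z0 powr (- \<mu>)" if z: "z \<in> K" for n z
    proof -
      have zp: "Re z > 0" "Re z0 > 0" using K z z0 by auto
      have "norm (h (a n) z) \<le> a n powr \<mu> * kap (- 1) (a n * Re z)"
        by (rule h_norm_le[OF a(1) zp(1)])
      also have "\<dots> = ((a n * Re z) powr \<mu> * kap (- 1) (a n * Re z)) * Re z powr (- \<mu>)"
        using zp a(1)[of n] by (simp add: powr_mult powr_minus field_simps)
      also have "\<dots> \<le> C * Re z powr (- \<mu>)"
        using zp a(1)[of n] by (intro mult_right_mono C) auto
      also have "\<dots> \<le> C * Re z0 powr (- \<mu>)"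
        using zp z0(2)[OF z] C mu by (intro mult_left_mono powr_mono2') auto
      finally show ?thesis .
    qed
    then show ?thesis by blast
  qed auto
  then show "\<exists>B. \<forall>n. \<forall>z\<in>K. norm (h (a n) z) \<le> B" using K by blast
  show "uniform_limit K (\<lambda>n. h (a n)) h_lim sequentially"
  proof (rule vitali_limit[OF open_right connected_right h_holo[OF a(1)] bdd h_lim_holo, where U = "of_real ` {0<..}" and \<xi> = 1])
    show "1 islimpt (complex_of_real ` {0<..})"
    proof -
      have "(\<lambda>n. complex_of_real (1 + 1 / real (Suc n))) \<longlonglongrightarrow> of_real (1 + 0)"
        by (intro tendsto_of_real tendsto_add tendsto_const LIMSEQ_inverse_real_of_nat[unfolded inverse_eq_divide])
      moreover have "complex_of_real (1 + 1 / real (Suc n)) \<in> of_real ` {0<..} - {1}" for n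
      proof
        have "1 + 1 / real (Suc n) > 0" "1 + 1 / real (Suc n) \<noteq> 1" by (simp_all add: add_pos_pos)
        then show "complex_of_real (1 + 1 / real (Suc n)) \<in> of_real ` {0<..}"
          "complex_of_real (1 + 1 / real (Suc n)) \<notin> {1}"
          by (blast, metis of_real_eq_1_iff singletonD)
      qed
      ultimately show ?thesis unfolding islimpt_sequential
        by (intro exI[of _ "\<lambda>n. complex_of_real (1 + 1 / real (Suc n))"] conjI allI) (assumption, simp only: of_real_1 add_0_right)
    qed
    fix z :: complex assume "z \<in> of_real ` {0<..}"
    then obtain x where x: "x > 0" "z = of_real x" by auto
    have "filterlim (\<lambda>n. x * a n) (at_right 0) sequentially"
      by (rule filterlim_compose[OF at_right_0_mult[OF x(1)]])
         (unfold filterlim_at, use a less_imp_neq[OF a(1)] in \<open>auto intro!: always_eventually\<close>)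
    from filterlim_compose[OF kap_lim_small[of "- 1"] this] mu
    have "(\<lambda>n. (x * a n) powr \<mu> * kap (- 1) (x * a n)) \<longlonglongrightarrow> C0" by (simp add: C0_def)
    then have "(\<lambda>n. complex_of_real (x powr (- \<mu>) * ((x * a n) powr \<mu> * kap (- 1) (x * a n)))) \<longlonglongrightarrow> of_real (x powr (- \<mu>) * C0)"
      by (intro tendsto_of_real tendsto_mult tendsto_const)
    also have "(\<lambda>n. complex_of_real (x powr (- \<mu>) * ((x * a n) powr \<mu> * kap (- 1) (x * a n)))) = (\<lambda>n. h (a n) z)"
    proof
      fix n
      have "x powr (- \<mu>) * (x * a n) powr \<mu> = a n powr \<mu>"
        using x a(1)[of n] by (simp add: powr_mult powr_minus field_simps)
      then show "complex_of_real (x powr (- \<mu>) * ((x * a n) powr \<mu> * kap (- 1) (x * a n))) = h (a n) z"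
        unfolding x(2) h_real[OF a(1) x(1)] by (simp only: mult.assoc[symmetric] mult.commute[of x])
    qed
    also have "complex_of_real (x powr (- \<mu>) * C0) = h_lim z"
      using x by (simp add: h_lim_def powr_of_real[symmetric] mult.commute)
    finally show "(\<lambda>n. h (a n) z) \<longlonglongrightarrow> h_lim z" .
  qed (use K in auto)
qed

lemma h_lim_deriv2: "(deriv ^^ 2) h_lim 1 = of_real (C0 * \<mu> * (\<mu> + 1))"
proof -
  have d: "deriv (\<lambda>z. of_real b * z powr (- of_real s)) z = of_real (- (b * s)) * z powr (- of_real (s + 1))"
    if "Re z > 0" for b s :: real and z :: complex
  proof (rule DERIV_imp_deriv)
    have "z \<notin> \<real>\<^sub>\<le>\<^sub>0" using that by (auto simp: complex_nonpos_Reals_iff)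
    then have "((\<lambda>z. of_real b * z powr (- of_real s)) has_field_derivative of_real b * (- of_real s * z powr (- of_real s - 1))) (at z)"
      by (intro DERIV_cmult has_field_derivative_powr)
    moreover have "- complex_of_real (s + 1) = - of_real s - 1" by simp
    ultimately show "((\<lambda>z. of_real b * z powr (- of_real s)) has_field_derivative of_real (- (b * s)) * z powr (- of_real (s + 1))) (at z)"
      by (simp only: of_real_minus of_real_mult mult.assoc mult_minus_left mult_minus_right)
  qed
  have "(deriv ^^ 2) h_lim 1 = deriv (deriv h_lim) 1" by (simp add: numeral_2_eq_2)
  also have "\<dots> = deriv (\<lambda>z. of_real (- (C0 * \<mu>)) * z powr (- of_real (\<mu> + 1))) 1"
  proof (rule deriv_cong_ev)
    have "\<forall>\<^sub>F z in nhds (1::complex). z \<in> {z. Re z > 0}"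
      by (intro eventually_nhds_in_open open_right) auto
    then show "\<forall>\<^sub>F z in nhds 1. deriv h_lim z = of_real (- (C0 * \<mu>)) * z powr (- of_real (\<mu> + 1))"
      by eventually_elim (use d in \<open>auto simp: h_lim_def[abs_def]\<close>)
  qed simp
  also have "\<dots> = of_real (C0 * \<mu> * (\<mu> + 1))" by (subst d) auto
  finally show ?thesis .
qed

text \<open>A real power of 1 - i u has modulus equal to that power of the modulus, so for u away
  from 0 the real part drops strictly below its value at u = 0.\<close>

lemma h_lim_Re:
  "Re (h_lim (1 - \<i> * of_real u)) - Re (h_lim 1) \<le> C0 * ((1 + u\<^sup>2) powr (- \<mu> / 2) - 1)"
proof -
  let ?z = "1 - \<i> * complex_of_real u"
  have "?z \<noteq> 0" by (auto simp: complex_eq_iff)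
  then have "norm (?z powr (- of_real \<mu>)) = norm ?z powr (- \<mu>)"
    by (simp add: norm_powr_real_powr' powr_def)
  also have "norm ?z = (1 + u\<^sup>2) powr (1 / 2)"
    by (simp add: cmod_def powr_half_sqrt add_nonneg_nonneg)
  finally have "norm (?z powr (- of_real \<mu>)) = (1 + u\<^sup>2) powr (- \<mu> / 2)" by (simp add: powr_powr)
  then have "Re (?z powr (- of_real \<mu>)) \<le> (1 + u\<^sup>2) powr (- \<mu> / 2)"
    using complex_Re_le_cmod[of "?z powr (- of_real \<mu>)"] by simp
  then show ?thesis using C0_pos by (simp add: h_lim_def right_diff_distrib)
qed

end

text \<open>The saddle point equation has no solution at n = 0, hence the requirement holds only
  eventually and \<open>a\<close> is merely positive elsewhere.\<close>

locale saddle_seq = first_order +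
  fixes a :: "nat \<Rightarrow> real"
  assumes a_pos: "a n > 0" and a_lim: "a \<longlonglongrightarrow> 0"
    and saddle: "\<forall>\<^sub>F n in sequentially. eval_fps weightS (of_real (exp (- a n))) = of_nat n"
begin

text \<open>By the chain rule the derivative brings out the logarithmic derivative
  \<open>weightS\<close> of \<open>T\<^sub>0\<close>, which equals n at the saddle point.\<close>

lemma h_deriv_1:
  "\<forall>\<^sub>F n in sequentially. deriv (h (a n)) 1 = - of_real (a n powr \<mu> * a n * real n)"
  using saddle
proof eventually_elim
  case (elim n)
  let ?w = "exp (- (complex_of_real (a n) * 1))"
  have w: "?w = of_real (exp (- a n))" by (metis exp_of_real of_real_minus mult.right_neutral)
  have nw: "norm ?w < fps_conv_radius logF"
    using a_pos[of n] by (intro norm_less_radius logF_radius) (simp add: w)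
  have "fps_conv_radius (fps_deriv logF) \<ge> 1" using fps_conv_radius_deriv[of logF] logF_radius by (rule order.trans[rotated])
  then have "eval_fps (fps_X * fps_deriv logF) ?w = ?w * eval_fps (fps_deriv logF) ?w"
    using a_pos[of n] by (subst eval_fps_mult) (auto simp: w intro!: ereal_less_radius)
  moreover have "eval_fps weightS ?w = of_nat n" unfolding w by (rule elim)
  ultimately have S: "?w * eval_fps (fps_deriv logF) ?w = of_nat n"
    by (simp only: X_deriv_logF)
  have d: "(eval_fps logF has_field_derivative eval_fps (fps_deriv logF) ?w) (at ?w)"
    by (rule has_field_derivative_eval_fps[OF nw])
  have "((\<lambda>z. exp (- (complex_of_real (a n) * z))) has_field_derivative - of_real (a n) * ?w) (at 1)"
    by (auto intro!: derivative_eq_intros)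
  from DERIV_chain2[OF d this]
  have "(h (a n) has_field_derivative of_real (a n powr \<mu>) * (eval_fps (fps_deriv logF) ?w * (- of_real (a n) * ?w))) (at 1)"
    unfolding h_def[abs_def] by (rule DERIV_cmult)
  then have "deriv (h (a n)) 1 = of_real (a n powr \<mu>) * (eval_fps (fps_deriv logF) ?w * (- of_real (a n) * ?w))"
    by (rule DERIV_imp_deriv)
  also have "\<dots> = - (of_real (a n powr \<mu>) * of_real (a n) * (?w * eval_fps (fps_deriv logF) ?w))" by simp
  also have "\<dots> = - of_real (a n powr \<mu> * a n * real n)" unfolding S by simp
  finally show ?case .
qed

text \<open>The normalised logarithm of the characteristic function; the saddle point equation cancels its
  linear term.\<close>

definition \<Psi> :: "nat \<Rightarrow> real \<Rightarrow> complex" where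
  "\<Psi> n u = h (a n) (1 - \<i> * of_real u) - h (a n) 1 - \<i> * of_real (a n powr \<mu> * a n * real n * u)"

text \<open>Taylor expansion of \<open>h (a n)\<close> at 1 with increment -i u: the linear term
  cancels against the one subtracted in \<open>\<Psi>\<close>, and the third derivative is bounded
  uniformly by Cauchy's estimate.\<close>

lemma Psi_taylor:
  "\<exists>B>0. \<forall>\<^sub>F n in sequentially. \<forall>u. \<bar>u\<bar> < 1 / 4 \<longrightarrow>
     norm (\<Psi> n u + of_real (u\<^sup>2) * ((deriv ^^ 2) (h (a n)) 1 / 2)) \<le> B * \<bar>u\<bar> ^ 3"
proof -
  note sub = cball_half_subset
  obtain B0 where B0: "\<And>n z. z \<in> cball 1 (1 / 2) \<Longrightarrow> norm (h (a n) z) \<le> B0"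
    using h_uniform(1)[OF a_pos a_lim compact_cball sub] by blast
  \<comment> \<open>Cauchy's constant for third derivatives on circles of radius 1/4, which stay in
    the disc of radius 1/2 about 1; the added 1 makes B positive.\<close>
  define B where "B = fact 3 * (\<bar>B0\<bar> + 1) / (1 / 4) ^ 3"
  have B: "B > 0" by (auto simp: B_def)
  have third: "norm ((deriv ^^ 3) (h (a n)) z) \<le> B" if z: "z \<in> ball 1 (1 / 4)" for n z
    unfolding B_def
  proof (rule Cauchy_inequality)
    have s: "cball z (1 / 4) \<subseteq> cball 1 (1 / 2)"
      using z by (intro cball_subset_cball_iff[THEN iffD2]) (auto simp: dist_commute)
    have holo: "h (a n) holomorphic_on cball z (1 / 4)"
      by (rule holomorphic_on_subset[OF h_holo[OF a_pos]]) (use s sub in auto)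
    show "h (a n) holomorphic_on ball z (1 / 4)" by (rule holomorphic_on_subset[OF holo]) auto
    show "continuous_on (cball z (1 / 4)) (h (a n))" by (rule holomorphic_on_imp_continuous_on[OF holo])
    fix x assume "norm (z - x) = 1 / 4"
    then have "x \<in> cball z (1 / 4)" by (simp add: dist_norm)
    then have "x \<in> cball 1 (1 / 2)" using s by blast
    from B0[OF this, of n] show "norm (h (a n) x) \<le> \<bar>B0\<bar> + 1" by linarith
  qed auto
  have "\<forall>\<^sub>F n in sequentially. \<forall>u. \<bar>u\<bar> < 1 / 4 \<longrightarrow>
     norm (\<Psi> n u + of_real (u\<^sup>2) * ((deriv ^^ 2) (h (a n)) 1 / 2)) \<le> B / 2 * \<bar>u\<bar> ^ 3"
    using h_deriv_1
  proof eventually_elim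
    case (elim n)
    show ?case
    proof (intro allI impI)
      fix u :: real assume u: "\<bar>u\<bar> < 1 / 4"
      let ?z = "1 - \<i> * complex_of_real u"
      have zin: "?z \<in> ball 1 (1 / 4)" using u by (simp add: dist_norm norm_mult)
      have "norm ((deriv ^^ 0) (h (a n)) ?z - (\<Sum>i\<le>2. (deriv ^^ i) (h (a n)) 1 * (?z - 1) ^ i / fact i)) \<le> B * norm (?z - 1) ^ Suc 2 / fact 2"
      proof (rule complex_Taylor[of "ball 1 (1 / 4)"])
        fix i and x :: complex assume x: "x \<in> ball 1 (1 / 4)"
        have "(deriv ^^ i) (h (a n)) holomorphic_on {z. Re z > 0}"
          by (intro holomorphic_higher_deriv h_holo a_pos open_right)
        moreover have "x \<in> {z. Re z > 0}"
          using x by (intro subsetD[OF sub]) (auto simp: dist_norm)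
        ultimately have "((deriv ^^ i) (h (a n)) has_field_derivative deriv ((deriv ^^ i) (h (a n))) x) (at x)"
          using open_right holomorphic_derivI by blast
        then show "((deriv ^^ i) (h (a n)) has_field_derivative (deriv ^^ Suc i) (h (a n)) x) (at x within ball 1 (1 / 4))"
          by (auto intro: has_field_derivative_at_within)
      next
        fix x :: complex assume x: "x \<in> ball 1 (1 / 4)"
        show "norm ((deriv ^^ Suc 2) (h (a n)) x) \<le> B"
          using third[OF x, of n] by (simp add: eval_nat_numeral)
      qed (use zin in auto)
      also have "(deriv ^^ 0) (h (a n)) ?z - (\<Sum>i\<le>2. (deriv ^^ i) (h (a n)) 1 * (?z - 1) ^ i / fact i) =
          \<Psi> n u + of_real (u\<^sup>2) * ((deriv ^^ 2) (h (a n)) 1 / 2)"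
        by (simp add: \<Psi>_def elim eval_nat_numeral power2_eq_square algebra_simps)
      also have "norm (?z - 1) = \<bar>u\<bar>" by (simp add: norm_mult)
      finally show "norm (\<Psi> n u + of_real (u\<^sup>2) * ((deriv ^^ 2) (h (a n)) 1 / 2)) \<le> B / 2 * \<bar>u\<bar> ^ 3"
        by (simp add: eval_nat_numeral)
    qed
  qed
  then show ?thesis using B by (intro exI[of _ "B / 2"]) auto
qed

lemma h_deriv2_lim: "(\<lambda>n. (deriv ^^ 2) (h (a n)) 1) \<longlonglongrightarrow> of_real (C0 * \<mu> * (\<mu> + 1))"
proof -
  note sub = cball_half_subset
  have "uniform_limit (ball 1 (1 / 2)) (\<lambda>n. h (a n)) h_lim sequentially"
    by (rule uniform_limit_on_subset[OF h_uniform(2)[OF a_pos a_lim compact_cball sub] ball_subset_cball])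
  then have "(\<lambda>n. (deriv ^^ 2) (h (a n)) 1) \<longlonglongrightarrow> (deriv ^^ 2) h_lim 1"
  proof (rule higher_deriv_complex_uniform_limit)
    show "\<forall>\<^sub>F n in sequentially. h (a n) holomorphic_on ball 1 (1 / 2)"
      using sub ball_subset_cball by (intro always_eventually allI holomorphic_on_subset[OF h_holo[OF a_pos]]) blast
  qed auto
  then show ?thesis by (simp only: h_lim_deriv2)
qed

text \<open>Its square undoes the normalising factor in \<open>h\<close>, so that
  \<open>(r n)\<^sup>2 * \<Psi> n u\<close> is the true logarithm of the characteristic function for
  k = 0.\<close>

definition r :: "nat \<Rightarrow> real" where
  "r n = a n powr (- \<mu> / 2)"

lemma r_pos: "r n > 0" using a_pos[of n] by (simp add: r_def)

lemma r_sq: "(r n)\<^sup>2 = a n powr (- \<mu>)"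
  using a_pos[of n] by (simp add: r_def power2_eq_square flip: powr_add)

lemma r_lim: "filterlim r at_top sequentially"
proof -
  have "filterlim a (at_right 0) sequentially"
    unfolding filterlim_at using a_pos a_lim less_imp_neq[OF a_pos] by (auto intro!: always_eventually)
  moreover have "filterlim (\<lambda>x::real. x powr (- \<mu> / 2)) at_top (at_right 0)"
    using mu by real_asymp
  ultimately show ?thesis unfolding r_def[abs_def] by (rule filterlim_compose[rotated])
qed

text \<open>Half the second derivative of \<open>h_lim\<close> at 1.\<close>

definition s :: real where "s = C0 * \<mu> * (\<mu> + 1) / 2"

lemma s_pos: "s > 0" using C0_pos mu by (simp add: s_def)

lemma Psi_lim: "(\<lambda>n. of_real ((r n)\<^sup>2) * \<Psi> n (v / r n)) \<longlonglongrightarrow> of_real (- s * v\<^sup>2)"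
proof -
  obtain B where B: "B > 0" "\<forall>\<^sub>F n in sequentially. \<forall>u. \<bar>u\<bar> < 1 / 4 \<longrightarrow>
     norm (\<Psi> n u + of_real (u\<^sup>2) * ((deriv ^^ 2) (h (a n)) 1 / 2)) \<le> B * \<bar>u\<bar> ^ 3"
    using Psi_taylor by blast
  have v0: "(\<lambda>n. v / r n) \<longlonglongrightarrow> 0"
    by (intro tendsto_divide_0[OF tendsto_const] filterlim_at_top_imp_at_infinity r_lim)
  have small: "\<forall>\<^sub>F n in sequentially. \<bar>v / r n\<bar> < 1 / 4"
    using tendstoD[OF v0, of "1 / 4"] by (simp add: dist_real_def)
  have "(\<lambda>n. of_real ((r n)\<^sup>2) * \<Psi> n (v / r n) + of_real (v\<^sup>2) * ((deriv ^^ 2) (h (a n)) 1 / 2)) \<longlonglongrightarrow> 0"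
  proof (rule Lim_null_comparison)
    show "\<forall>\<^sub>F n in sequentially. norm (of_real ((r n)\<^sup>2) * \<Psi> n (v / r n) + of_real (v\<^sup>2) * ((deriv ^^ 2) (h (a n)) 1 / 2))
            \<le> B * v\<^sup>2 * \<bar>v / r n\<bar>"
      using B(2) small
    proof eventually_elim
      case (elim n)
      have rp: "r n > 0" by (rule r_pos)
      have "of_real ((r n)\<^sup>2) * \<Psi> n (v / r n) + of_real (v\<^sup>2) * ((deriv ^^ 2) (h (a n)) 1 / 2) =
          of_real ((r n)\<^sup>2) * (\<Psi> n (v / r n) + of_real ((v / r n)\<^sup>2) * ((deriv ^^ 2) (h (a n)) 1 / 2))"
        using rp by (simp add: field_simps)
      also have "norm \<dots> \<le> (r n)\<^sup>2 * (B * \<bar>v / r n\<bar> ^ 3)"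
      proof -
        have "norm (\<Psi> n (v / r n) + of_real ((v / r n)\<^sup>2) * ((deriv ^^ 2) (h (a n)) 1 / 2)) \<le> B * \<bar>v / r n\<bar> ^ 3"
          using elim by blast
        then show ?thesis unfolding norm_mult norm_of_real abs_power2 by (rule mult_left_mono) simp
      qed
      also have "\<dots> = B * v\<^sup>2 * \<bar>v / r n\<bar>"
        using rp by (simp add: power3_eq_cube power2_eq_square field_simps flip: abs_mult)
      finally show ?case .
    qed
    show "(\<lambda>n. B * v\<^sup>2 * \<bar>v / r n\<bar>) \<longlonglongrightarrow> 0"
      using tendsto_mult_right_zero[OF tendsto_rabs_zero[OF v0]] .
  qed
  moreover have "(\<lambda>n. of_real (v\<^sup>2) * ((deriv ^^ 2) (h (a n)) 1 / 2)) \<longlonglongrightarrow> of_real (v\<^sup>2) * (of_real (C0 * \<mu> * (\<mu> + 1)) / 2)"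
    by (intro tendsto_mult tendsto_const tendsto_divide h_deriv2_lim) simp
  ultimately have "(\<lambda>n. (of_real ((r n)\<^sup>2) * \<Psi> n (v / r n) + of_real (v\<^sup>2) * ((deriv ^^ 2) (h (a n)) 1 / 2)) - of_real (v\<^sup>2) * ((deriv ^^ 2) (h (a n)) 1 / 2))
     \<longlonglongrightarrow> 0 - of_real (v\<^sup>2) * (of_real (C0 * \<mu> * (\<mu> + 1)) / 2)"
    by (rule tendsto_diff)
  then show ?thesis by (simp add: s_def mult.commute)
qed

text \<open>Two ranges: for small u the quadratic Taylor term outweighs the cubic error, and for the
  remaining bounded u the strict drop of the real part of \<open>h_lim\<close> survives the uniform
  approximation.\<close>

lemma Psi_dom:
  assumes T: "T > 0"
  shows "\<exists>d>0. \<forall>\<^sub>F n in sequentially. \<forall>u. \<bar>u\<bar> \<le> T \<longrightarrow> Re (\<Psi> n u) \<le> - d * u\<^sup>2"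
proof -
  obtain B where B: "B > 0" "\<forall>\<^sub>F n in sequentially. \<forall>u. \<bar>u\<bar> < 1 / 4 \<longrightarrow>
     norm (\<Psi> n u + of_real (u\<^sup>2) * ((deriv ^^ 2) (h (a n)) 1 / 2)) \<le> B * \<bar>u\<bar> ^ 3"
    using Psi_taylor by blast
  \<comment> \<open>The first bound stays inside the range of \<open>Psi_taylor\<close>; the second
    makes the cubic error at most half of the quadratic term, eventually at least s/2 times the
    square of u.\<close>
  define u0 where "u0 = min (1 / 8) (s / (4 * B))"
  have u0: "0 < u0" "u0 < 1 / 4" "B * u0 \<le> s / 4" using s_pos B by (auto simp: u0_def min_def field_simps)
  define D where "D = C0 * (1 - (1 + u0\<^sup>2) powr (- \<mu> / 2))"
  have D: "D > 0"
  proof -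
    have "(1 + u0\<^sup>2) powr (- \<mu> / 2) < (1 + u0\<^sup>2) powr 0"
      using mu u0 by (intro powr_less_mono) auto
    also have "(1 + u0\<^sup>2) powr 0 = 1" using add_pos_nonneg[of 1 "u0\<^sup>2"] by simp
    finally show ?thesis using C0_pos unfolding D_def by (intro mult_pos_pos) auto
  qed
  define d where "d = min (s / 4) (D / (2 * T\<^sup>2))"
  have d: "d > 0" "d \<le> s / 4" "d * T\<^sup>2 \<le> D / 2" using D s_pos T by (auto simp: d_def min_def field_simps)
  let ?K = "(\<lambda>u. 1 - \<i> * complex_of_real u) ` {- T..T}"
  have "uniform_limit ?K (\<lambda>n. h (a n)) h_lim sequentially"
    by (intro h_uniform a_pos a_lim compact_continuous_image continuous_intros) auto
  from uniform_limitD[OF this, of "D / 4"] D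
  have unif: "\<forall>\<^sub>F n in sequentially. \<forall>z\<in>?K. dist (h (a n) z) (h_lim z) < D / 4" by simp
  have "(\<lambda>n. Re ((deriv ^^ 2) (h (a n)) 1)) \<longlonglongrightarrow> 2 * s"
    using tendsto_Re[OF h_deriv2_lim] by (simp add: s_def)
  from order_tendstoD(1)[OF this, of s] s_pos
  have d2: "\<forall>\<^sub>F n in sequentially. Re ((deriv ^^ 2) (h (a n)) 1) > s" by simp
  have "\<forall>\<^sub>F n in sequentially. \<forall>u. \<bar>u\<bar> \<le> T \<longrightarrow> Re (\<Psi> n u) \<le> - d * u\<^sup>2"
    using B(2) unif d2
  proof eventually_elim
    case (elim n)
    show ?case
    proof (intro allI impI)
      fix u :: real assume u: "\<bar>u\<bar> \<le> T"
      show "Re (\<Psi> n u) \<le> - d * u\<^sup>2"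
      proof (cases "\<bar>u\<bar> < u0")
        case True
        have "Re (\<Psi> n u + of_real (u\<^sup>2) * ((deriv ^^ 2) (h (a n)) 1 / 2)) \<le> B * \<bar>u\<bar> ^ 3"
          using elim(1) True u0 by (intro order.trans[OF complex_Re_le_cmod]) auto
        then have "Re (\<Psi> n u) \<le> B * \<bar>u\<bar> ^ 3 - u\<^sup>2 * (Re ((deriv ^^ 2) (h (a n)) 1) / 2)"
          by simp
        also have "B * \<bar>u\<bar> ^ 3 = (B * \<bar>u\<bar>) * u\<^sup>2" by (simp add: power3_eq_cube power2_eq_square flip: abs_mult)
        also have "\<dots> \<le> (s / 4) * u\<^sup>2"
        proof (rule mult_right_mono)
          have "B * \<bar>u\<bar> \<le> B * u0" using True B by (intro mult_left_mono) auto
          then show "B * \<bar>u\<bar> \<le> s / 4" using u0 by linarith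
        qed simp
        finally have "Re (\<Psi> n u) \<le> s / 4 * u\<^sup>2 - u\<^sup>2 * (Re ((deriv ^^ 2) (h (a n)) 1) / 2)" by simp
        moreover have "u\<^sup>2 * (s / 2) \<le> u\<^sup>2 * (Re ((deriv ^^ 2) (h (a n)) 1) / 2)"
          using elim(3) by (intro mult_left_mono) auto
        ultimately have "Re (\<Psi> n u) \<le> s / 4 * u\<^sup>2 - u\<^sup>2 * (s / 2)" by linarith
        also have "\<dots> = - (s / 4) * u\<^sup>2" by (simp add: field_simps)
        also have "\<dots> \<le> - d * u\<^sup>2" using d by (intro mult_right_mono) auto
        finally show ?thesis .
      next
        case False
        have in1: "1 - \<i> * complex_of_real u \<in> ?K" using u by (intro imageI) auto
        have in2: "1 \<in> ?K" using T by (intro image_eqI[of _ _ 0]) auto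
        have "Re (\<Psi> n u) = Re (h (a n) (1 - \<i> * complex_of_real u)) - Re (h (a n) 1)"
          by (simp add: \<Psi>_def)
        \<comment> \<open>An error of D / 4 at each of the two points; half of the drop D
          remains.\<close>
        also have "\<dots> \<le> (Re (h_lim (1 - \<i> * complex_of_real u)) - Re (h_lim 1)) + D / 2"
          using elim(2)[rule_format, OF in1] elim(2)[rule_format, OF in2]
            abs_Re_le_cmod[of "h (a n) (1 - \<i> * complex_of_real u) - h_lim (1 - \<i> * complex_of_real u)"]
            abs_Re_le_cmod[of "h (a n) 1 - h_lim 1"]
          unfolding dist_norm minus_complex.simps by linarith
        also have "\<dots> \<le> C0 * ((1 + u\<^sup>2) powr (- \<mu> / 2) - 1) + D / 2"
          by (intro add_right_mono h_lim_Re)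
        also have "\<dots> \<le> - D + D / 2"
        proof -
          have "u0\<^sup>2 \<le> u\<^sup>2" using False u0 by (intro abs_le_square_iff[THEN iffD1]) auto
          then have "(1 + u\<^sup>2) powr (- \<mu> / 2) \<le> (1 + u0\<^sup>2) powr (- \<mu> / 2)"
            using mu by (intro powr_mono2') (auto intro: add_pos_nonneg)
          from mult_left_mono[OF this, of C0] C0_pos show ?thesis by (simp add: D_def algebra_simps)
        qed
        also have "\<dots> = - (D / 2)" by simp
        also have "\<dots> \<le> - d * u\<^sup>2"
        proof -
          have "u\<^sup>2 \<le> T\<^sup>2" using u T by (intro abs_le_square_iff[THEN iffD1]) auto
          then have "d * u\<^sup>2 \<le> d * T\<^sup>2" using d by (intro mult_left_mono) auto
          then show ?thesis using d by linarith
        qed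
        finally show ?thesis .
      qed
    qed
  qed
  then show ?thesis using d by blast
qed

section \<open>The tilted moments of arbitrary order\<close>

definition Bell :: "nat \<Rightarrow> real \<Rightarrow> real" where
  "Bell k t = bell_rec (\<lambda>i. kap (real i - 1) t) k"

lemma Bell_pos: "t > 0 \<Longrightarrow> Bell k t > 0"
  unfolding Bell_def by (intro bell_rec_pos kap_pos)

abbreviation BF :: "nat \<Rightarrow> complex fps" where "BF k \<equiv> bell_rec powK k"

lemma BF_radius: "fps_conv_radius (BF k) \<ge> 1"
  by (rule bell_rec_fps(1)[OF powK_radius])

lemma BF_nonneg: "nonneg_fps (BF k)"
  by (rule nonneg_fps_bell_rec[OF nonneg_powK])

lemma eval_BF:
  assumes "t > 0"
  shows "eval_fps (BF k) (of_real (exp (- t))) = of_real (Bell k t)"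
proof -
  have "ereal (norm (complex_of_real (exp (- t)))) < 1" using assms by (simp add: one_ereal_def)
  from bell_rec_fps(2)[OF powK_radius this]
  show ?thesis using assms by (simp only: eval_powK Bell_def bell_rec_of_real)
qed

lemma eval_momT: "norm z < 1 \<Longrightarrow> eval_fps (momT k) z = exp (eval_fps logF z) * eval_fps (BF k) z"
  unfolding momT_eq[of k]
  by (subst eval_fps_mult) (auto intro!: norm_less_radius momT_0(1) BF_radius simp: momT_0(2))

definition TT :: "nat \<Rightarrow> nat \<Rightarrow> real" where
  "TT k n = exp (kap (- 1) (a n)) * Bell k (a n)"

lemma TT_pos: "TT k n > 0"
  unfolding TT_def using Bell_pos[OF a_pos] by simp

lemma eval_momT_real: "eval_fps (momT k) (of_real (exp (- a n))) = of_real (TT k n)"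
proof -
  have "norm (complex_of_real (exp (- a n))) < 1" using a_pos[of n] by simp
  from eval_momT[OF this] have "eval_fps (momT k) (of_real (exp (- a n))) =
     exp (of_real (kap (- 1) (a n))) * of_real (Bell k (a n))"
    using eval_powK[OF a_pos, of 0 n] by (simp only: eval_BF[OF a_pos] logF_def) simp
  then show ?thesis by (simp only: TT_def exp_of_real of_real_mult)
qed

lemma moment_sums:
  assumes "norm z < 1"
  shows "(\<lambda>m. of_real (moment \<Lambda> k m) * z ^ m) sums eval_fps (momT k) z"
proof -
  have "summable (\<lambda>m. fps_nth (momT k) m * z ^ m)"
    by (intro summable_fps norm_less_radius momT_radius assms)
  then show ?thesis unfolding eval_fps_def by (simp add: momT_def summable_sums)
qed

definition Q :: "nat \<Rightarrow> nat \<Rightarrow> nat \<Rightarrow> real" where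
  "Q k n m = moment \<Lambda> k m * exp (- a n) ^ m / TT k n"

lemma Q_sums: "Q k n sums 1"
proof -
  have "norm (complex_of_real (exp (- a n))) < 1" using a_pos[of n] by simp
  from sums_Re[OF moment_sums[OF this, of k, unfolded eval_momT_real]]
  have "(\<lambda>m. moment \<Lambda> k m * exp (- a n) ^ m) sums TT k n"
    by (simp flip: of_real_power of_real_mult)
  from sums_divide[OF this, of "TT k n"] show ?thesis
    unfolding Q_def[abs_def] using TT_pos[of k n] by simp
qed

lemma rot_point: "exp (- (complex_of_real (a n) * (1 - \<i> * of_real u))) = of_real (exp (- a n)) * cis (u * a n)"
proof -
  have "- (complex_of_real (a n) * (1 - \<i> * of_real u)) = of_real (- a n) + \<i> * of_real (u * a n)"
    by (simp add: algebra_simps)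
  then show ?thesis by (simp only: exp_add cis_conv_exp exp_of_real)
qed

text \<open>The factor by which the characteristic function for k differs from the one for k =
  0.\<close>

definition gg :: "nat \<Rightarrow> nat \<Rightarrow> real \<Rightarrow> complex" where
  "gg k n u = eval_fps (BF k) (exp (- (of_real (a n) * (1 - \<i> * of_real u)))) / of_real (Bell k (a n))"

lemma Q_char: "(\<Sum>m. of_real (Q k n m) * cis (u * a n * (real m - real n))) = exp (of_real ((r n)\<^sup>2) * \<Psi> n u) * gg k n u"
proof -
  let ?w = "exp (- (complex_of_real (a n) * (1 - \<i> * of_real u)))"
  have nw: "norm ?w < 1" unfolding rot_point using a_pos[of n] by (simp add: norm_mult)
  have "(\<lambda>m. of_real (moment \<Lambda> k m) * ?w ^ m * (cis (- (u * a n * real n)) / of_real (TT k n)))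
          sums (eval_fps (momT k) ?w * (cis (- (u * a n * real n)) / of_real (TT k n)))"
    by (rule sums_mult2[OF moment_sums[OF nw]])
  also have "(\<lambda>m. of_real (moment \<Lambda> k m) * ?w ^ m * (cis (- (u * a n * real n)) / of_real (TT k n))) =
     (\<lambda>m. of_real (Q k n m) * cis (u * a n * (real m - real n)))"
  proof
    fix m
    have "cis (real m * (u * a n)) * cis (- (u * a n * real n)) = cis (u * a n * (real m - real n))"
      by (simp add: cis_mult algebra_simps)
    moreover have "?w ^ m = of_real (exp (- a n) ^ m) * cis (real m * (u * a n))"
      unfolding rot_point power_mult_distrib Complex.DeMoivre of_real_power ..
    ultimately show "of_real (moment \<Lambda> k m) * ?w ^ m * (cis (- (u * a n * real n)) / of_real (TT k n)) =
        of_real (Q k n m) * cis (u * a n * (real m - real n))"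
      unfolding Q_def by (simp only: of_real_divide of_real_mult times_divide_eq_right times_divide_eq_left mult.assoc)
  qed
  finally have "(\<Sum>m. of_real (Q k n m) * cis (u * a n * (real m - real n))) =
      eval_fps (momT k) ?w * (cis (- (u * a n * real n)) / of_real (TT k n))"
    by (rule sums_unique[symmetric])
  also have "\<dots> = exp (eval_fps logF ?w) * eval_fps (BF k) ?w * (cis (- (u * a n * real n)) / (exp (of_real (kap (- 1) (a n))) * of_real (Bell k (a n))))"
    by (simp only: eval_momT[OF nw] TT_def of_real_mult exp_of_real)
  also have "\<dots> = (exp (eval_fps logF ?w) * cis (- (u * a n * real n)) / exp (of_real (kap (- 1) (a n)))) * gg k n u"
    by (simp add: gg_def)
  also have "exp (eval_fps logF ?w) * cis (- (u * a n * real n)) / exp (of_real (kap (- 1) (a n))) =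
     exp (eval_fps logF ?w + \<i> * of_real (- (u * a n * real n)) - of_real (kap (- 1) (a n)))"
    by (simp only: exp_diff exp_add cis_conv_exp)
  also have "eval_fps logF ?w + \<i> * of_real (- (u * a n * real n)) - of_real (kap (- 1) (a n)) = of_real ((r n)\<^sup>2) * \<Psi> n u"
  proof -
    define P where "P = complex_of_real (a n powr \<mu>)"
    have P: "of_real ((r n)\<^sup>2) * P = 1"
      unfolding r_sq P_def of_real_mult[symmetric] using a_pos[of n] by (simp flip: powr_add)
    have h1: "h (a n) 1 = P * of_real (kap (- 1) (a n))"
      using h_real[OF a_pos, of 1 n] by (simp add: P_def)
    have "of_real ((r n)\<^sup>2) * \<Psi> n u = (of_real ((r n)\<^sup>2) * P) * (eval_fps logF ?w - of_real (kap (- 1) (a n)) - \<i> * of_real (u * a n * real n))"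
      unfolding \<Psi>_def h1 by (simp add: h_def P_def algebra_simps)
    then show ?thesis unfolding P by simp
  qed
  finally show ?thesis .
qed

text \<open>Nonnegative coefficients of the Bell series. Consequently the Gaussian majorant found
  for k = 0 holds for all k.\<close>

lemma gg_le: "norm (gg k n u) \<le> 1"
proof -
  let ?w = "exp (- (complex_of_real (a n) * (1 - \<i> * of_real u)))"
  have nw: "norm ?w = exp (- a n)" unfolding rot_point by (simp add: norm_mult)
  have "norm (eval_fps (BF k) ?w) \<le> Re (eval_fps (BF k) (of_real (norm ?w)))"
    by (rule nonneg_fps_norm_le[OF BF_nonneg BF_radius]) (use nw a_pos[of n] in simp)
  also have "\<dots> = Bell k (a n)" unfolding nw eval_BF[OF a_pos] by simp
  finally show ?thesis using Bell_pos[OF a_pos, of k n] by (simp add: gg_def norm_divide)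
qed

text \<open>With the doubling bound K the rotation estimate becomes 2 K |u|, independent of
  n.\<close>

lemma gg_lim:
  assumes K: "\<forall>\<^sub>F n in sequentially. Bell k (a n / 2) \<le> K * Bell k (a n)" and u: "u \<longlonglongrightarrow> 0"
  shows "(\<lambda>n. gg k n (u n)) \<longlonglongrightarrow> 1"
proof -
  have "(\<lambda>n. gg k n (u n) - 1) \<longlonglongrightarrow> 0"
  proof (rule Lim_null_comparison)
    show "(\<lambda>n. \<bar>u n\<bar> * (2 * K)) \<longlonglongrightarrow> 0"
      using tendsto_mult_left_zero[OF tendsto_rabs_zero[OF u]] .
    show "\<forall>\<^sub>F n in sequentially. norm (gg k n (u n) - 1) \<le> \<bar>u n\<bar> * (2 * K)"
      using K
    proof eventually_elim
      case (elim n)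
      let ?w = "exp (- (complex_of_real (a n) * (1 - \<i> * of_real (u n))))"
      have B: "Bell k (a n) > 0" by (rule Bell_pos[OF a_pos])
      have e: "eval_fps (BF k) (exp (- complex_of_real (a n))) = of_real (Bell k (a n))"
        using eval_BF[OF a_pos, of k n] by (metis exp_of_real of_real_minus)
      have "gg k n (u n) - 1 = (eval_fps (BF k) ?w - eval_fps (BF k) (exp (- complex_of_real (a n)))) / of_real (Bell k (a n))"
        unfolding gg_def e using B by (simp add: diff_divide_distrib)
      then have "norm (gg k n (u n) - 1) = norm (eval_fps (BF k) ?w - eval_fps (BF k) (exp (- complex_of_real (a n)))) / Bell k (a n)"
        using B by (simp add: norm_divide)
      also have "\<dots> \<le> \<bar>u n\<bar> * (2 * Re (eval_fps (BF k) (of_real (exp (- (a n / 2)))))) / Bell k (a n)"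
        using B by (intro divide_right_mono nonneg_fps_rotate BF_nonneg BF_radius a_pos) auto
      also have "Re (eval_fps (BF k) (of_real (exp (- (a n / 2))))) = Bell k (a n / 2)"
        using eval_BF[of "a n / 2" k] a_pos[of n] by (simp only: half_gt_zero) simp
      also have "\<bar>u n\<bar> * (2 * Bell k (a n / 2)) / Bell k (a n) \<le> \<bar>u n\<bar> * (2 * (K * Bell k (a n))) / Bell k (a n)"
        using B elim by (intro divide_right_mono mult_left_mono) auto
      also have "\<dots> = \<bar>u n\<bar> * (2 * K)" using B by simp
      finally show ?case .
    qed
  qed
  from tendsto_add[OF this tendsto_const[of 1]] show ?thesis by simp
qed

lemma lattice_family_Q:
  assumes K: "\<forall>\<^sub>F n in sequentially. Bell k (a n / 2) \<le> K * Bell k (a n)"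
  shows "lattice_family (Q k) a r s"
proof
  show "Q k n m \<ge> 0" for n m
    unfolding Q_def using TT_pos[of k n] moment_nonneg[of k m] by simp
  show "summable (Q k n)" for n by (rule sums_summable[OF Q_sums])
  \<comment> \<open>Undoing the tilt leaves the moments over a constant, so this is precisely their
    monotonicity.\<close>
  show "Q k n m * exp (a n * real m) \<le> Q k n m' * exp (a n * real m')" if "m \<le> m'" for m m' n
  proof -
    have "Q k n m * exp (a n * real m) = moment \<Lambda> k m / TT k n" for m
    proof -
      have "exp (- a n) ^ m * exp (a n * real m) = 1" by (simp flip: exp_of_nat_mult exp_add)
      then show ?thesis unfolding Q_def by (simp add: field_simps)
    qed
    then show ?thesis using moment_mono[OF one that, of k] TT_pos[of k n] by (simp add: divide_right_mono)
  qed
  show "(\<lambda>n. \<Sum>m. of_real (Q k n m) * cis (v / r n * a n * (real m - real n))) \<longlonglongrightarrow> of_real (exp (- s * v\<^sup>2))" for v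
  proof -
    have v0: "(\<lambda>n. v / r n) \<longlonglongrightarrow> 0"
      by (intro tendsto_divide_0[OF tendsto_const] filterlim_at_top_imp_at_infinity r_lim)
    have "(\<lambda>n. exp (of_real ((r n)\<^sup>2) * \<Psi> n (v / r n)) * gg k n (v / r n)) \<longlonglongrightarrow> exp (of_real (- s * v\<^sup>2)) * 1"
      by (intro tendsto_mult tendsto_exp Psi_lim gg_lim[OF K v0])
    then show ?thesis unfolding Q_char by (simp only: exp_of_real mult_1_right)
  qed
  show "\<exists>c>0. \<forall>\<^sub>F n in sequentially. \<forall>u. \<bar>u\<bar> \<le> T \<longrightarrow>
      norm (\<Sum>m. of_real (Q k n m) * cis (u * a n * (real m - real n))) \<le> exp (- c * (r n * u)\<^sup>2)" if T: "T > 0" for T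
  proof -
    obtain d where d: "d > 0" "\<forall>\<^sub>F n in sequentially. \<forall>u. \<bar>u\<bar> \<le> T \<longrightarrow> Re (\<Psi> n u) \<le> - d * u\<^sup>2"
      using Psi_dom[OF T] by blast
    have "\<forall>\<^sub>F n in sequentially. \<forall>u. \<bar>u\<bar> \<le> T \<longrightarrow>
      norm (\<Sum>m. of_real (Q k n m) * cis (u * a n * (real m - real n))) \<le> exp (- d * (r n * u)\<^sup>2)"
      using d(2)
    proof eventually_elim
      case (elim n)
      show ?case
      proof (intro allI impI)
        fix u assume u: "\<bar>u\<bar> \<le> T"
        have "norm (exp (of_real ((r n)\<^sup>2) * \<Psi> n u) * gg k n u) \<le> exp ((r n)\<^sup>2 * Re (\<Psi> n u)) * 1"
          unfolding norm_mult by (intro mult_mono gg_le) (simp_all del: of_real_power)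
        also have "\<dots> \<le> exp ((r n)\<^sup>2 * (- d * u\<^sup>2))"
          using mult_left_mono[OF elim[rule_format, OF u], of "(r n)\<^sup>2"] by simp
        also have "\<dots> = exp (- d * (r n * u)\<^sup>2)" by (simp add: power_mult_distrib mult_ac)
        finally show "norm (\<Sum>m. of_real (Q k n m) * cis (u * a n * (real m - real n))) \<le> exp (- d * (r n * u)\<^sup>2)"
          unfolding Q_char .
      qed
    qed
    then show ?thesis using d(1) by blast
  qed
qed (use a_pos a_lim r_pos r_lim s_pos in auto)

text \<open>In the quotient of the tilted weights at n the exponentials cancel, and the normalising
  constants leave \<open>Bell k (a n)\<close>.\<close>

theorem moment_ratio:
  assumes K: "\<forall>\<^sub>F n in sequentially. Bell k (a n / 2) \<le> K * Bell k (a n)"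
  shows "(\<lambda>n. moment \<Lambda> k n / (moment \<Lambda> 0 n * Bell k (a n))) \<longlonglongrightarrow> 1"
proof -
  have "\<forall>\<^sub>F n in sequentially. Bell 0 (a n / 2) \<le> 1 * Bell 0 (a n)" by (simp add: Bell_def)
  then interpret Q0: lattice_family "Q 0" a r s by (rule lattice_family_Q)
  have m0: "moment \<Lambda> 0 n > 0" for n
    using moment_mono[OF one, of 0 n 0] by (simp add: moment_0_0)
  have "(\<lambda>n. Q k n n / Q 0 n n) \<longlonglongrightarrow> 1"
  proof (rule Q0.ratio_tendsto[OF lattice_family_Q[OF K]])
    show "\<forall>\<^sub>F n in sequentially. Q 0 n n > 0"
      using m0 TT_pos by (intro always_eventually) (simp add: Q_def)
  qed
  also have "(\<lambda>n. Q k n n / Q 0 n n) = (\<lambda>n. moment \<Lambda> k n / (moment \<Lambda> 0 n * Bell k (a n)))"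
  proof
    fix n
    have "TT k n = TT 0 n * Bell k (a n)" by (simp add: TT_def Bell_def)
    then show "Q k n n / Q 0 n n = moment \<Lambda> k n / (moment \<Lambda> 0 n * Bell k (a n))"
      unfolding Q_def using TT_pos[of 0 n] Bell_pos[OF a_pos, of k n] m0[of n] by (simp add: field_simps)
  qed
  finally show ?thesis .
qed

end

section \<open>The Mellin transform and the Dirichlet series\<close>

text \<open>The exponential form of \<open>t\<^bsup>s - 1\<^esup>\<close> avoids the complex power, whose measurability is not
  automatic.\<close>

definition mellin :: "(real \<Rightarrow> real) \<Rightarrow> complex \<Rightarrow> complex" where
  "mellin g s = (LINT t:{0<..}|lborel. exp ((s - 1) * of_real (ln t)) * of_real (g t))"

lemma norm_mellin_kernel: "t > 0 \<Longrightarrow> norm (exp ((s - 1) * of_real (ln t)) :: complex) = t powr (Re s - 1)"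
  by (simp add: powr_def mult.commute)

lemma set_integrable_mellin:
  assumes [measurable]: "g \<in> borel_measurable borel"
    and int: "set_integrable lborel {0<..} (\<lambda>t. t powr (Re s - 1) * g t)"
  shows "set_integrable lborel {0<..} (\<lambda>t. exp ((s - 1) * of_real (ln t)) * complex_of_real (g t))"
proof (rule set_integrable_bound[OF int])
  show "set_borel_measurable lborel {0<..} (\<lambda>t. exp ((s - 1) * of_real (ln t)) * complex_of_real (g t))"
    unfolding set_borel_measurable_def by measurable
  show "AE x in lborel. x \<in> {0<..} \<longrightarrow>
    norm (exp ((s - 1) * of_real (ln x)) * complex_of_real (g x)) \<le> norm (x powr (Re s - 1) * g x)"
    by (intro always_eventually allI impI) (simp add: norm_mult norm_mellin_kernel abs_mult del: norm_exp_eq_Re)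
qed

lemma exp_partial_sum_le: "finite F \<Longrightarrow> norm (\<Sum>k\<in>F. (x::complex) ^ k / fact k) \<le> exp (norm x)"
proof -
  assume F: "finite F"
  have s: "(\<lambda>k. norm x ^ k / fact k) sums exp (norm x)"
    using exp_converges[of "norm x"] by (simp add: divide_inverse mult.commute)
  have "norm (\<Sum>k\<in>F. x ^ k / fact k) \<le> (\<Sum>k\<in>F. norm x ^ k / fact k)"
    by (rule order.trans[OF norm_sum]) (simp add: norm_divide norm_power)
  also have "\<dots> \<le> exp (norm x)"
    using sum_le_suminf[OF sums_summable[OF s] F] sums_unique[OF s] by simp
  finally show ?thesis .
qed

text \<open>Expanding the kernel in powers of \<open>(s - z) ln t\<close> and integrating termwise represents the
  transform as a power series about \<open>z\<close>.\<close>

lemma mellin_holomorphic: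
  assumes [measurable]: "g \<in> borel_measurable borel"
    and int: "\<And>\<sigma>. \<sigma> > a \<Longrightarrow> set_integrable lborel {0<..} (\<lambda>t. t powr (\<sigma> - 1) * g t)"
  shows "mellin g holomorphic_on {s. Re s > a}"
proof -
  have "mellin g field_differentiable at z" if z: "Re z > a" for z
  proof -
    \<comment> \<open>Half the distance to the boundary, so that both abscissae Re z + r and Re z -
      r admit integration; exp(r |ln t|) is at most the sum of the corresponding powers of
      t.\<close>
    define r where "r = (Re z - a) / 2"
    have r: "r > 0" using z by (simp add: r_def)
    define D where "D t = (t powr (Re z + r - 1) + t powr (Re z - r - 1)) * \<bar>g t\<bar>" for t
    have "set_integrable lborel {0<..} (\<lambda>t. \<bar>t powr (Re z + r - 1) * g t\<bar> + \<bar>t powr (Re z - r - 1) * g t\<bar>)"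
      using z r by (intro set_integral_add set_integrable_abs int) (simp_all add: r_def field_simps)
    also have "(\<lambda>t. \<bar>t powr (Re z + r - 1) * g t\<bar> + \<bar>t powr (Re z - r - 1) * g t\<bar>) = D"
      by (auto simp: D_def abs_mult distrib_right)
    finally have D: "set_integrable lborel {0<..} D" .
    define f where "f w k t = (((w - z) * of_real (ln t)) ^ k / fact k) * (exp ((z - 1) * of_real (ln t)) * complex_of_real (g t))" for w k t
    have bound: "norm (\<Sum>k\<in>F. f w k t) \<le> D t" if "finite F" "t > 0" "w \<in> ball z r" for F w t
    proof -
      define x where "x = (w - z) * complex_of_real (ln t)"
      have "norm x \<le> r * \<bar>ln t\<bar>"
        unfolding x_def norm_mult using that by (intro mult_mono) (use r in \<open>auto simp: dist_norm norm_minus_commute\<close>)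
      then have "exp (norm x) \<le> exp (r * \<bar>ln t\<bar>)" by simp
      also have "\<dots> \<le> t powr r + t powr (- r)"
        using that by (cases "ln t \<ge> 0") (simp_all add: powr_def mult.commute add_increasing add_increasing2)
      finally have ex: "exp (norm x) \<le> t powr r + t powr (- r)" .
      have "(\<Sum>k\<in>F. f w k t) = (\<Sum>k\<in>F. x ^ k / fact k) * (exp ((z - 1) * of_real (ln t)) * of_real (g t))"
        by (simp add: f_def x_def sum_distrib_right)
      also have "norm \<dots> = norm (\<Sum>k\<in>F. x ^ k / fact k) * (t powr (Re z - 1) * \<bar>g t\<bar>)"
        using that by (simp add: norm_mult norm_mellin_kernel del: norm_exp_eq_Re)
      also have "\<dots> \<le> (t powr r + t powr (- r)) * (t powr (Re z - 1) * \<bar>g t\<bar>)"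
        using exp_partial_sum_le[OF that(1), of x] ex by (intro mult_right_mono) auto
      also have "\<dots> = (t powr r * t powr (Re z - 1) + t powr (- r) * t powr (Re z - 1)) * \<bar>g t\<bar>"
        by (simp add: algebra_simps)
      also have "\<dots> = D t"
        by (simp add: D_def flip: powr_add) (simp add: algebra_simps)
      finally show ?thesis .
    qed
    have fm [measurable]: "f w k \<in> borel_measurable borel" for w k unfolding f_def by measurable
    have f_int: "set_integrable lborel {0<..} (f w k)" if "w \<in> ball z r" for w k
    proof (rule set_integrable_bound[OF D])
      show "AE t in lborel. t \<in> {0<..} \<longrightarrow> norm (f w k t) \<le> norm (D t)"
        using bound[of "{k}" _ w] that by (auto intro: order.trans[OF _ abs_ge_self])
    qed (simp add: set_borel_measurable_def)
    define c where "c k = (LINT t:{0<..}|lborel. (of_real (ln t) ^ k / fact k) * (exp ((z - 1) * of_real (ln t)) * complex_of_real (g t)))" for k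
    have "(\<lambda>k. c k * (w - z) ^ k) sums mellin g w" if w: "w \<in> ball z r" for w
    proof -
      have "(\<lambda>n. LINT t|lborel. indicator {0<..} t *\<^sub>R (\<Sum>k<n. f w k t)) \<longlonglongrightarrow> 
        (LINT t|lborel. indicator {0<..} t *\<^sub>R (exp ((w - 1) * of_real (ln t)) * complex_of_real (g t)))"
      proof (rule integral_dominated_convergence)
        show "integrable lborel (\<lambda>t. indicator {0<..} t *\<^sub>R D t)"
          using D by (simp add: set_integrable_def)
        show "AE t in lborel. norm (indicator {0<..} t *\<^sub>R (\<Sum>k<n. f w k t)) \<le> indicator {0<..} t *\<^sub>R D t" for n
          using bound[of "{..<n}" _ w] w by (auto simp: indicator_def)
        show "AE t in lborel. (\<lambda>n. indicator {0<..} t *\<^sub>R (\<Sum>k<n. f w k t)) \<longlonglongrightarrow>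
          indicator {0<..} t *\<^sub>R (exp ((w - 1) * of_real (ln t)) * complex_of_real (g t))"
        proof (intro always_eventually allI tendsto_scaleR tendsto_const)
          fix t :: real
          have "(\<lambda>k. ((w - z) * of_real (ln t)) ^ k / fact k) sums exp ((w - z) * of_real (ln t))"
            using exp_converges[of "(w - z) * of_real (ln t)"] by (simp add: scaleR_conv_of_real divide_inverse mult.commute)
          then have "(\<lambda>k. f w k t) sums (exp ((w - z) * of_real (ln t)) * (exp ((z - 1) * of_real (ln t)) * complex_of_real (g t)))"
            unfolding f_def by (rule sums_mult2)
          also have "exp ((w - z) * of_real (ln t)) * (exp ((z - 1) * of_real (ln t)) * complex_of_real (g t)) =
            exp ((w - 1) * of_real (ln t)) * of_real (g t)"
            by (simp flip: mult.assoc exp_add distrib_right)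
          finally show "(\<lambda>n. \<Sum>k<n. f w k t) \<longlonglongrightarrow> exp ((w - 1) * of_real (ln t)) * of_real (g t)"
            by (simp add: sums_def)
        qed
      qed measurable
      moreover have "(LINT t|lborel. indicator {0<..} t *\<^sub>R (\<Sum>k<n. f w k t)) = (\<Sum>k<n. c k * (w - z) ^ k)" for n
      proof -
        have "(LINT t|lborel. indicator {0<..} t *\<^sub>R (\<Sum>k<n. f w k t)) = (\<Sum>k<n. LINT t|lborel. indicator {0<..} t *\<^sub>R f w k t)"
          unfolding scaleR_sum_right
          by (rule Bochner_Integration.integral_sum) (use f_int[OF w] in \<open>simp add: set_integrable_def\<close>)
        also have "\<dots> = (\<Sum>k<n. c k * (w - z) ^ k)"
        proof (rule sum.cong[OF refl])
          fix k
          have "(\<lambda>t. indicator {0<..} t *\<^sub>R f w k t) = (\<lambda>t. (indicator {0<..} t *\<^sub>R ((of_real (ln t) ^ k / fact k) * (exp ((z - 1) * of_real (ln t)) * complex_of_real (g t)))) * (w - z) ^ k)"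
            by (auto simp: f_def power_mult_distrib)
          then show "(LINT t|lborel. indicator {0<..} t *\<^sub>R f w k t) = c k * (w - z) ^ k"
            by (simp only: c_def set_lebesgue_integral_def integral_mult_left_zero)
        qed
        finally show ?thesis .
      qed
      ultimately show ?thesis by (simp add: sums_def mellin_def set_lebesgue_integral_def)
    qed
    then have "mellin g holomorphic_on ball z r" by (rule power_series_holomorphic)
    then show ?thesis
      using r by (metis centre_in_ball holomorphic_on_imp_differentiable_at open_ball)
  qed
  then show ?thesis unfolding holomorphic_on_def by (auto intro: field_differentiable_at_within)
qed

lemma mellin_add:
  assumes "g \<in> borel_measurable borel" "h \<in> borel_measurable borel"
    and "set_integrable lborel {0<..} (\<lambda>t. t powr (Re s - 1) * g t)"
    and "set_integrable lborel {0<..} (\<lambda>t. t powr (Re s - 1) * h t)"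
  shows "mellin (\<lambda>t. g t + h t) s = mellin g s + mellin h s"
  unfolding mellin_def of_real_add distrib_left
  by (rule set_integral_add(2)) (intro set_integrable_mellin assms)+

lemma set_integrable_powr_unit:
  fixes p :: real
  assumes p: "p > - 1"
  shows "set_integrable lborel {0<..} (\<lambda>t. t powr p * (if t \<le> 1 then 1 else 0))"
proof (rule set_integrable_bound)
  show "set_integrable lborel {0<..} (\<lambda>t. exp 1 * (t powr ((p + 1) - 1) * exp (- (1 * t))))"
    using p by (intro set_integrable_mult_right set_integrable_Gamma) auto
  have "x powr p \<le> exp 1 * (x powr p * exp (- x))" if "x > 0" "x \<le> 1" for x
  proof -
    have "1 \<le> exp (1 - x)" using that by simp
    then have "x powr p * 1 \<le> x powr p * exp (1 - x)" by (rule mult_left_mono) simp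
    then show ?thesis by (simp add: exp_diff exp_minus field_simps)
  qed
  then show "AE x in lborel. x \<in> {0<..} \<longrightarrow>
    norm (x powr p * (if x \<le> 1 then 1 else 0)) \<le> norm (exp 1 * (x powr ((p + 1) - 1) * exp (- (1 * x))))"
    by auto
qed (simp add: set_borel_measurable_def)

text \<open>A power cut off at 1 is what contributes a simple pole at -e. The integral is taken
  along the real axis with the antiderivative exp(w ln t) / w.\<close>

lemma mellin_powr:
  assumes q: "Re s + e > 0"
  shows "mellin (\<lambda>t. if t \<le> 1 then t powr e else 0) s = 1 / (s + of_real e)"
proof -
  define w where "w = s + of_real e"
  have w: "Re w > 0" using q by (simp add: w_def)
  then have w0: "w \<noteq> 0" by auto
  define f where "f t = exp ((w - 1) * complex_of_real (ln t))" for t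
  have f_norm: "norm (f t) = t powr (Re w - 1)" if "t > 0" for t
    unfolding f_def by (rule norm_mellin_kernel[OF that])
  have fm [measurable]: "f \<in> borel_measurable borel" unfolding f_def by measurable
  have int: "set_integrable lborel (einterval 0 1) f"
  proof -
    have "set_integrable lborel {0<..} (\<lambda>t. f t * (if t \<le> 1 then 1 else 0))"
      by (rule set_integrable_bound[OF set_integrable_powr_unit[of "Re w - 1"]])
         (use w f_norm in \<open>auto simp: set_borel_measurable_def\<close>)
    then have "set_integrable lborel {0<..<1} (\<lambda>t. f t * (if t \<le> 1 then 1 else 0))"
      by (rule set_integrable_subset) auto
    also have "?this \<longleftrightarrow> set_integrable lborel {0<..<1} f"
      by (rule set_integrable_cong) auto
    also have "{0<..<1} = einterval 0 1" by (auto simp: einterval_def)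
    finally show ?thesis .
  qed
  have "(LBINT t=0..1. f t) = 1 / w - 0"
  proof (rule interval_integral_FTC_integrable[where F = "\<lambda>t. exp (w * of_real (ln t)) / w", OF _ _ _ int])
    fix x assume "(0::ereal) < ereal x"
    then have x: "x > 0" by simp
    have "((\<lambda>t. exp (w * of_real (ln t)) / w) has_vector_derivative (exp (w * of_real (ln x)) * (w * of_real (1 / x)) / w)) (at x)"
    proof -
      have "((\<lambda>z. exp (w * z) / w) has_field_derivative (exp (w * of_real (ln x)) * w / w)) (at (complex_of_real (ln x)))"
        by (auto intro!: derivative_eq_intros)
      moreover have "((\<lambda>t. complex_of_real (ln t)) has_vector_derivative of_real (1 / x)) (at x)"
        using x by (auto intro!: derivative_eq_intros has_vector_derivative_of_real simp flip: has_real_derivative_iff_has_vector_derivative)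
      ultimately have "((\<lambda>z. exp (w * z) / w) \<circ> (\<lambda>t. complex_of_real (ln t)) has_vector_derivative
          (of_real (1 / x) * (exp (w * of_real (ln x)) * w / w))) (at x)"
        by (rule field_vector_diff_chain_at[rotated])
      then show ?thesis using w0 by (simp add: o_def mult_ac)
    qed
    also have "exp (w * of_real (ln x)) * (w * of_real (1 / x)) / w = f x"
    proof -
      have "exp (complex_of_real (ln x)) = of_real x" using x by (simp add: exp_of_real)
      then show ?thesis using w0 x by (simp add: f_def left_diff_distrib exp_diff)
    qed
    finally show "((\<lambda>t. exp (w * of_real (ln t)) / w) has_vector_derivative f x) (at x)" .
    show "isCont f x" unfolding f_def using x by (intro continuous_intros) auto
  next
    have "((\<lambda>t. exp (w * of_real (ln t)) / w) \<longlongrightarrow> 0) (at_right 0)"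
    proof (rule tendsto_norm_zero_cancel)
      have "((\<lambda>t::real. t powr Re w / norm w) \<longlongrightarrow> 0 / norm w) (at_right 0)"
        using w by (intro tendsto_divide tendsto_powr_at_right_0 tendsto_const) (use w0 in auto)
      then have "((\<lambda>t::real. t powr Re w / norm w) \<longlongrightarrow> 0) (at_right 0)" by simp
      then show "((\<lambda>t. norm (exp (w * of_real (ln t)) / w)) \<longlongrightarrow> 0) (at_right 0)"
      proof (rule Lim_transform_eventually)
        show "\<forall>\<^sub>F t in at_right 0. t powr Re w / norm w = norm (exp (w * of_real (ln t)) / w)"
          using eventually_at_right_less[of 0] by eventually_elim (simp add: norm_divide powr_def mult.commute)
      qed
    qed
    then show "(((\<lambda>t. exp (w * of_real (ln t)) / w) \<circ> real_of_ereal) \<longlongrightarrow> 0) (at_right 0)"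
      by (simp add: zero_ereal_def ereal_tendsto_simps)
    have "isCont (\<lambda>t. exp (w * of_real (ln t)) / w) (1::real)"
      using w0 by (intro continuous_intros) auto
    then have "((\<lambda>t. exp (w * of_real (ln t)) / w) \<longlongrightarrow> exp (w * of_real (ln 1)) / w) (at_left (1::real))"
      unfolding isCont_def by (rule tendsto_within_subset) simp
    then show "(((\<lambda>t. exp (w * of_real (ln t)) / w) \<circ> real_of_ereal) \<longlongrightarrow> 1 / w) (at_left 1)"
      by (simp add: one_ereal_def ereal_tendsto_simps)
  qed auto
  also have "(LBINT t=0..1. f t) = (LINT t:{0<..<1}|lborel. f t)"
    by (simp add: interval_lebesgue_integral_def einterval_def zero_ereal_def one_ereal_def greaterThanLessThan_def greaterThan_def lessThan_def Int_def)
  also have "\<dots> = mellin (\<lambda>t. if t \<le> 1 then t powr e else 0) s"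
    unfolding mellin_def set_lebesgue_integral_def
  proof (rule integral_cong_AE)
    show "AE t in lborel. indicator {0<..<1} t *\<^sub>R f t =
      indicator {0<..} t *\<^sub>R (exp ((s - 1) * of_real (ln t)) * complex_of_real (if t \<le> 1 then t powr e else 0))"
      using AE_lborel_singleton[of 1]
    proof eventually_elim
      case (elim t)
      have "complex_of_real (t powr e) = exp (of_real e * of_real (ln t))" if "t > 0"
        using that by (simp add: powr_def flip: exp_of_real)
      then show ?case using elim
        by (auto simp: indicator_def f_def w_def algebra_simps simp flip: exp_add)
    qed
  qed measurable
  finally show ?thesis by (simp add: w_def)
qed

lemma mellin_exp:
  assumes "Re s > 0" "l > 0"
  shows "mellin (\<lambda>t. exp (- (l * t))) s = Gamma s * of_real l powr (- s)"
    "set_integrable lborel {0<..} (\<lambda>t. t powr (Re s - 1) * exp (- (l * t)))"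
proof -
  have "mellin (\<lambda>t. exp (- (l * t))) s = (LINT t:{0<..}|lborel. complex_of_real t powr (s - 1) * of_real (exp (- (l * t))))"
    unfolding mellin_def by (rule set_lebesgue_integral_cong) (auto simp: powr_def Ln_of_real)
  then show "mellin (\<lambda>t. exp (- (l * t))) s = Gamma s * of_real l powr (- s)"
    using assms by (simp add: set_integral_Gamma)
qed (rule set_integrable_Gamma[OF assms])

text \<open>The difference vanishes on a half-plane, hence everywhere up to removable singularities.
  The normalisation of values then turns agreement near each point into agreement at the
  point.\<close>

lemma nicely_meromorphic_eqI:
  assumes f: "f nicely_meromorphic_on UNIV" and g: "g nicely_meromorphic_on UNIV"
    and eq: "\<And>s. Re s > c \<Longrightarrow> f s = g s"
  shows "f = g"
proof
  fix z
  define d where "d = remove_sings (\<lambda>s. f s - g s)"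
  have m: "(\<lambda>s. f s - g s) meromorphic_on UNIV"
    using f g by (intro meromorphic_intros) (auto simp: nicely_meromorphic_on_def)
  have iso: "isolated_singularity_at (\<lambda>s. f s - g s) w" for w
    using m by (rule meromorphic_on_isolated_singularity[OF meromorphic_on_subset]) auto
  define w where "w = complex_of_real (c + 1)"
  have "\<forall>\<^sub>F s in at w. Re s > c"
    by (rule eventually_at_in_open'[of "{s. Re s > c}", simplified]) (auto simp: w_def open_halfspace_Re_gt)
  then have "\<forall>\<^sub>F s in at w. d s = 0"
    using eventually_remove_sings_eq_at[OF iso[of w]] by eventually_elim (simp add: d_def eq)
  then have "\<exists>\<^sub>F s in at w. d s = 0" by (rule eventually_frequently[rotated]) auto
  then have d0: "d s = 0" for s
    by (rule frequently_eq_meromorphic_imp_constant[of _ _ _ UNIV])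
       (auto simp: d_def intro: remove_sings_nicely_meromorphic m)
  have ev: "\<forall>\<^sub>F s in at z. f s = g s"
    using eventually_remove_sings_eq_at[OF iso[of z]] d0 by (simp add: d_def)
  show "f z = g z"
  proof (cases "is_pole f z")
    case True
    then have "is_pole g z" using is_pole_cong[OF ev refl] by simp
    \<comment> \<open>At a pole a function has no finite limit, so a nicely meromorphic one must
      take the value 0 there.\<close>
    then have "\<not> g \<midarrow>z\<rightarrow> g z" "\<not> f \<midarrow>z\<rightarrow> f z"
      using True unfolding is_pole_def by (auto dest: not_tendsto_and_filterlim_at_infinity[OF at_neq_bot])
    then show ?thesis using f g unfolding nicely_meromorphic_on_def by (metis UNIV_I)
  next
    case False
    then have "\<not> is_pole g z" using is_pole_cong[OF ev refl] by simp
    with False have lims: "f \<midarrow>z\<rightarrow> f z" "g \<midarrow>z\<rightarrow> g z" using f g unfolding nicely_meromorphic_on_def by auto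
    from Lim_transform_eventually[OF lims(1) ev] lims(2) show ?thesis
      by (metis LIM_unique)
  qed
qed

lemma powr_unit_integrable:
  fixes \<sigma> e b :: real
  assumes "\<sigma> + e > 0"
  shows "set_integrable lborel {0<..} (\<lambda>t. t powr (\<sigma> - 1) * (b * (if t \<le> 1 then t powr e else 0)))"
proof -
  have "set_integrable lborel {0<..} (\<lambda>t. b * (t powr (\<sigma> + e - 1) * (if t \<le> 1 then 1 else 0)))"
    by (rule set_integrable_mult_right, rule set_integrable_powr_unit) (use assms in auto)
  also have "?this \<longleftrightarrow> ?thesis"
    by (intro set_integrable_cong) (auto simp: algebra_simps simp flip: powr_add)
  finally show ?thesis .
qed

lemma mellin_cmult: "mellin (\<lambda>t. b * g t) s = of_real b * mellin g s"
proof -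
  have "mellin (\<lambda>t. b * g t) s = (LINT t:{0<..}|lborel. of_real b * (exp ((s - 1) * of_real (ln t)) * complex_of_real (g t)))"
    unfolding mellin_def by (simp add: mult_ac)
  then show ?thesis unfolding mellin_def by simp
qed

section \<open>Continuation of the Dirichlet series by subtracting the expansion\<close>

locale expansion_seq = part_seq_summable +
  fixes i :: "nat \<Rightarrow> real" and A :: "real \<Rightarrow> real"
  assumes expn: "asymp_expansion_at_0 (Theta \<Lambda>) i A"
begin

lemma i_mono: "strict_mono i" and i_lim: "filterlim i at_top sequentially"
  using expn by (auto simp: asymp_expansion_at_0_def)

text \<open>The expansion is removed on (0, 1] only. There the remainder is of the order of the last
  exponent, while beyond 1 the exponential decay of \<open>\<theta>\<close> is kept.\<close>

definition G :: "nat \<Rightarrow> real \<Rightarrow> real" where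
  "G N t = \<theta> t - (if t \<le> 1 then \<Sum>n\<le>N. A (i n) * t powr i n else 0)"

lemma G_measurable [measurable]: "G N \<in> borel_measurable borel"
  unfolding G_def by measurable

text \<open>Three ranges: the remainder estimate near 0, continuity on the compact part up to 1, and
  \<open>Theta_decay\<close> beyond.\<close>

lemma G_bound: "\<exists>C>0. \<forall>t>0. \<bar>G N t\<bar> \<le> C * t powr i N * exp (- (t / 2))"
proof -
  have "\<forall>\<^sub>F t in at_right 0. norm (\<theta> t - (\<Sum>n\<le>N. A (i n) * t powr i n)) \<le> 1 * norm (t powr i N)"
    using expn unfolding asymp_expansion_at_0_def by (intro landau_o.smallD) auto
  then obtain d0 where d0: "d0 > 0"
    "\<And>t. 0 < t \<Longrightarrow> t < d0 \<Longrightarrow> \<bar>\<theta> t - (\<Sum>n\<le>N. A (i n) * t powr i n)\<bar> \<le> t powr i N"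
    unfolding eventually_at_right_field by auto
  define d where "d = min (d0 / 2) 1"
  have d: "d > 0" "d < d0" "d \<le> 1" using d0 by (auto simp: d_def)
  define q where "q t = \<bar>\<theta> t - (\<Sum>n\<le>N. A (i n) * t powr i n)\<bar> * t powr (- i N)" for t
  have "continuous_on {d..1} q"
    unfolding q_def using d
    by (intro continuous_intros continuous_at_imp_continuous_on) (auto intro!: isCont_Theta)
  then have "bounded (q ` {d..1})" by (intro compact_imp_bounded compact_continuous_image) auto
  then obtain B where B: "B > 0" "\<And>t. d \<le> t \<Longrightarrow> t \<le> 1 \<Longrightarrow> q t \<le> B"
    unfolding bounded_pos by force
  obtain K where K: "K > 0" "\<And>u. u > 0 \<Longrightarrow> u powr \<bar>i N\<bar> * exp (- (1 / 2 * u)) \<le> K"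
    by (rule powr_exp_bounded[of "\<bar>i N\<bar>" "1 / 2"]) simp_all
  define C where "C = (B + 1) * exp (1 / 2) + exp 1 * \<theta> 1 * K"
  have th1: "\<theta> 1 > 0" by (rule Theta_pos) simp
  have C: "C > 0" unfolding C_def using B K th1 by (intro add_pos_pos mult_pos_pos) simp_all
  have "\<bar>G N t\<bar> \<le> C * t powr i N * exp (- (t / 2))" if t: "t > 0" for t
  proof (cases "t \<le> 1")
    case True
    have "\<bar>G N t\<bar> \<le> (B + 1) * t powr i N"
    proof (cases "t < d")
      case True
      have "\<bar>G N t\<bar> \<le> 1 * t powr i N" using d0(2)[of t] t True d by (simp add: G_def)
      also have "\<dots> \<le> (B + 1) * t powr i N" using B by (intro mult_right_mono) auto
      finally show ?thesis .
    next
      case False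
      then have "q t \<le> B" using B True by auto
      then have "\<bar>G N t\<bar> \<le> B * t powr i N"
        using t True by (simp add: q_def G_def powr_minus field_simps)
      also have "\<dots> \<le> (B + 1) * t powr i N" by (intro mult_right_mono) auto
      finally show ?thesis .
    qed
    also have "\<dots> \<le> (B + 1) * t powr i N * (exp (1 / 2) * exp (- (t / 2)))"
    proof -
      have "1 \<le> exp (1 / 2) * exp (- (t / 2))" using True by (simp flip: exp_add)
      then show ?thesis using mult_left_mono[of 1 _ "(B + 1) * t powr i N"] B by simp
    qed
    also have "\<dots> = (B + 1) * exp (1 / 2) * t powr i N * exp (- (t / 2))" by simp
    also have "\<dots> \<le> C * t powr i N * exp (- (t / 2))"
      unfolding C_def using K th1 by (intro mult_right_mono) auto
    finally show ?thesis .
  next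
    case False
    then have "\<bar>G N t\<bar> = \<theta> t" using Theta_pos[OF t] by (simp add: G_def)
    also have "\<dots> \<le> exp (- (t - 1)) * \<theta> 1" using False by (intro Theta_decay) auto
    also have "exp (- (t - 1)) = exp 1 * exp (- (1 / 2 * t)) * exp (- (t / 2))" by (simp flip: exp_add)
    also have "exp (- (1 / 2 * t)) \<le> K * t powr (- \<bar>i N\<bar>)"
      using K(2)[OF t] t by (simp add: powr_minus field_simps)
    also have "K * t powr (- \<bar>i N\<bar>) \<le> K * t powr i N"
      using K False by (intro mult_left_mono powr_mono) auto
    also have "exp 1 * (K * t powr i N) * exp (- (t / 2)) * \<theta> 1 = exp 1 * \<theta> 1 * K * t powr i N * exp (- (t / 2))" by simp
    also have "\<dots> \<le> C * t powr i N * exp (- (t / 2))"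
      unfolding C_def using B by (intro mult_right_mono) auto
    finally show ?thesis using th1 by simp
  qed
  with C show ?thesis by blast
qed

lemma G_integrable:
  assumes "\<sigma> > - i N"
  shows "set_integrable lborel {0<..} (\<lambda>t. t powr (\<sigma> - 1) * G N t)"
proof -
  obtain C where C: "C > 0" "\<And>t. t > 0 \<Longrightarrow> \<bar>G N t\<bar> \<le> C * t powr i N * exp (- (t / 2))"
    using G_bound by blast
  show ?thesis
  proof (rule set_integrable_bound)
    show "set_integrable lborel {0<..} (\<lambda>t. C * (t powr ((\<sigma> + i N) - 1) * exp (- (1 / 2 * t))))"
      using assms by (intro set_integrable_mult_right set_integrable_Gamma) auto
    have "norm (t powr (\<sigma> - 1) * G N t) \<le> norm (C * (t powr ((\<sigma> + i N) - 1) * exp (- (1 / 2 * t))))" if t: "t > 0" for t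
    proof -
      have "norm (t powr (\<sigma> - 1) * G N t) \<le> t powr (\<sigma> - 1) * (C * t powr i N * exp (- (t / 2)))"
        unfolding real_norm_def abs_mult using C(2)[OF t] by (intro mult_mono) auto
      also have "\<dots> = C * ((t powr (\<sigma> - 1) * t powr i N) * exp (- (1 / 2 * t)))" by simp
      also have "t powr (\<sigma> - 1) * t powr i N = t powr ((\<sigma> + i N) - 1)"
        by (simp flip: powr_add) (simp add: algebra_simps)
      finally show ?thesis using C by (simp add: abs_mult)
    qed
    then show "AE t in lborel. t \<in> {0<..} \<longrightarrow> norm (t powr (\<sigma> - 1) * G N t) \<le> norm (C * (t powr ((\<sigma> + i N) - 1) * exp (- (1 / 2 * t))))"
      by auto
  qed (simp add: set_borel_measurable_def)
qed

text \<open>The N-th approximation to Gamma times the Dirichlet series: a transform holomorphic for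
  Re s > -\<open>i N\<close>, plus the explicit transforms of the removed powers.\<close>

definition F :: "nat \<Rightarrow> complex \<Rightarrow> complex" where
  "F N s = mellin (G N) s + (\<Sum>n\<le>N. of_real (A (i n)) / (s + of_real (i n)))"

text \<open>One more cut-off power moves from the transform into the explicit sum, where it
  reappears as its own transform.\<close>

lemma F_Suc:
  assumes s: "Re s > - i N"
  shows "F (Suc N) s = F N s"
proof -
  have lt: "i N < i (Suc N)" using i_mono by (simp add: strict_mono_def)
  define h where "h t = A (i (Suc N)) * (if t \<le> 1 then t powr i (Suc N) else 0)" for t
  have "mellin (\<lambda>t. G (Suc N) t + h t) s = mellin (G (Suc N)) s + mellin h s"
  proof (rule mellin_add)
    show "set_integrable lborel {0<..} (\<lambda>t. t powr (Re s - 1) * h t)"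
      unfolding h_def using s lt by (intro powr_unit_integrable) auto
  qed (use s lt in \<open>auto simp: h_def intro!: G_integrable\<close>)
  also have "(\<lambda>t. G (Suc N) t + h t) = G N" by (auto simp: G_def h_def)
  also have "mellin h s = of_real (A (i (Suc N))) / (s + of_real (i (Suc N)))"
    unfolding h_def mellin_cmult using s lt by (simp add: mellin_powr)
  finally show ?thesis by (simp add: F_def)
qed

lemma Theta_integrable:
  assumes "\<sigma> > - i 0"
  shows "set_integrable lborel {0<..} (\<lambda>t. t powr (\<sigma> - 1) * \<theta> t)"
proof -
  have "set_integrable lborel {0<..} (\<lambda>t. t powr (\<sigma> - 1) * G 0 t + t powr (\<sigma> - 1) * (A (i 0) * (if t \<le> 1 then t powr i 0 else 0)))"
    using assms by (intro set_integral_add G_integrable powr_unit_integrable) auto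
  also have "?this \<longleftrightarrow> ?thesis"
    by (intro set_integrable_cong) (auto simp: G_def algebra_simps)
  finally show ?thesis .
qed

lemma F_0:
  assumes s: "Re s > - i 0"
  shows "F 0 s = mellin \<theta> s"
proof -
  define h where "h t = A (i 0) * (if t \<le> 1 then t powr i 0 else 0)" for t
  have "mellin (\<lambda>t. G 0 t + h t) s = mellin (G 0) s + mellin h s"
  proof (rule mellin_add)
    show "set_integrable lborel {0<..} (\<lambda>t. t powr (Re s - 1) * h t)"
      unfolding h_def using s by (intro powr_unit_integrable) auto
  qed (use s in \<open>auto simp: h_def intro!: G_integrable\<close>)
  also have "(\<lambda>t. G 0 t + h t) = \<theta>" by (auto simp: G_def h_def)
  also have "mellin h s = of_real (A (i 0)) / (s + of_real (i 0))"
    unfolding h_def mellin_cmult using s by (simp add: mellin_powr)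
  finally show ?thesis by (simp add: F_def)
qed

lemma F_eq: "N \<le> M \<Longrightarrow> Re s > - i N \<Longrightarrow> F M s = F N s"
proof (induction M rule: dec_induct)
  case (step M)
  have "i N \<le> i M" using i_mono step by (simp add: strict_mono_less_eq)
  then show ?case using step F_Suc[of M s] by simp
qed simp

text \<open>By \<open>F_eq\<close> all sufficiently large N give the same value at s; the least one
  is just a choice.\<close>

definition cutoff :: "complex \<Rightarrow> nat" where
  "cutoff s = (LEAST N. Re s > - i N)"

lemma ex_cutoff: "\<exists>N. Re s > - i N"
proof -
  have "\<forall>\<^sub>F N in sequentially. i N > - Re s" using i_lim by (simp add: filterlim_at_top_dense)
  then show ?thesis by (auto simp: eventually_sequentially minus_less_iff)
qed

lemma F_cutoff: "Re s > - i N \<Longrightarrow> F (cutoff s) s = F N s"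
  unfolding cutoff_def by (rule F_eq[symmetric]) (auto intro: Least_le LeastI)

text \<open>At a pole \<open>-i n\<close> the formula for \<open>F\<close> has the junk value \<open>A / 0 = 0\<close>, which \<^const>\<open>remove_sings\<close>
  disposes of.\<close>

definition zeta_cont :: "complex \<Rightarrow> complex" where
  "zeta_cont = remove_sings (\<lambda>s. rGamma s * F (cutoff s) s)"

lemma zeta_cont_nice: "zeta_cont nicely_meromorphic_on UNIV"
  unfolding zeta_cont_def
proof (intro remove_sings_nicely_meromorphic meromorphic_intros)
  show "rGamma meromorphic_on UNIV"
    by (intro analytic_on_imp_meromorphic_on) (simp add: analytic_on_open holomorphic_rGamma)
  show "(\<lambda>s. F (cutoff s) s) meromorphic_on UNIV"
  proof (subst meromorphic_on_meromorphic_at, rule ballI)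
    fix z :: complex
    obtain N where N: "Re z > - i N" using ex_cutoff by blast
    have op: "open {s. Re s > - i N}" by (rule open_halfspace_Re_gt)
    have "mellin (G N) holomorphic_on {s. Re s > - i N}"
      by (intro mellin_holomorphic G_integrable) auto
    then have "mellin (G N) meromorphic_on {z}"
      using N op by (intro analytic_on_imp_meromorphic_on) (auto simp: analytic_at)
    moreover have "(\<lambda>s. \<Sum>n\<le>N. of_real (A (i n)) / (s + of_real (i n))) meromorphic_on {z}"
      by (intro meromorphic_intros)
    ultimately have "F N meromorphic_on {z}"
      unfolding F_def[abs_def] by (rule meromorphic_on_add)
    moreover have "\<forall>\<^sub>F s in at z. F (cutoff s) s = F N s"
      using eventually_at_in_open'[OF op, of z] N by (auto elim!: eventually_mono simp: F_cutoff)
    ultimately show "(\<lambda>s. F (cutoff s) s) meromorphic_on {z}"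
      by (subst meromorphic_on_cong) auto
  qed
qed

end

locale pole_seq = expansion_seq +
  assumes i_0: "i 0 < 0"
begin

lemma mellin_Theta_holomorphic: "mellin \<theta> holomorphic_on {s. Re s > - i 0}"
  by (intro mellin_holomorphic Theta_integrable) auto

lemma zeta_cont_eq:
  assumes s: "Re s > - i 0"
  shows "zeta_cont s = rGamma s * mellin \<theta> s"
proof -
  have op: "open {s. Re s > - i 0}" by (rule open_halfspace_Re_gt)
  have eq: "F (cutoff w) w = mellin \<theta> w" if "w \<in> {s. Re s > - i 0}" for w
    using that F_cutoff F_0 by simp
  have "(\<lambda>s. rGamma s * mellin \<theta> s) holomorphic_on {s. Re s > - i 0}"
    by (intro holomorphic_intros holomorphic_on_mult mellin_Theta_holomorphic holomorphic_rGamma)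
  then have "(\<lambda>s. rGamma s * F (cutoff s) s) holomorphic_on {s. Re s > - i 0}"
    by (rule holomorphic_transform) (simp add: eq)
  \<comment> \<open>At a point of analyticity \<open>remove_sings\<close> leaves the value
    unchanged.\<close>
  then have "(\<lambda>s. rGamma s * F (cutoff s) s) analytic_on {s}"
    using s op by (auto simp: analytic_at)
  then show ?thesis unfolding zeta_cont_def using s eq by simp
qed

text \<open>The transform is taken term by term, each exponential giving Gamma(s) times a power of
  \<open>\<Lambda> j\<close>. The partial sums of exponentials are dominated by
  \<open>\<theta>\<close>, so the limit passes through the integral.\<close>

lemma zeta_cont_sums:
  assumes s: "Re s > - i 0"
  shows "(\<lambda>j. of_nat (\<Lambda> j) powr (- s)) sums zeta_cont s"
proof -
  have s0: "Re s > 0" using s i_0 by simp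
  have e: "mellin (\<lambda>t. exp (- real (\<Lambda> j) * t)) s = Gamma s * of_nat (\<Lambda> j) powr (- s)"
    "set_integrable lborel {0<..} (\<lambda>t. t powr (Re s - 1) * exp (- real (\<Lambda> j) * t))" for j
    using mellin_exp[OF s0, of "real (\<Lambda> j)"] pos[of j] by simp_all
  have eint: "integrable lborel (\<lambda>t. indicator {0<..} t *\<^sub>R (exp ((s - 1) * of_real (ln t)) * complex_of_real (exp (- real (\<Lambda> j) * t))))" for j
    using set_integrable_mellin[of "\<lambda>t. exp (- real (\<Lambda> j) * t)" s] e(2) by (simp add: set_integrable_def)
  have "(\<lambda>n. LINT t|lborel. (\<Sum>j<n. indicator {0<..} t *\<^sub>R (exp ((s - 1) * of_real (ln t)) * complex_of_real (exp (- real (\<Lambda> j) * t))))) \<longlonglongrightarrow>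
     (LINT t|lborel. indicator {0<..} t *\<^sub>R (exp ((s - 1) * of_real (ln t)) * complex_of_real (\<theta> t)))"
  proof (rule integral_dominated_convergence)
    show "integrable lborel (\<lambda>t. indicator {0<..} t *\<^sub>R (t powr (Re s - 1) * \<theta> t))"
      using Theta_integrable[OF s] by (simp add: set_integrable_def)
    have part: "(\<Sum>j<n. indicator {0<..} t *\<^sub>R (exp ((s - 1) * of_real (ln t)) * complex_of_real (exp (- real (\<Lambda> j) * t)))) =
      indicator {0<..} t *\<^sub>R (exp ((s - 1) * of_real (ln t)) * complex_of_real (\<Sum>j<n. exp (- real (\<Lambda> j) * t)))" for n t
      by (simp add: scaleR_sum_right sum_distrib_left)
    show "AE t in lborel. (\<lambda>n. \<Sum>j<n. indicator {0<..} t *\<^sub>R (exp ((s - 1) * of_real (ln t)) * complex_of_real (exp (- real (\<Lambda> j) * t)))) \<longlonglongrightarrow>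
      indicator {0<..} t *\<^sub>R (exp ((s - 1) * of_real (ln t)) * complex_of_real (\<theta> t))"
    proof (rule always_eventually, rule allI)
      fix t :: real
      show "(\<lambda>n. \<Sum>j<n. indicator {0<..} t *\<^sub>R (exp ((s - 1) * of_real (ln t)) * complex_of_real (exp (- real (\<Lambda> j) * t)))) \<longlonglongrightarrow>
        indicator {0<..} t *\<^sub>R (exp ((s - 1) * of_real (ln t)) * complex_of_real (\<theta> t))"
      proof (cases "t > 0")
        case True
        show ?thesis unfolding part
          by (intro tendsto_intros Theta_sums[OF True, unfolded sums_def])
      qed simp
    qed
    show "AE t in lborel. norm (\<Sum>j<n. indicator {0<..} t *\<^sub>R (exp ((s - 1) * of_real (ln t)) * complex_of_real (exp (- real (\<Lambda> j) * t)))) \<le>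
      indicator {0<..} t *\<^sub>R (t powr (Re s - 1) * \<theta> t)" for n
    proof (rule always_eventually, rule allI)
      fix t :: real
      show "norm (\<Sum>j<n. indicator {0<..} t *\<^sub>R (exp ((s - 1) * of_real (ln t)) * complex_of_real (exp (- real (\<Lambda> j) * t)))) \<le>
        indicator {0<..} t *\<^sub>R (t powr (Re s - 1) * \<theta> t)"
      proof (cases "t > 0")
        case True
        have "0 \<le> (\<Sum>j<n. exp (- real (\<Lambda> j) * t))" by (intro sum_nonneg) auto
        moreover have "(\<Sum>j<n. exp (- real (\<Lambda> j) * t)) \<le> \<theta> t"
          unfolding Theta_def by (intro sum_le_suminf summ True) auto
        ultimately show ?thesis unfolding part norm_scaleR norm_mult norm_mellin_kernel[OF True] norm_of_real
          using True by (auto intro!: mult_left_mono)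
      qed simp
    qed
  qed measurable
  then have "(\<lambda>j. mellin (\<lambda>t. exp (- real (\<Lambda> j) * t)) s) sums mellin \<theta> s"
    unfolding sums_def mellin_def set_lebesgue_integral_def
    by (subst (asm) Bochner_Integration.integral_sum[OF eint])
  then have "(\<lambda>j. rGamma s * (Gamma s * of_nat (\<Lambda> j) powr (- s))) sums (rGamma s * mellin \<theta> s)"
    unfolding e by (rule sums_mult)
  moreover have "rGamma s * (Gamma s * x) = x" for x
  proof -
    have "s \<notin> \<int>\<^sub>\<le>\<^sub>0" using s0 by (auto elim!: nonpos_Ints_cases')
    then show ?thesis by (simp add: rGamma_inverse_Gamma Gamma_eq_zero_iff)
  qed
  ultimately show ?thesis using zeta_cont_eq[OF s] by simp
qed

theorem zeta_eq: "zeta \<Lambda> = zeta_cont"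
  unfolding zeta_def
proof (rule the_equality)
  show "zeta_cont nicely_meromorphic_on UNIV \<and> (\<exists>c. \<forall>s. Re s > c \<longrightarrow> (\<lambda>j. of_nat (\<Lambda> j) powr (- s)) sums zeta_cont s)"
    using zeta_cont_nice zeta_cont_sums by blast
next
  fix f assume f: "f nicely_meromorphic_on UNIV \<and> (\<exists>c. \<forall>s. Re s > c \<longrightarrow> (\<lambda>j. of_nat (\<Lambda> j) powr (- s)) sums f s)"
  then obtain c where c: "\<And>s. Re s > c \<Longrightarrow> (\<lambda>j. of_nat (\<Lambda> j) powr (- s)) sums f s" by blast
  show "f = zeta_cont"
  \<comment> \<open>The competitor may be tied to the series on some other half-plane; the smaller
    of the two half-planes is common.\<close>
  proof (rule nicely_meromorphic_eqI[where c = "max c (- i 0)"])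
    show "f s = zeta_cont s" if "Re s > max c (- i 0)" for s
      using sums_unique2[OF c zeta_cont_sums] that by simp
  qed (use f zeta_cont_nice in auto)
qed

lemma zeta_sums: "Re s > - i 0 \<Longrightarrow> (\<lambda>j. of_nat (\<Lambda> j) powr (- s)) sums zeta \<Lambda> s"
  unfolding zeta_eq by (rule zeta_cont_sums)

lemma zeta_mellin: "Re s > - i 0 \<Longrightarrow> zeta \<Lambda> s = rGamma s * mellin \<theta> s"
  unfolding zeta_eq by (rule zeta_cont_eq)

end

lemma mellin_of_real:
  "mellin g (of_real s) = of_real (LINT t:{0<..}|lborel. t powr (s - 1) * g t)"
proof -
  have "mellin g (of_real s) = (LINT t:{0<..}|lborel. complex_of_real (t powr (s - 1) * g t))"
    unfolding mellin_def by (rule set_lebesgue_integral_cong) (auto simp: powr_def simp flip: exp_of_real)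
  also have "\<dots> = of_real (LINT t:{0<..}|lborel. t powr (s - 1) * g t)"
  proof -
    have "(\<lambda>t. indicator {0<..} t *\<^sub>R complex_of_real (t powr (s - 1) * g t)) =
      (\<lambda>t. complex_of_real (indicator {0<..} t *\<^sub>R (t powr (s - 1) * g t)))"
      by (auto simp: indicator_def)
    then show ?thesis unfolding set_lebesgue_integral_def by (simp only: integral_complex_of_real)
  qed
  finally show ?thesis .
qed

text \<open>After subtraction of the Taylor polynomial all coefficients up to N vanish, so division
  by the N-th power leaves a convergent series whose constant term is 0.\<close>

lemma has_fps_expansion_remainder:
  fixes f :: "real \<Rightarrow> real"
  assumes f: "f has_fps_expansion F"
  shows "((\<lambda>x. (f x - (\<Sum>n\<le>N. fps_nth F n * x ^ n)) / x ^ N) \<longlongrightarrow> 0) (at 0)"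
proof -
  define h where "h x = f x - (\<Sum>n\<le>N. fps_nth F n * x ^ n)" for x
  define H where "H = F - (\<Sum>n\<le>N. fps_const (fps_nth F n) * fps_X ^ n)"
  have h: "h has_fps_expansion H" unfolding h_def[abs_def] H_def
    by (intro fps_expansion_intros f)
  have H_nth: "fps_nth H n = 0" if "n \<le> N" for n
  proof -
    have "fps_nth H n = fps_nth F n - (\<Sum>k\<le>N. if k = n then fps_nth F k else 0)"
      unfolding H_def fps_sub_nth fps_sum_nth by (rule arg_cong2[where f = "(-)"], simp, rule sum.cong) auto
    then show ?thesis using that by simp
  qed
  show ?thesis
  proof (cases "H = 0")
    case True
    with h have "\<forall>\<^sub>F x in nhds 0. 0 = h x" by (simp add: has_fps_expansion_def)
    then have "\<forall>\<^sub>F x in at 0. 0 = h x / x ^ N"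
      by (auto simp: eventually_at_filter elim!: eventually_mono)
    then show ?thesis unfolding h_def[symmetric] by (rule Lim_transform_eventually[OF tendsto_const])
  next
    case False
    then have "N \<le> subdegree H" by (metis H_nth linorder_linear nth_subdegree_nonzero)
    from has_fps_expansion_shift[OF h this refl]
    have "(\<lambda>x. if x = 0 then 0 else h x / x ^ N) has_fps_expansion fps_shift N H"
      unfolding H_nth[OF order_refl] .
    from has_fps_expansion_imp_continuous[OF this, of UNIV]
    have "((\<lambda>x. if x = 0 then 0 else h x / x ^ N) \<longlongrightarrow> 0) (at 0)"
      by (simp add: isCont_def)
    then show ?thesis unfolding h_def[symmetric]
      by (rule Lim_transform_eventually) (simp add: eventually_at_filter)
  qed
qed

section \<open>The Riemann zeta function as an instance\<close>

interpretation riemann: part_seq_summable Suc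
proof
  fix t :: real assume t: "t > 0"
  have "summable (\<lambda>j. exp (- t) * exp (- t) ^ j)" using t by (intro summable_mult summable_geometric) auto
  then show "summable (\<lambda>j. exp (- real (Suc j) * t))"
    by (simp add: algebra_simps flip: exp_of_nat_mult exp_add)
next
  show "finite {j. Suc j = m}" for m
    by (rule finite_subset[of _ "{..m}"]) auto
qed simp

lemma Theta_Suc: "t > 0 \<Longrightarrow> Theta Suc t = 1 / (exp t - 1)"
proof -
  assume t: "t > 0"
  have "(\<lambda>j. exp (- t) * exp (- t) ^ j) sums (exp (- t) * (1 / (1 - exp (- t))))"
    using t by (intro sums_mult geometric_sums) auto
  moreover have "exp (- t) * exp (- t) ^ j = exp (- real (Suc j) * t)" for j
    by (simp add: algebra_simps flip: exp_of_nat_mult exp_add)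
  ultimately have "Theta Suc t = exp (- t) * (1 / (1 - exp (- t)))"
    using sums_unique2[OF riemann.Theta_sums[OF t]] by simp
  also have "\<dots> = 1 / (exp t - 1)" using t by (simp add: exp_minus field_simps)
  finally show ?thesis .
qed

text \<open>\<open>\<Theta>(t) = 1 / (e\<^sup>t - 1)\<close> for the sequence \<open>1, 2, 3, \<dots>\<close>, so its expansion is the Taylor series of
  \<open>t / (e\<^sup>t - 1)\<close> divided by \<open>t\<close>.\<close>

definition bern :: "real fps" where "bern = fps_X / (fps_exp 1 - 1)"

text \<open>The exponents are shifted by the division by t; the floor recovers the index n from the
  exponent n - 1.\<close>

interpretation riemann: pole_seq Suc "\<lambda>n. real n - 1" "\<lambda>x. fps_nth bern (nat \<lfloor>x + 1\<rfloor>)"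
proof
  let ?i = "\<lambda>n. real n - 1" and ?A = "\<lambda>x. fps_nth bern (nat \<lfloor>x + 1\<rfloor>)"
  have "strict_mono ?i" by (simp add: strict_mono_def)
  moreover have "filterlim ?i at_top sequentially" by real_asymp
  moreover have "(\<lambda>t. Theta Suc t - (\<Sum>n\<le>N. ?A (?i n) * t powr ?i n)) \<in> o[at_right 0](\<lambda>t. t powr ?i N)" for N
  proof (rule smalloI_tendsto)
    have nth1: "fps_nth (fps_exp 1 - 1 :: real fps) 1 = 1" by simp
    then have ne: "(fps_exp 1 - 1 :: real fps) \<noteq> 0" by (metis fps_zero_nth zero_neq_one)
    have sd: "subdegree (fps_exp 1 - 1 :: real fps) = 1"
      by (rule subdegreeI) (use nth1 in auto)
    have "(\<lambda>x::real. if x = 0 then 1 else x / (exp x - 1)) has_fps_expansion bern"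
      unfolding bern_def
      by (rule has_fps_expansion_divide) (use ne sd in \<open>auto intro!: fps_expansion_intros\<close>)
    from has_fps_expansion_remainder[OF this, of N]
    have "((\<lambda>x. ((if x = 0 then 1 else x / (exp x - 1)) - (\<Sum>n\<le>N. fps_nth bern n * x ^ n)) / x ^ N) \<longlongrightarrow> 0) (at_right 0)"
      by (rule tendsto_within_subset) simp
    then show "((\<lambda>t. (Theta Suc t - (\<Sum>n\<le>N. ?A (?i n) * t powr ?i n)) / t powr ?i N) \<longlongrightarrow> 0) (at_right 0)"
    proof (rule Lim_transform_eventually)
      show "\<forall>\<^sub>F t in at_right 0. ((if t = 0 then 1 else t / (exp t - 1)) - (\<Sum>n\<le>N. fps_nth bern n * t ^ n)) / t ^ N =
        (Theta Suc t - (\<Sum>n\<le>N. ?A (?i n) * t powr ?i n)) / t powr ?i N"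
        using eventually_at_right_less[of 0]
      proof eventually_elim
        case (elim t)
        have frac: "(1 / x - S / t) / (y / t) = (t / x - S) / y" for x S y :: real
        proof -
          have "(1 / x - S / t) / (y / t) = (1 / x - S / t) * t / y" using elim by simp
          also have "(1 / x - S / t) * t = t / x - S" using elim by (simp add: left_diff_distrib)
          finally show ?thesis .
        qed
        have p: "t powr ?i n = t ^ n / t" for n using elim by (simp add: powr_diff powr_realpow)
        have "(\<Sum>n\<le>N. ?A (?i n) * t powr ?i n) = (\<Sum>n\<le>N. fps_nth bern n * t ^ n) / t"
          unfolding p sum_divide_distrib by (rule sum.cong) auto
        then have "(Theta Suc t - (\<Sum>n\<le>N. ?A (?i n) * t powr ?i n)) / t powr ?i N =
            (1 / (exp t - 1) - (\<Sum>n\<le>N. fps_nth bern n * t ^ n) / t) / (t ^ N / t)"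
          by (simp only: Theta_Suc[OF elim] p)
        also have "\<dots> = (t / (exp t - 1) - (\<Sum>n\<le>N. fps_nth bern n * t ^ n)) / t ^ N"
          unfolding frac using elim by simp
        finally show ?case using elim by simp
      qed
    qed
    show "\<forall>\<^sub>F t in at_right 0. t powr ?i N \<noteq> 0"
      using eventually_at_right_less[of "0::real"] by eventually_elim simp
  qed
  ultimately show "asymp_expansion_at_0 (Theta Suc) ?i ?A" unfolding asymp_expansion_at_0_def by (intro conjI allI)
qed simp

lemma riemann_zeta_real:
  assumes "x > 1"
  shows "riemann_zeta (of_real x) = of_real (\<Sum>r. real (Suc r) powr (- x))"
proof -
  have "(\<lambda>j. of_nat (Suc j) powr (- complex_of_real x)) sums riemann_zeta (of_real x)"
    unfolding riemann_zeta_def by (rule riemann.zeta_sums) (use assms in simp)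
  also have "(\<lambda>j. of_nat (Suc j) powr (- complex_of_real x)) = (\<lambda>j. complex_of_real (real (Suc j) powr (- x)))"
    by (rule ext) (metis of_nat_0_le_iff of_real_minus of_real_of_nat_eq powr_of_real)
  finally have "(\<lambda>j. complex_of_real (real (Suc j) powr (- x))) sums riemann_zeta (of_real x)" .
  moreover have "(\<lambda>j. complex_of_real (real (Suc j) powr (- x))) sums of_real (\<Sum>r. real (Suc r) powr (- x))"
    by (intro sums_of_real summable_sums summable_Suc_powr) (use assms in simp)
  ultimately show ?thesis by (rule sums_unique2)
qed

section \<open>The Dirichlet series at integers and its finite part at 1\<close>

locale admissible_seq = pole_seq +
  assumes A_0: "A (i 0) \<noteq> 0" and one: "1 \<in> range \<Lambda>"
begin

lemma Theta_lim_0: "((\<lambda>t. t powr (- i 0) * \<theta> t) \<longlongrightarrow> A (i 0)) (at_right 0)"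
proof -
  have "\<forall>N. (\<lambda>t. \<theta> t - (\<Sum>n\<le>N. A (i n) * t powr i n)) \<in> o[at_right 0](\<lambda>t. t powr i N)"
    using expn unfolding asymp_expansion_at_0_def by (elim conjE)
  from spec[OF this, of 0] have "(\<lambda>t. \<theta> t - A (i 0) * t powr i 0) \<in> o[at_right 0](\<lambda>t. t powr i 0)"
    by simp
  then have "((\<lambda>t. (\<theta> t - A (i 0) * t powr i 0) / t powr i 0 + A (i 0)) \<longlongrightarrow> 0 + A (i 0)) (at_right 0)"
    by (intro tendsto_add tendsto_const smalloD_tendsto)
  then have "((\<lambda>t. (\<theta> t - A (i 0) * t powr i 0) / t powr i 0 + A (i 0)) \<longlongrightarrow> A (i 0)) (at_right 0)" by simp
  then show ?thesis
  proof (rule Lim_transform_eventually)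
    show "\<forall>\<^sub>F t in at_right 0. (\<theta> t - A (i 0) * t powr i 0) / t powr i 0 + A (i 0) = t powr (- i 0) * \<theta> t"
      using eventually_at_right_less[of 0] by eventually_elim (simp add: powr_minus field_simps)
  qed
qed

lemma A_0_pos: "A (i 0) > 0"
proof -
  have "\<forall>\<^sub>F t in at_right 0. 0 \<le> t powr (- i 0) * \<theta> t"
    using eventually_at_right_less[of 0] by eventually_elim (simp add: Theta_pos less_imp_le)
  then have "A (i 0) \<ge> 0"
    by (rule tendsto_lowerbound[OF Theta_lim_0]) simp
  with A_0 show ?thesis by simp
qed

sublocale first_order \<Lambda> "- i 0" "A (i 0)"
  by unfold_locales (use i_0 A_0_pos Theta_lim_0 one in auto)

text \<open>Gamma(j) is the factorial of j - 1, which accounts for the factorials in the arguments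
  of the Bell polynomial.\<close>

lemma zeta_of_nat:
  assumes "real j > - i 0"
  shows "fact (j - 1) * zeta \<Lambda> (of_nat j) = of_real (LINT u:{0<..}|lborel. u powr (real j - 1) * \<theta> u)"
proof -
  have j: "j > 0" using assms i_0 by (cases j) auto
  have "zeta \<Lambda> (of_nat j) = rGamma (of_nat j) * mellin \<theta> (of_real (real j))"
    using zeta_mellin[of "of_nat j"] assms by simp
  also have "rGamma (of_nat j) = inverse (fact (j - 1) :: complex)"
    using j Gamma_fact[of "j - 1", where 'a = complex] by (simp add: rGamma_inverse_Gamma of_nat_diff)
  finally show ?thesis using mellin_of_real[of \<theta> "real j"] by simp
qed

text \<open>Subtracting \<open>e\<^sup>-\<^sup>t / t\<close>, whose transform is \<open>\<Gamma>(s - 1) = \<Gamma>(s) / (s - 1)\<close>, isolates the principal part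
  of the Dirichlet series at 1 exactly.\<close>

definition M :: "real \<Rightarrow> real" where
  "M t = \<theta> t - A (i 0) * exp (- t) / t"

lemma M_measurable [measurable]: "M \<in> borel_measurable borel"
  unfolding M_def by measurable

lemma M_integrable:
  assumes i0: "i 0 = - 1" and s: "\<sigma> > 0" "\<sigma> > - i 1"
  shows "set_integrable lborel {0<..} (\<lambda>t. t powr (\<sigma> - 1) * M t)"
proof -
  \<comment> \<open>The difference between the cut-off 1/t removed in \<open>G\<close> and the
    smooth exp(-t)/t removed in \<open>M\<close>; it is bounded near 0 and decays
    exponentially.\<close>
  define e where "e t = (if t \<le> 1 then (1 - exp (- t)) / t else - exp (- t) / t)" for t :: real
  have em [measurable]: "e \<in> borel_measurable borel" unfolding e_def by measurable
  have e_bound: "\<bar>e t\<bar> \<le> exp 1 * exp (- (1 * t))" if t: "t > 0" for t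
  proof (cases "t \<le> 1")
    case True
    have "\<bar>e t\<bar> = (1 - exp (- t)) / t" using True t by (simp add: e_def)
    also have "\<dots> \<le> 1" using t exp_ge_add_one_self[of "- t"] by (simp add: field_simps)
    also have "1 \<le> exp (1 - t)" using True by simp
    finally show ?thesis by (simp add: exp_diff exp_minus field_simps)
  next
    case False
    have "\<bar>e t\<bar> = exp (- t) / t" using False t by (simp add: e_def)
    also have "\<dots> \<le> exp (- t) / 1" using False by (intro divide_left_mono) auto
    also have "\<dots> \<le> exp 1 * exp (- t)" by simp
    finally show ?thesis by simp
  qed
  have "set_integrable lborel {0<..} (\<lambda>t. t powr (\<sigma> - 1) * e t)"
  proof (rule set_integrable_bound)
    show "set_integrable lborel {0<..} (\<lambda>t. exp 1 * (t powr (\<sigma> - 1) * exp (- (1 * t))))"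
      using s by (intro set_integrable_mult_right set_integrable_Gamma) auto
    have "norm (t powr (\<sigma> - 1) * e t) \<le> norm (exp 1 * (t powr (\<sigma> - 1) * exp (- (1 * t))))" if "t > 0" for t
      using mult_left_mono[OF e_bound[OF that], of "t powr (\<sigma> - 1)"] by (simp add: abs_mult mult_ac)
    then show "AE t in lborel. t \<in> {0<..} \<longrightarrow> norm (t powr (\<sigma> - 1) * e t) \<le> norm (exp 1 * (t powr (\<sigma> - 1) * exp (- (1 * t))))"
      by auto
  qed (simp add: set_borel_measurable_def)
  then have "set_integrable lborel {0<..} (\<lambda>t. t powr (\<sigma> - 1) * G 1 t +
      t powr (\<sigma> - 1) * (A (i 1) * (if t \<le> 1 then t powr i 1 else 0)) + A (i 0) * (t powr (\<sigma> - 1) * e t))"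
    using s by (intro set_integral_add set_integrable_mult_right G_integrable powr_unit_integrable) auto
  also have "?this \<longleftrightarrow> ?thesis"
  proof (intro set_integrable_cong refl)
    fix t :: real assume "t \<in> {0<..}"
    then have t: "t > 0" by simp
    have "M t = G 1 t + A (i 1) * (if t \<le> 1 then t powr i 1 else 0) + A (i 0) * e t"
      using t i0 by (simp add: G_def M_def e_def powr_minus field_simps)
    then show "t powr (\<sigma> - 1) * G 1 t + t powr (\<sigma> - 1) * (A (i 1) * (if t \<le> 1 then t powr i 1 else 0)) + A (i 0) * (t powr (\<sigma> - 1) * e t) = t powr (\<sigma> - 1) * M t"
      by (simp add: distrib_left)
  qed
  finally show ?thesis .
qed

lemma zeta_eq_M:
  assumes i0: "i 0 = - 1" and s: "Re s > 1"
  shows "zeta \<Lambda> s = rGamma s * mellin M s + of_real (A (i 0)) / (s - 1)"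
proof -
  have s1: "Re (s - 1) > 0" using s by simp
  have i1: "i 0 < i 1" using i_mono by (simp add: strict_mono_def)
  define h where "h t = A (i 0) * (exp (- t) / t)" for t :: real
  have hm [measurable]: "h \<in> borel_measurable borel" unfolding h_def by measurable
  have "mellin (\<lambda>t. M t + h t) s = mellin M s + mellin h s"
  proof (rule mellin_add)
    show "set_integrable lborel {0<..} (\<lambda>t. t powr (Re s - 1) * M t)"
      using s i0 i1 by (intro M_integrable) auto
    have "set_integrable lborel {0<..} (\<lambda>t. A (i 0) * (t powr (Re (s - 1) - 1) * exp (- (1 * t))))"
      by (intro set_integrable_mult_right mellin_exp(2)) (use s1 in auto)
    also have "?this \<longleftrightarrow> set_integrable lborel {0<..} (\<lambda>t. t powr (Re s - 1) * h t)"
      by (intro set_integrable_cong) (auto simp: h_def powr_diff field_simps power2_eq_square)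
    finally show "set_integrable lborel {0<..} (\<lambda>t. t powr (Re s - 1) * h t)" .
  qed measurable
  also have "(\<lambda>t. M t + h t) = \<theta>" by (auto simp: M_def h_def)
  also have "mellin h s = of_real (A (i 0)) * mellin (\<lambda>t. exp (- (1 * t))) (s - 1)"
  proof -
    have "mellin (\<lambda>t. exp (- t) / t) s = mellin (\<lambda>t. exp (- (1 * t))) (s - 1)"
      unfolding mellin_def
    proof (rule set_lebesgue_integral_cong)
      show "\<forall>t. t \<in> {0<..} \<longrightarrow> exp ((s - 1) * of_real (ln t)) * complex_of_real (exp (- t) / t) =
        exp ((s - 1 - 1) * of_real (ln t)) * complex_of_real (exp (- (1 * t)))"
      proof (intro allI impI)
        fix t :: real assume "t \<in> {0<..}"
        then have "complex_of_real (exp (- t) / t) = exp (- of_real (ln t)) * of_real (exp (- (1 * t)))"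
          by (simp add: exp_minus exp_of_real divide_inverse)
        then show "exp ((s - 1) * of_real (ln t)) * complex_of_real (exp (- t) / t) =
          exp ((s - 1 - 1) * of_real (ln t)) * complex_of_real (exp (- (1 * t)))"
          by (simp only:) (simp add: left_diff_distrib flip: mult.assoc exp_add)
      qed
    qed simp
    then show ?thesis unfolding h_def mellin_cmult by simp
  qed
  also have "mellin (\<lambda>t. exp (- (1 * t))) (s - 1) = Gamma (s - 1)"
    by (subst mellin_exp(1)) (use s1 in auto)
  finally have "zeta \<Lambda> s = rGamma s * (mellin M s + of_real (A (i 0)) * Gamma (s - 1))"
    using zeta_mellin[of s] s i0 by simp
  also have "\<dots> = rGamma s * mellin M s + of_real (A (i 0)) * (rGamma s * Gamma (s - 1))"
    by (simp add: algebra_simps)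
  \<comment> \<open>The functional equation of Gamma gives the principal part with no regular
    remainder, hence no correction to the constant term.\<close>
  also have "rGamma s * Gamma (s - 1) = 1 / (s - 1)"
  proof -
    have ni: "s - 1 \<notin> \<int>\<^sub>\<le>\<^sub>0"
    proof
      assume "s - 1 \<in> \<int>\<^sub>\<le>\<^sub>0"
      then obtain n where "s - 1 = - of_nat n" by (elim nonpos_Ints_cases')
      then have "Re (s - 1) = Re (- of_nat n)" by (rule arg_cong)
      with s1 show False by simp
    qed
    then have "s - 1 \<noteq> 0" by auto
    then have "rGamma s = rGamma (s - 1) / (s - 1)"
      using rGamma_plus1[of "s - 1"] by (simp add: field_simps)
    then show ?thesis using ni by (simp add: rGamma_inverse_Gamma Gamma_eq_zero_iff)
  qed
  finally show ?thesis by simp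
qed

text \<open>\<open>zeta_eq_M\<close> holds for Re s > 1 only, but \<open>M\<close> has a transform
  holomorphic around 1. The difference of the two sides vanishes at points arbitrarily close to 1,
  whereas a nonzero Laurent series has no zeros in a punctured neighbourhood, so the Laurent series
  coincide.\<close>

lemma finite_part_zeta:
  assumes i0: "i 0 = - 1"
  shows "finite_part (zeta \<Lambda>) 1 = of_real (LINT u:{0<..}|lborel. \<theta> u - A (i 0) * exp (- u) / u)"
proof -
  have i1: "i 0 < i 1" using i_mono by (simp add: strict_mono_def)
  define a where "a = max 0 (- i 1)"
  have a: "a < 1" using i1 i0 by (simp add: a_def)
  have op: "open {s. Re s > a}" by (rule open_halfspace_Re_gt)
  define h where "h w = rGamma (1 + w) * mellin M (1 + w)" for w
  have "mellin M holomorphic_on {s. Re s > a}"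
    by (intro mellin_holomorphic M_integrable i0) (auto simp: a_def)
  then have "(\<lambda>s. rGamma s * mellin M s) holomorphic_on {s. Re s > a}"
    by (intro holomorphic_on_mult holomorphic_rGamma)
  then have "(\<lambda>s. rGamma s * mellin M s) analytic_on {1}"
    using op a by (auto simp: analytic_at)
  then have "h has_fps_expansion fps_expansion (\<lambda>s. rGamma s * mellin M s) 1"
    unfolding h_def by (rule analytic_at_imp_has_fps_expansion)
  then have h: "h has_laurent_expansion fps_to_fls (fps_expansion (\<lambda>s. rGamma s * mellin M s) 1)"
    by (rule has_laurent_expansion_fps)
  define H where "H = fps_to_fls (fps_expansion (\<lambda>s. rGamma s * mellin M s) 1) + fls_const (of_real (A (i 0))) * fls_X_inv"
  have H: "(\<lambda>w. h w + of_real (A (i 0)) * inverse w) has_laurent_expansion H"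
    unfolding H_def using has_laurent_expansion_inverse[OF has_laurent_expansion_fps_X]
    by (intro laurent_expansion_intros h)
  define L where "L = laurent_expansion (zeta \<Lambda>) 1"
  have "zeta \<Lambda> meromorphic_on UNIV"
    using zeta_cont_nice unfolding zeta_eq nicely_meromorphic_on_def by blast
  then have L: "(\<lambda>w. zeta \<Lambda> (1 + w)) has_laurent_expansion L"
    unfolding L_def meromorphic_on_def' by blast
  define d where "d w = zeta \<Lambda> (1 + w) - (h w + of_real (A (i 0)) * inverse w)" for w
  have d: "d has_laurent_expansion L - H"
    unfolding d_def[abs_def] by (intro laurent_expansion_intros L H)
  have d0: "d w = 0" if "Re w > 0" for w
    using zeta_eq_M[OF i0, of "1 + w"] that by (simp add: d_def h_def field_simps)
  have "L - H = 0"
  proof (rule ccontr)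
    assume "L - H \<noteq> 0"
    then have "\<forall>\<^sub>F w in at 0. d w \<noteq> 0"
      using d by (metis has_laurent_expansion_nonzero_imp_eventually_nonzero)
    then obtain e where e: "e > 0" "\<And>w. w \<noteq> 0 \<Longrightarrow> dist w 0 < e \<Longrightarrow> d w \<noteq> 0"
      unfolding eventually_at by auto
    have "d (of_real (e / 2)) \<noteq> 0" using e(1) by (intro e(2)) auto
    then show False using d0[of "of_real (e / 2)"] e(1) by simp
  qed
  then have "finite_part (zeta \<Lambda>) 1 = fls_nth H 0" by (simp add: finite_part_def L_def)
  \<comment> \<open>The pole term has coefficient 0 at degree 0, and \<open>rGamma 1\<close> is
    1.\<close>
  also have "\<dots> = rGamma 1 * mellin M 1" by (simp add: H_def fps_expansion_def)
  also have "\<dots> = of_real (LINT u:{0<..}|lborel. u powr (1 - 1) * M u)"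
    using mellin_of_real[of M 1] by simp
  also have "(LINT u:{0<..}|lborel. u powr (1 - 1) * M u) = (LINT u:{0<..}|lborel. \<theta> u - A (i 0) * exp (- u) / u)"
    by (rule set_lebesgue_integral_cong) (auto simp: M_def)
  finally show ?thesis .
qed

end

section \<open>Bell polynomials\<close>

text \<open>The number K of variables is kept apart from the weight n, so that a part can be
  removed, lowering n, within the same index range.\<close>

definition bell_idx :: "nat \<Rightarrow> nat \<Rightarrow> (nat \<Rightarrow> nat) set" where
  "bell_idx K n = {b \<in> {1..K} \<rightarrow>\<^sub>E UNIV. (\<Sum>j=1..K. j * b j) = n}"

definition bell_w :: "(nat \<Rightarrow> complex) \<Rightarrow> nat \<Rightarrow> (nat \<Rightarrow> nat) \<Rightarrow> complex" where
  "bell_w x K b = (\<Prod>j=1..K. (x j / fact j) ^ b j / fact (b j))"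

lemma bell_idx_le: "b \<in> bell_idx K n \<Longrightarrow> j \<in> {1..K} \<Longrightarrow> j * b j \<le> n"
  unfolding bell_idx_def using member_le_sum[of j "{1..K}" "\<lambda>j. j * b j"] by auto

lemma finite_bell_idx [simp]: "finite (bell_idx K n)"
proof (rule finite_subset)
  show "bell_idx K n \<subseteq> {1..K} \<rightarrow>\<^sub>E {..n}"
  proof
    fix b assume b: "b \<in> bell_idx K n"
    have "b j \<le> n" if "j \<in> {1..K}" for j
    proof -
      have "b j \<le> j * b j" using that by simp
      with bell_idx_le[OF b that] show ?thesis by linarith
    qed
    with b show "b \<in> {1..K} \<rightarrow>\<^sub>E {..n}" by (auto simp: bell_idx_def PiE_def Pi_def)
  qed
qed (intro finite_PiE; simp)

lemma bell_Y_alt: "bell_Y k x = fact k * (\<Sum>b\<in>bell_idx k k. bell_w x k b)"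
  unfolding bell_Y_def bell_idx_def sum_distrib_left
  by (rule sum.cong) (auto simp: bell_w_def prod_dividef)

text \<open>No part can exceed the total weight n, so the coordinates beyond n are 0 and restriction
  is a bijection.\<close>

lemma bell_idx_reduce:
  assumes "n \<le> K"
  shows "(\<Sum>b\<in>bell_idx K n. bell_w x K b) = (\<Sum>b\<in>bell_idx n n. bell_w x n b)"
proof (rule sum.reindex_bij_witness[where i = "\<lambda>b. \<lambda>j\<in>{1..K}. if j \<le> n then b j else 0" and j = "\<lambda>b. restrict b {1..n}"])
  have sub: "{1..n} \<subseteq> {1..K}" using assms by auto
  fix b assume b: "b \<in> bell_idx K n"
  have z: "b j = 0" if "j \<in> {1..K} - {1..n}" for j
  proof (rule ccontr)
    assume "b j \<noteq> 0"
    then have "j \<le> j * b j" by simp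
    moreover from that have "j \<in> {1..K}" "n < j" by auto
    ultimately show False using bell_idx_le[OF b, of j] by linarith
  qed
  have "(\<Sum>j=1..n. j * b j) = (\<Sum>j=1..K. j * b j)"
    using z by (intro sum.mono_neutral_left sub) auto
  with b show "restrict b {1..n} \<in> bell_idx n n" by (auto simp: bell_idx_def)
  show "(\<lambda>j\<in>{1..K}. if j \<le> n then restrict b {1..n} j else 0) = b"
  proof
    fix j show "(\<lambda>j\<in>{1..K}. if j \<le> n then restrict b {1..n} j else 0) j = b j"
      using b z[of j] by (auto simp: bell_idx_def PiE_def extensional_def restrict_def)
  qed
  have "bell_w x K b = (\<Prod>j=1..n. (x j / fact j) ^ b j / fact (b j))"
    unfolding bell_w_def using z by (intro prod.mono_neutral_right sub) auto
  then show "bell_w x n (restrict b {1..n}) = bell_w x K b" by (simp add: bell_w_def)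
next
  have sub: "{1..n} \<subseteq> {1..K}" using assms by auto
  fix b assume b: "b \<in> bell_idx n n"
  have "(\<Sum>j=1..K. j * (if j \<le> n then b j else 0)) = (\<Sum>j=1..n. j * (if j \<le> n then b j else 0))"
    by (intro sum.mono_neutral_right sub) auto
  also have "\<dots> = n" using b by (simp add: bell_idx_def)
  finally show "(\<lambda>j\<in>{1..K}. if j \<le> n then b j else 0) \<in> bell_idx K n" by (simp add: bell_idx_def)
  show "restrict (\<lambda>j\<in>{1..K}. if j \<le> n then b j else 0) {1..n} = b"
  proof
    fix j show "restrict (\<lambda>j\<in>{1..K}. if j \<le> n then b j else 0) {1..n} j = b j"
      using b sub by (auto simp: bell_idx_def PiE_def extensional_def restrict_def)
  qed
qed

lemma bell_w_decrease:
  assumes j: "j \<in> {1..K}" and b: "b j > 0"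
  shows "of_nat (b j) * bell_w x K b = x j / fact j * bell_w x K (b(j := b j - 1))"
proof -
  let ?g = "\<lambda>b l. (x l / fact l) ^ b l / fact (b l) :: complex"
  have r: "(\<Prod>l\<in>{1..K}-{j}. ?g (b(j := b j - 1)) l) = (\<Prod>l\<in>{1..K}-{j}. ?g b l)"
    by (rule prod.cong) auto
  obtain m where m: "b j = Suc m" using b by (cases "b j") auto
  have h: "of_nat (b j) * ?g b j = x j / fact j * ?g (b(j := b j - 1)) j"
    unfolding m by (simp add: m fact_Suc field_simps del: of_nat_Suc)
  have "of_nat (b j) * bell_w x K b = (of_nat (b j) * ?g b j) * (\<Prod>l\<in>{1..K}-{j}. ?g b l)"
    unfolding bell_w_def using prod.remove[of "{1..K}" j "?g b"] j by simp
  also have "\<dots> = x j / fact j * (?g (b(j := b j - 1)) j * (\<Prod>l\<in>{1..K}-{j}. ?g (b(j := b j - 1)) l))"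
    unfolding h r by (simp only: mult.assoc)
  also have "?g (b(j := b j - 1)) j * (\<Prod>l\<in>{1..K}-{j}. ?g (b(j := b j - 1)) l) = bell_w x K (b(j := b j - 1))"
    unfolding bell_w_def using prod.remove[of "{1..K}" j "?g (b(j := b j - 1))"] j by simp
  finally show ?thesis .
qed

lemma sum_upd: "j \<in> {1..K} \<Longrightarrow> (\<Sum>l=1..K. l * (b(j := c)) l) + j * b j = (\<Sum>l=1..K. l * b l) + j * (c :: nat)"
proof -
  assume j: "j \<in> {1..K}"
  have "(\<Sum>l=1..K. l * (b(j := c)) l) = j * c + (\<Sum>l\<in>{1..K}-{j}. l * (b(j := c)) l)"
    using sum.remove[OF _ j, of "\<lambda>l. l * (b(j := c)) l"] by simp
  also have "(\<Sum>l\<in>{1..K}-{j}. l * (b(j := c)) l) = (\<Sum>l\<in>{1..K}-{j}. l * b l)"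
    by (rule sum.cong) auto
  finally show ?thesis using sum.remove[OF finite_atLeastAtMost j, of "\<lambda>l. l * b l"] by linarith
qed

text \<open>Removing one part j: the multiplicity b j cancels against the factorial of b j, leaving
  one factor x j / j! and the weight n - j. Vectors with b j = 0 contribute nothing.\<close>

lemma bell_idx_mult:
  assumes j: "j \<in> {1..K}"
  shows "(\<Sum>b\<in>bell_idx K n. of_nat (b j) * bell_w x K b) =
    (if j \<le> n then x j / fact j * (\<Sum>b\<in>bell_idx K (n - j). bell_w x K b) else 0)"
proof (cases "j \<le> n")
  case False
  have "of_nat (b j) * bell_w x K b = 0" if b: "b \<in> bell_idx K n" for b
  proof -
    have "b j = 0"
    proof (rule ccontr)
      assume "b j \<noteq> 0"
      then have "j \<le> j * b j" by simp
      with bell_idx_le[OF b j] False show False by linarith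
    qed
    then show ?thesis by simp
  qed
  then have "(\<Sum>b\<in>bell_idx K n. of_nat (b j) * bell_w x K b) = 0" by (intro sum.neutral ballI)
  with False show ?thesis by simp
next
  case True
  have "(\<Sum>b\<in>bell_idx K n. of_nat (b j) * bell_w x K b) = (\<Sum>b\<in>{b\<in>bell_idx K n. b j > 0}. of_nat (b j) * bell_w x K b)"
    by (rule sum.mono_neutral_right) auto
  also have "\<dots> = (\<Sum>b\<in>bell_idx K (n - j). x j / fact j * bell_w x K b)"
  proof (rule sum.reindex_bij_witness[where i = "\<lambda>b. b(j := Suc (b j))" and j = "\<lambda>b. b(j := b j - 1)"])
    fix b assume "b \<in> {b\<in>bell_idx K n. b j > 0}"
    then have b: "b \<in> bell_idx K n" "b j > 0" by auto
    show "b(j := b j - 1, j := Suc ((b(j := b j - 1)) j)) = b" using b by auto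
    have "j * b j = j * (b j - 1) + j" using b(2) by (cases "b j") auto
    with sum_upd[OF j, of b "b j - 1"] b have "(\<Sum>l=1..K. l * (b(j := b j - 1)) l) = n - j"
      by (simp add: bell_idx_def)
    with b j show "b(j := b j - 1) \<in> bell_idx K (n - j)"
      by (auto simp: bell_idx_def PiE_def extensional_def)
    show "x j / fact j * bell_w x K (b(j := b j - 1)) = of_nat (b j) * bell_w x K b"
      using bell_w_decrease[of j K b x] j b by simp
  next
    fix b assume b: "b \<in> bell_idx K (n - j)"
    show "b(j := Suc (b j), j := (b(j := Suc (b j))) j - 1) = b" by auto
    have "(\<Sum>l=1..K. l * (b(j := Suc (b j))) l) = n"
      using sum_upd[OF j, of b "Suc (b j)"] b True by (simp add: bell_idx_def)
    with b j show "b(j := Suc (b j)) \<in> {b\<in>bell_idx K n. b j > 0}"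
      by (auto simp: bell_idx_def PiE_def extensional_def)
  qed
  finally show ?thesis using True by (simp add: sum_distrib_left)
qed

text \<open>The weight equation \<open>k + 1 = \<Sum> j b\<^sub>j\<close> is inserted under the sum.
  This is the derivative of the generating function
  exp(\<open>\<Sum> x\<^sub>j u\<^sup>j / j!\<close>), compared coefficientwise.\<close>

lemma bell_idx_rec:
  "of_nat (Suc k) * (\<Sum>b\<in>bell_idx (Suc k) (Suc k). bell_w x (Suc k) b) =
    (\<Sum>i\<le>k. x (Suc i) / fact i * (\<Sum>b\<in>bell_idx (k - i) (k - i). bell_w x (k - i) b))"
proof -
  let ?K = "Suc k"
  have "of_nat ?K * (\<Sum>b\<in>bell_idx ?K ?K. bell_w x ?K b) = (\<Sum>b\<in>bell_idx ?K ?K. \<Sum>j=1..?K. of_nat j * (of_nat (b j) * bell_w x ?K b))"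
    unfolding sum_distrib_left
  proof (rule sum.cong[OF refl])
    fix b assume "b \<in> bell_idx ?K ?K"
    then have "?K = (\<Sum>j=1..?K. j * b j)" by (simp add: bell_idx_def)
    then have "(of_nat ?K :: complex) = of_nat (\<Sum>j=1..?K. j * b j)" by (rule arg_cong)
    then show "of_nat ?K * bell_w x ?K b = (\<Sum>j=1..?K. of_nat j * (of_nat (b j) * bell_w x ?K b))"
      by (simp only: of_nat_sum of_nat_mult sum_distrib_right mult.assoc)
  qed
  also have "\<dots> = (\<Sum>j=1..?K. of_nat j * (\<Sum>b\<in>bell_idx ?K ?K. of_nat (b j) * bell_w x ?K b))"
    unfolding sum_distrib_left by (rule sum.swap)
  also have "\<dots> = (\<Sum>j=1..?K. of_nat j * (x j / fact j * (\<Sum>b\<in>bell_idx (?K - j) (?K - j). bell_w x (?K - j) b)))"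
  proof (rule sum.cong[OF refl])
    fix j assume j: "j \<in> {1..?K}"
    then have "j \<le> ?K" by simp
    then show "of_nat j * (\<Sum>b\<in>bell_idx ?K ?K. of_nat (b j) * bell_w x ?K b) =
      of_nat j * (x j / fact j * (\<Sum>b\<in>bell_idx (?K - j) (?K - j). bell_w x (?K - j) b))"
      unfolding bell_idx_mult[OF j] using bell_idx_reduce[of "?K - j" ?K x] by simp
  qed
  also have "\<dots> = (\<Sum>i=0..k. of_nat (Suc i) * (x (Suc i) / fact (Suc i) * (\<Sum>b\<in>bell_idx (?K - Suc i) (?K - Suc i). bell_w x (?K - Suc i) b)))"
    unfolding One_nat_def by (rule sum.shift_bounds_cl_Suc_ivl)
  also have "\<dots> = (\<Sum>i\<le>k. x (Suc i) / fact i * (\<Sum>b\<in>bell_idx (k - i) (k - i). bell_w x (k - i) b))"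
    unfolding atLeast0AtMost
  proof (rule sum.cong[OF refl])
    fix i
    have "of_nat (Suc i) * (x (Suc i) / fact (Suc i)) = x (Suc i) / fact i"
      by (simp add: fact_Suc divide_simps del: of_nat_Suc)
    then show "of_nat (Suc i) * (x (Suc i) / fact (Suc i) * (\<Sum>b\<in>bell_idx (?K - Suc i) (?K - Suc i). bell_w x (?K - Suc i) b)) =
      x (Suc i) / fact i * (\<Sum>b\<in>bell_idx (k - i) (k - i). bell_w x (k - i) b)"
      by (simp only: mult.assoc[symmetric] diff_Suc_Suc)
  qed
  finally show ?thesis .
qed

lemma bell_Y_eq_bell_rec: "bell_Y k x = bell_rec x k"
proof (induction k rule: less_induct)
  case (less k)
  show ?case
  proof (cases k)
    case 0
    have "bell_idx 0 0 = {\<lambda>_. undefined}" by (auto simp: bell_idx_def)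
    then show ?thesis unfolding bell_Y_alt 0 by (simp add: bell_w_def)
  next
    case (Suc n)
    have "bell_Y k x = fact n * (of_nat (Suc n) * (\<Sum>b\<in>bell_idx (Suc n) (Suc n). bell_w x (Suc n) b))"
      unfolding bell_Y_alt Suc by (simp add: fact_Suc mult_ac del: of_nat_Suc)
    also have "\<dots> = (\<Sum>i\<le>n. of_nat (n choose i) * x (Suc i) * bell_rec x (n - i))"
      unfolding bell_idx_rec sum_distrib_left[of "fact n" _ "{..n}"]
    proof (rule sum.cong[OF refl])
      fix i assume i: "i \<in> {..n}"
      then have IH: "bell_rec x (n - i) = fact (n - i) * (\<Sum>b\<in>bell_idx (n - i) (n - i). bell_w x (n - i) b)"
        using less[of "n - i"] Suc by (simp add: bell_Y_alt)
      have c: "(of_nat (n choose i) :: complex) = fact n / (fact i * fact (n - i))"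
        using i by (simp add: binomial_fact)
      show "fact n * (x (Suc i) / fact i * (\<Sum>b\<in>bell_idx (n - i) (n - i). bell_w x (n - i) b)) =
        of_nat (n choose i) * x (Suc i) * bell_rec x (n - i)"
        unfolding IH c by (simp add: divide_simps)
    qed
    finally show ?thesis by (simp add: Suc bell_rec_Suc)
  qed
qed

text \<open>Weighted homogeneity, the i-th variable having weight i.\<close>

lemma bell_rec_scale:
  fixes c :: "'a::comm_semiring_1"
  shows "bell_rec (\<lambda>i. c ^ i * x i) k = c ^ k * bell_rec x k"
proof (induction k rule: less_induct)
  case (less k)
  show ?case
  proof (cases k)
    case (Suc n)
    show ?thesis unfolding Suc bell_rec_Suc sum_distrib_left
    proof (rule sum.cong[OF refl])
      fix i assume i: "i \<in> {..n}"
      then have "c ^ Suc n = c ^ Suc i * c ^ (n - i)" by (simp flip: power_Suc power_add)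
      moreover have "bell_rec (\<lambda>i. c ^ i * x i) (n - i) = c ^ (n - i) * bell_rec x (n - i)"
        using less[of "n - i"] Suc by simp
      ultimately show "of_nat (n choose i) * (c ^ Suc i * x (Suc i)) * bell_rec (\<lambda>i. c ^ i * x i) (n - i) =
        c ^ Suc n * (of_nat (n choose i) * x (Suc i) * bell_rec x (n - i))" by (simp only: mult_ac)
    qed
  qed simp
qed

lemma bell_rec_tendsto:
  fixes l :: "nat \<Rightarrow> real"
  assumes "\<And>i. i \<ge> 1 \<Longrightarrow> ((\<lambda>t. f t i) \<longlongrightarrow> l i) F"
  shows "((\<lambda>t. bell_rec (f t) k) \<longlongrightarrow> bell_rec l k) F"
proof (induction k rule: less_induct)
  case (less k)
  show ?case
  proof (cases k)
    case (Suc n)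
    show ?thesis unfolding Suc bell_rec_Suc
      by (intro tendsto_sum tendsto_mult tendsto_const assms less) (use Suc in auto)
  qed simp
qed

lemma bell_rec_single: "bell_rec (\<lambda>i. if i = 1 then a else 0) k = a ^ k"
proof (induction k)
  case (Suc k)
  have "bell_rec (\<lambda>i. if i = 1 then a else 0) (Suc k) =
    (\<Sum>i\<le>k. if i = 0 then a * bell_rec (\<lambda>i. if i = 1 then a else 0) k else 0)"
    unfolding bell_rec_Suc by (rule sum.cong) auto
  also have "\<dots> = a ^ Suc k" using Suc by simp
  finally show ?case .
qed simp

text \<open>By homogeneity the variables may be divided by powers of the first one. The first
  becomes 1 and the others tend to 0, which leaves the value 1.\<close>

lemma bell_rec_dominant:
  fixes l :: "nat \<Rightarrow> real"
  assumes inf: "filterlim (\<lambda>t. f t 1) at_top F" and lim: "\<And>i. i \<ge> 2 \<Longrightarrow> ((\<lambda>t. f t i) \<longlongrightarrow> l i) F"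
  shows "((\<lambda>t. bell_rec (f t) k / f t 1 ^ k) \<longlongrightarrow> 1) F"
proof -
  have ev: "\<forall>\<^sub>F t in F. f t 1 > 0" using inf by (auto simp: filterlim_at_top_dense)
  have inv: "((\<lambda>t. inverse (f t 1)) \<longlongrightarrow> 0) F" using inf by (rule tendsto_inverse_0_at_top)
  have "((\<lambda>t. bell_rec (\<lambda>i. inverse (f t 1) ^ i * f t i) k) \<longlongrightarrow> bell_rec (\<lambda>i. if i = 1 then 1 else 0) k) F"
  proof (rule bell_rec_tendsto)
    fix i :: nat assume i: "i \<ge> 1"
    show "((\<lambda>t. inverse (f t 1) ^ i * f t i) \<longlongrightarrow> (if i = 1 then 1 else 0)) F"
    proof (cases "i = 1")
      case True
      have "\<forall>\<^sub>F t in F. 1 = inverse (f t 1) ^ i * f t i"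
        using ev by eventually_elim (simp add: True)
      with True show ?thesis by (auto intro: Lim_transform_eventually[OF tendsto_const])
    next
      case False
      then have "((\<lambda>t. inverse (f t 1) ^ i * f t i) \<longlongrightarrow> 0 ^ i * l i) F"
        using i by (intro tendsto_mult tendsto_power inv lim) auto
      with False i show ?thesis by (simp add: zero_power)
    qed
  qed
  then have "((\<lambda>t. inverse (f t 1) ^ k * bell_rec (f t) k) \<longlongrightarrow> 1) F"
    unfolding bell_rec_scale bell_rec_single by simp
  then show ?thesis by (simp add: divide_inverse power_inverse mult.commute)
qed

section \<open>The saddle point and the asymptotics of the moments\<close>

context first_order
begin

definition S :: "real \<Rightarrow> real" where
  "S t = (\<Sum>n. dsum (\<lambda>j r. real (\<Lambda> j)) n * exp (- t) ^ n)"

lemma S_sums: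
  assumes "t > 0"
  shows "(\<lambda>n. dsum (\<lambda>j r. real (\<Lambda> j)) n * exp (- t) ^ n) sums S t"
    "(\<lambda>j. real (\<Lambda> j) / (exp (t * real (\<Lambda> j)) - 1)) sums S t"
proof -
  obtain s where "(\<lambda>n. dsum (\<lambda>j r. real (\<Lambda> j)) n * exp (- t) ^ n) sums s"
    "(\<lambda>j. real (\<Lambda> j) / (exp (t * real (\<Lambda> j)) - 1)) sums s"
    by (rule dsum_weight_sums[OF assms])
  moreover from this(1) have "S t = s" unfolding S_def by (rule sums_unique[symmetric])
  ultimately show "(\<lambda>n. dsum (\<lambda>j r. real (\<Lambda> j)) n * exp (- t) ^ n) sums S t"
    "(\<lambda>j. real (\<Lambda> j) / (exp (t * real (\<Lambda> j)) - 1)) sums S t" by simp_all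
qed

lemma eval_weightS: "t > 0 \<Longrightarrow> eval_fps weightS (of_real (exp (- t))) = of_real (S t)"
  unfolding weightS_def by (intro eval_cfps S_sums)

text \<open>The contribution of the element 1 alone; it makes S unbounded near 0.\<close>

lemma S_ge:
  assumes t: "t > 0"
  shows "S t \<ge> 1 / (exp t - 1)"
proof -
  obtain j where j: "\<Lambda> j = 1" using one by (metis imageE)
  have "(\<Sum>j\<in>{j}. real (\<Lambda> j) / (exp (t * real (\<Lambda> j)) - 1)) \<le> S t"
    using S_sums(2)[OF t] t
    by (subst sums_unique[OF S_sums(2)[OF t]]) (intro sum_le_suminf sums_summable[OF S_sums(2)[OF t]], auto)
  then show ?thesis by (simp add: j)
qed

lemma S_pos: "t > 0 \<Longrightarrow> S t > 0"
  using S_ge[of t] by (smt (verit) divide_pos_pos exp_gt_one)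

text \<open>The series has no constant term, so every power of exp(-t) in it loses at least the
  factor exp(-(t - s)).\<close>

lemma S_decay:
  assumes "0 < s" "s \<le> t"
  shows "S t \<le> exp (- (t - s)) * S s"
proof (rule sums_le[OF _ S_sums(1) sums_mult[OF S_sums(1)]])
  fix n
  show "dsum (\<lambda>j r. real (\<Lambda> j)) n * exp (- t) ^ n \<le> exp (- (t - s)) * (dsum (\<lambda>j r. real (\<Lambda> j)) n * exp (- s) ^ n)"
  proof (cases n)
    case (Suc m)
    have "1 * (t - s) \<le> real n * (t - s)" using assms Suc by (intro mult_right_mono) auto
    then have "exp (- t) ^ n \<le> exp (- (t - s)) * exp (- s) ^ n"
      by (simp add: algebra_simps flip: exp_of_nat_mult exp_add)
    then have "dsum (\<lambda>j r. real (\<Lambda> j)) n * exp (- t) ^ n \<le> dsum (\<lambda>j r. real (\<Lambda> j)) n * (exp (- (t - s)) * exp (- s) ^ n)"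
      by (rule mult_left_mono) (auto intro: dsum_nonneg)
    then show ?thesis by (simp only: mult_ac)
  qed simp
qed (use assms in auto)

lemma S_strict:
  assumes "0 < s" "s < t"
  shows "S t < S s"
proof -
  have "S t \<le> exp (- (t - s)) * S s" using assms by (intro S_decay) auto
  also have "\<dots> < 1 * S s" using assms S_pos[of s] by (intro mult_strict_right_mono) auto
  finally show ?thesis by simp
qed

lemma S_continuous: "continuous_on {0<..} S"
proof -
  have "continuous_on {0<..} (\<lambda>t. Re (eval_fps weightS (of_real (exp (- t)))))"
  proof (intro continuous_intros)
    show "(\<lambda>t. complex_of_real (exp (- t))) ` {0<..} \<subseteq> eball 0 (fps_conv_radius weightS)"
      using ereal_less_radius[OF _ weightS_radius] by auto
  qed
  also have "?this \<longleftrightarrow> continuous_on {0<..} S"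
    by (rule continuous_on_cong) (auto simp: eval_weightS)
  finally show ?thesis .
qed

lemma saddle_ex1:
  assumes n: "n > 0"
  shows "\<exists>!\<alpha>. \<alpha> > 0 \<and> S \<alpha> = real n"
proof -
  \<comment> \<open>The point where the lower bound 1 / (exp t - 1) equals n.\<close>
  define t1 where "t1 = ln (1 + 1 / real n)"
  have t1: "t1 > 0" using n by (simp add: t1_def ln_gt_zero)
  have "exp t1 = 1 + 1 / real n" using n by (simp add: t1_def add_pos_pos)
  then have S1: "S t1 \<ge> real n" using S_ge[OF t1] by simp
  \<comment> \<open>Far enough to the right for \<open>S_decay\<close> to bring S from its value at
    \<open>t1\<close> down to n.\<close>
  define t2 where "t2 = t1 + ln (S t1 / real n)"
  have t2: "t2 \<ge> t1" using S1 n by (simp add: t2_def)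
  have "S t2 \<le> exp (- (t2 - t1)) * S t1" by (rule S_decay[OF t1 t2])
  also have "\<dots> = real n" using S_pos[OF t1] n by (simp add: t2_def exp_minus)
  finally have S2: "S t2 \<le> real n" .
  have "continuous_on {t1..t2} S" using t1 by (intro continuous_on_subset[OF S_continuous]) auto
  then obtain \<alpha> where "t1 \<le> \<alpha>" "S \<alpha> = real n" using IVT2'[OF S2 S1 t2] by blast
  moreover have "x = y" if "x > 0" "y > 0" "S x = S y" for x y
    using S_strict[of x y] S_strict[of y x] that by (cases x y rule: linorder_cases) auto
  ultimately show ?thesis using t1 by (metis less_le_trans)
qed

lemma saddle:
  assumes n: "n > 0"
  shows "saddle \<Lambda> n > 0" "S (saddle \<Lambda> n) = real n"
proof -
  have "(\<alpha> > 0 \<and> (\<lambda>j. real (\<Lambda> j) / (exp (\<alpha> * real (\<Lambda> j)) - 1)) sums real n) \<longleftrightarrow> \<alpha> > 0 \<and> S \<alpha> = real n" for \<alpha>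
    using S_sums(2)[of \<alpha>] sums_unique2 by metis
  then have "saddle \<Lambda> n = (THE \<alpha>. \<alpha> > 0 \<and> S \<alpha> = real n)" unfolding saddle_def by simp
  then show "saddle \<Lambda> n > 0" "S (saddle \<Lambda> n) = real n"
    using theI'[OF saddle_ex1[OF n]] by simp_all
qed

lemma saddle_lim: "filterlim (saddle \<Lambda>) (at_right 0) sequentially"
  unfolding filterlim_at
proof
  have pos: "\<forall>\<^sub>F n in sequentially. saddle \<Lambda> n > 0"
    using eventually_gt_at_top[of 0] by eventually_elim (rule saddle(1))
  then show "\<forall>\<^sub>F n in sequentially. saddle \<Lambda> n \<in> {0<..} \<and> saddle \<Lambda> n \<noteq> 0"
    by eventually_elim auto
  show "saddle \<Lambda> \<longlonglongrightarrow> 0"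
  proof (rule order_tendstoI)
    show "\<forall>\<^sub>F n in sequentially. e < saddle \<Lambda> n" if "e < 0" for e
      using pos by eventually_elim (use that in auto)
    show "\<forall>\<^sub>F n in sequentially. saddle \<Lambda> n < e" if e: "e > 0" for e
    proof -
      obtain N where N: "S e < real N" using reals_Archimedean2 by blast
      show ?thesis using eventually_ge_at_top[of "Suc N"]
      proof eventually_elim
        case (elim n)
        then have n: "n > 0" "S e < real n" using N by auto
        show ?case
        proof (rule ccontr)
          assume "\<not> saddle \<Lambda> n < e"
          then have "S (saddle \<Lambda> n) \<le> S e"
            using S_strict[OF e, of "saddle \<Lambda> n"] by (cases "saddle \<Lambda> n = e") auto
          with saddle(2)[OF n(1)] n(2) show False by simp
        qed
      qed
    qed
  qed
qed

text \<open>An asymptotically equivalent comparison function f may replace the Bell polynomial, and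
  its doubling bound carries over.\<close>

lemma moment_saddle:
  assumes f: "((\<lambda>t. bell_rec (\<lambda>i. kap (real i - 1) t) k / f t) \<longlongrightarrow> 1) (at_right 0)"
    and f_pos: "\<forall>\<^sub>F t in at_right 0. f t > 0"
    and C: "C > 0" "\<forall>\<^sub>F t in at_right 0. f (t / 2) \<le> C * f t"
  shows "(\<lambda>n. moment \<Lambda> k n / (moment \<Lambda> 0 n * f (saddle \<Lambda> n))) \<longlonglongrightarrow> 1"
proof -
  \<comment> \<open>At n = 0 the description in \<open>saddle\<close> denotes nothing definite; the
    value 1 only secures positivity.\<close>
  define a where "a n = (if n = 0 then 1 else saddle \<Lambda> n)" for n
  have a_eq: "\<forall>\<^sub>F n in sequentially. a n = saddle \<Lambda> n"
    using eventually_gt_at_top[of 0] by eventually_elim (simp add: a_def)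
  have a_at: "filterlim a (at_right 0) sequentially"
    using saddle_lim a_eq by (simp cong: filterlim_cong)
  have S_a: "\<forall>\<^sub>F n in sequentially. eval_fps weightS (of_real (exp (- a n))) = of_nat n"
    using eventually_gt_at_top[of 0]
  proof eventually_elim
    case (elim n)
    then show ?case using eval_weightS[OF saddle(1)] saddle(2) by (simp add: a_def)
  qed
  interpret saddle_seq \<Lambda> \<mu> c a
    by unfold_locales (use saddle(1) a_at S_a in \<open>auto simp: a_def filterlim_at\<close>)
  have f: "((\<lambda>t. Bell k t / f t) \<longlongrightarrow> 1) (at_right 0)" using f unfolding Bell_def .
  have half: "filterlim (\<lambda>t. 1 / 2 * t) (at_right 0) (at_right (0::real))" by (rule at_right_0_mult) simp
  have le: "\<forall>\<^sub>F t in at_right 0. Bell k t / f t < 2" and ge: "\<forall>\<^sub>F t in at_right 0. Bell k t / f t > 1 / 2"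
    using order_tendstoD(2)[OF f, of 2] order_tendstoD(1)[OF f, of "1 / 2"] by simp_all
  \<comment> \<open>A factor 2 for passing from \<open>Bell k\<close> to f at t / 2, and another for
    passing back at t.\<close>
  have "\<forall>\<^sub>F t in at_right 0. Bell k (t / 2) \<le> 4 * C * Bell k t"
    using eventually_compose_filterlim[OF le half] eventually_compose_filterlim[OF f_pos half] C(2) ge f_pos
  proof eventually_elim
    case (elim t)
    have "Bell k (t / 2) \<le> 2 * f (t / 2)" using elim(1,2) by (simp add: field_simps)
    also have "\<dots> \<le> 2 * (C * f t)" using elim(3) by simp
    also have "f t \<le> 2 * Bell k t" using elim(4,5) by (simp add: field_simps)
    finally show ?case using C(1) by (simp add: mult_ac)
  qed
  from eventually_compose_filterlim[OF this a_at]
  have "(\<lambda>n. moment \<Lambda> k n / (moment \<Lambda> 0 n * Bell k (a n))) \<longlonglongrightarrow> 1"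
    by (rule moment_ratio)
  moreover have "(\<lambda>n. Bell k (a n) / f (a n)) \<longlonglongrightarrow> 1" by (rule filterlim_compose[OF f a_at])
  ultimately have "(\<lambda>n. moment \<Lambda> k n / (moment \<Lambda> 0 n * Bell k (a n)) * (Bell k (a n) / f (a n))) \<longlonglongrightarrow> 1 * 1"
    by (rule tendsto_mult)
  then have "(\<lambda>n. moment \<Lambda> k n / (moment \<Lambda> 0 n * Bell k (a n)) * (Bell k (a n) / f (a n))) \<longlonglongrightarrow> 1" by simp
  then show ?thesis
  proof (rule Lim_transform_eventually)
    show "\<forall>\<^sub>F n in sequentially. moment \<Lambda> k n / (moment \<Lambda> 0 n * Bell k (a n)) * (Bell k (a n) / f (a n)) =
      moment \<Lambda> k n / (moment \<Lambda> 0 n * f (saddle \<Lambda> n))"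
      using a_eq
    proof eventually_elim
      case (elim n)
      have "Bell k (a n) > 0" by (rule Bell_pos[OF a_pos])
      then show ?case by (simp flip: elim)
    qed
  qed
qed

text \<open>When the i-th cumulant has at most the order of t to the power -\<nu> i, homogeneity
  makes the Bell polynomial asymptotic to a pure power, for which doubling is evident.\<close>

lemma moment_scaled:
  assumes \<nu>: "\<nu> > 0"
    and lim: "\<And>i. i \<ge> 1 \<Longrightarrow> ((\<lambda>t. (t powr \<nu>) ^ i * kap (real i - 1) t) \<longlongrightarrow> l i) (at_right 0)"
    and l: "bell_rec l k > 0"
  shows "(\<lambda>n. moment \<Lambda> k n / (moment \<Lambda> 0 n * (bell_rec l k / (saddle \<Lambda> n powr \<nu>) ^ k))) \<longlonglongrightarrow> 1"
proof (rule moment_saddle[where C = "(2 powr \<nu>) ^ k" and f = "\<lambda>t. bell_rec l k / (t powr \<nu>) ^ k"])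
  have ev: "\<forall>\<^sub>F t in at_right (0::real). t > 0" by (rule eventually_at_right_less)
  have "((\<lambda>t. bell_rec (\<lambda>i. (t powr \<nu>) ^ i * kap (real i - 1) t) k) \<longlongrightarrow> bell_rec l k) (at_right 0)"
    by (rule bell_rec_tendsto[OF lim])
  then have "((\<lambda>t. (t powr \<nu>) ^ k * bell_rec (\<lambda>i. kap (real i - 1) t) k / bell_rec l k) \<longlongrightarrow> bell_rec l k / bell_rec l k) (at_right 0)"
    unfolding bell_rec_scale using l by (intro tendsto_divide tendsto_const) auto
  then show "((\<lambda>t. bell_rec (\<lambda>i. kap (real i - 1) t) k / (bell_rec l k / (t powr \<nu>) ^ k)) \<longlongrightarrow> 1) (at_right 0)"
    using l by (simp add: mult.commute)
  show "\<forall>\<^sub>F t in at_right 0. bell_rec l k / (t powr \<nu>) ^ k > 0"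
    using ev by eventually_elim (use l in simp)
  show "\<forall>\<^sub>F t in at_right 0. bell_rec l k / ((t / 2) powr \<nu>) ^ k \<le> (2 powr \<nu>) ^ k * (bell_rec l k / (t powr \<nu>) ^ k)"
    using ev by eventually_elim (simp add: powr_divide power_divide mult.commute)
qed simp

end

section \<open>The three cases\<close>

context admissible_seq
begin

abbreviation mom_int :: "nat \<Rightarrow> real" where
  "mom_int j \<equiv> (LINT u:{0<..}|lborel. u powr (real j - 1) * \<theta> u)"

lemma kap_lim_int:
  assumes "real j > - i 0"
  shows "((\<lambda>t. t ^ j * kap (real j - 1) t) \<longlongrightarrow> mom_int j) (at_right 0)"
proof (rule Lim_transform_eventually)
  show "((\<lambda>t. t powr (real j - 1 + 1) * kap (real j - 1) t) \<longlongrightarrow> mom_int j) (at_right 0)"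
    using assms by (intro kap_lim_large) auto
  show "\<forall>\<^sub>F t in at_right 0. t powr (real j - 1 + 1) * kap (real j - 1) t = t ^ j * kap (real j - 1) t"
    using eventually_at_right_less[of 0] by eventually_elim (simp add: powr_realpow)
qed

text \<open>Positivity is read off the Dirichlet series, whose terms are positive.\<close>

lemma mom_int_pos:
  assumes "real j > - i 0"
  shows "mom_int j > 0"
proof -
  have "(\<lambda>n. of_nat (\<Lambda> n) powr (- of_nat j)) sums zeta \<Lambda> (of_nat j)"
    using assms by (intro zeta_sums) simp
  from sums_Re[OF this] have s: "(\<lambda>n. Re (of_nat (\<Lambda> n) powr (- of_nat j))) sums Re (zeta \<Lambda> (of_nat j))" .
  have "Re (of_nat (\<Lambda> n) powr (- of_nat j)) > 0" for n
    using pos[of n] powr_of_real[of "real (\<Lambda> n)" "- real j"] by simp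
  then have "Re (zeta \<Lambda> (of_nat j)) > 0"
    using suminf_pos[OF sums_summable[OF s]] sums_unique[OF s] by simp
  moreover have "fact (j - 1) * Re (zeta \<Lambda> (of_nat j)) = mom_int j"
  proof -
    have "Re (of_real (fact (j - 1)) * zeta \<Lambda> (of_nat j)) = mom_int j"
      using zeta_of_nat[OF assms] by simp
    then show ?thesis by (simp only: times_complex.sel Re_complex_of_real Im_complex_of_real)
  qed
  ultimately show ?thesis by (metis fact_gt_zero mult_pos_pos)
qed

lemma moment_lt1:
  assumes "- i 0 < 1"
  shows "(\<lambda>n. moment \<Lambda> k n / (moment \<Lambda> 0 n * (saddle \<Lambda> n powr (- real k) * bell_rec mom_int k))) \<longlonglongrightarrow> 1"
proof -
  have "(\<lambda>n. moment \<Lambda> k n / (moment \<Lambda> 0 n * (bell_rec mom_int k / (saddle \<Lambda> n powr 1) ^ k))) \<longlonglongrightarrow> 1"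
  proof (rule moment_scaled)
    fix j :: nat assume j: "j \<ge> 1"
    show "((\<lambda>t. (t powr 1) ^ j * kap (real j - 1) t) \<longlongrightarrow> mom_int j) (at_right 0)"
    proof (rule Lim_transform_eventually[OF kap_lim_int])
      show "\<forall>\<^sub>F t in at_right 0. t ^ j * kap (real j - 1) t = (t powr 1) ^ j * kap (real j - 1) t"
        using eventually_at_right_less[of 0] by eventually_elim simp
    qed (use assms j in simp)
  next
    show "bell_rec mom_int k > 0" by (intro bell_rec_pos mom_int_pos) (use assms in simp)
  qed simp
  then show ?thesis
  proof (rule Lim_transform_eventually)
    show "\<forall>\<^sub>F n in sequentially. moment \<Lambda> k n / (moment \<Lambda> 0 n * (bell_rec mom_int k / (saddle \<Lambda> n powr 1) ^ k)) =
      moment \<Lambda> k n / (moment \<Lambda> 0 n * (saddle \<Lambda> n powr (- real k) * bell_rec mom_int k))"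
      using eventually_gt_at_top[of 0]
    proof eventually_elim
      case (elim n)
      have "b / (saddle \<Lambda> n powr 1) ^ k = saddle \<Lambda> n powr (- real k) * b" for b
        using saddle(1)[OF elim] by (simp add: powr_minus powr_realpow divide_inverse mult.commute)
      then show ?case by (simp only:)
    qed
  qed
qed

text \<open>With the scale \<nu> = -\<open>i 0\<close> only the first cumulant has a nonzero limit,
  so the Bell polynomial collapses to its k-th power.\<close>

lemma moment_gt1:
  assumes m: "- i 0 > 1"
  defines "Z \<equiv> (\<Sum>r. real (Suc r) powr i 0)"
  shows "(\<lambda>n. moment \<Lambda> k n / (moment \<Lambda> 0 n * (saddle \<Lambda> n powr (i 0 * real k) * (A (i 0) * Z) ^ k))) \<longlonglongrightarrow> 1"
proof -
  let ?l = "\<lambda>j::nat. if j = 1 then A (i 0) * Z else 0"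
  have Z: "Z > 0" unfolding Z_def using m by (intro suminf_pos summable_Suc_powr) auto
  have "(\<lambda>n. moment \<Lambda> k n / (moment \<Lambda> 0 n * (bell_rec ?l k / (saddle \<Lambda> n powr (- i 0)) ^ k))) \<longlonglongrightarrow> 1"
  proof (rule moment_scaled)
    fix j :: nat assume j: "j \<ge> 1"
    show "((\<lambda>t. (t powr (- i 0)) ^ j * kap (real j - 1) t) \<longlongrightarrow> ?l j) (at_right 0)"
    proof (cases "j = 1")
      case True
      show ?thesis using kap_lim_small[of 0] m by (simp add: True Z_def)
    next
      case False
      have "((\<lambda>t. t powr ((real j - 1 + 1) * (- i 0)) * kap (real j - 1) t) \<longlongrightarrow> 0) (at_right 0)"
        using False j m by (intro kap_lim_mid) auto
      then have "((\<lambda>t. (t powr (- i 0)) ^ j * kap (real j - 1) t) \<longlongrightarrow> 0) (at_right 0)"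
      proof (rule Lim_transform_eventually)
        show "\<forall>\<^sub>F t in at_right 0. t powr ((real j - 1 + 1) * (- i 0)) * kap (real j - 1) t = (t powr (- i 0)) ^ j * kap (real j - 1) t"
          using eventually_at_right_less[of 0]
          by eventually_elim (simp add: powr_powr mult.commute flip: powr_realpow)
      qed
      with False show ?thesis by simp
    qed
  next
    show "bell_rec ?l k > 0" unfolding bell_rec_single using Z A_0_pos by simp
  qed (use m in simp)
  then show ?thesis unfolding bell_rec_single
  proof (rule Lim_transform_eventually)
    show "\<forall>\<^sub>F n in sequentially. moment \<Lambda> k n / (moment \<Lambda> 0 n * ((A (i 0) * Z) ^ k / (saddle \<Lambda> n powr (- i 0)) ^ k)) =
      moment \<Lambda> k n / (moment \<Lambda> 0 n * (saddle \<Lambda> n powr (i 0 * real k) * (A (i 0) * Z) ^ k))"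
      using eventually_gt_at_top[of 0]
    proof eventually_elim
      case (elim n)
      have "(saddle \<Lambda> n powr (- i 0)) ^ k = saddle \<Lambda> n powr (- i 0 * real k)"
        using saddle(1)[OF elim] by (simp add: powr_powr flip: powr_realpow)
      then have "x / (saddle \<Lambda> n powr (- i 0)) ^ k = saddle \<Lambda> n powr (i 0 * real k) * x" for x
        by (simp add: powr_minus divide_inverse mult.commute)
      then show ?case by simp
    qed
  qed
qed

text \<open>Here the first argument of the Bell polynomial tends to infinity, so that the power of it
  dominates.\<close>

lemma moment_eq1:
  assumes i0: "i 0 = - 1"
  defines "FP \<equiv> (LINT u:{0<..}|lborel. \<theta> u - A (i 0) * exp (- u) / u)"
  shows "(\<lambda>n. moment \<Lambda> k n / (moment \<Lambda> 0 n * (saddle \<Lambda> n powr (- real k) *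
    bell_rec (\<lambda>j. if j = 1 then FP - A (i 0) * ln (saddle \<Lambda> n) else mom_int j) k))) \<longlonglongrightarrow> 1"
proof -
  have i1: "i 1 > - 1" using i_mono i0 by (metis strict_monoD zero_less_one)
  define y where "y t = FP - A (i 0) * ln t" for t
  \<comment> \<open>The gap between the first two exponents, capped because
    \<open>kap_lim_log\<close> demands \<eta> < 1.\<close>
  define \<eta> where "\<eta> = min (i 1 + 1) (1 / 2)"
  have eta: "0 < \<eta>" "\<eta> < 1" using i1 by (auto simp: \<eta>_def)
  obtain C where C: "C > 0" "\<And>t. t > 0 \<Longrightarrow> \<bar>G 1 t\<bar> \<le> C * t powr i 1 * exp (- (t / 2))"
    using G_bound by blast
  have "\<bar>\<theta> u - A (i 0) / u\<bar> \<le> (C + \<bar>A (i 1)\<bar>) * u powr (\<eta> - 1)" if u: "0 < u" "u \<le> 1" for u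
  proof -
    have "\<theta> u - A (i 0) / u = G 1 u + A (i 1) * u powr i 1"
      using u i0 by (simp add: G_def powr_minus divide_inverse)
    also have "\<bar>\<dots>\<bar> \<le> \<bar>G 1 u\<bar> + \<bar>A (i 1) * u powr i 1\<bar>" by (rule abs_triangle_ineq)
    also have "\<dots> \<le> C * u powr i 1 * 1 + \<bar>A (i 1)\<bar> * u powr i 1"
    proof (rule add_mono)
      have "C * u powr i 1 * exp (- (u / 2)) \<le> C * u powr i 1 * 1"
        using u C(1) by (intro mult_left_mono) auto
      with C(2)[OF u(1)] show "\<bar>G 1 u\<bar> \<le> C * u powr i 1 * 1" by linarith
    qed (simp add: abs_mult)
    also have "\<dots> = (C + \<bar>A (i 1)\<bar>) * u powr i 1" by (simp add: distrib_right)
    also have "\<dots> \<le> (C + \<bar>A (i 1)\<bar>) * u powr (\<eta> - 1)"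
      using u C(1) powr_mono'[of "\<eta> - 1" "i 1" u] by (intro mult_left_mono) (auto simp: \<eta>_def)
    finally show ?thesis .
  qed
  then have lim1: "((\<lambda>t. t * kap 0 t + A (i 0) * ln t) \<longlongrightarrow> FP) (at_right 0)"
    unfolding FP_def using i0 eta by (intro kap_lim_log) auto
  have y_top: "filterlim y at_top (at_right 0)"
    unfolding y_def using A_0_pos by real_asymp
  have ev: "\<forall>\<^sub>F t in at_right (0::real). t > 0" by (rule eventually_at_right_less)
  have y_pos: "\<forall>\<^sub>F t in at_right 0. y t > 0" using y_top by (auto simp: filterlim_at_top_dense)
  have "((\<lambda>t. 1 + (t * kap 0 t + A (i 0) * ln t - FP) * inverse (y t)) \<longlongrightarrow> 1 + (FP - FP) * 0) (at_right 0)"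
    by (intro tendsto_intros lim1 tendsto_inverse_0_at_top[OF y_top])
  then have "((\<lambda>t. 1 + (t * kap 0 t + A (i 0) * ln t - FP) * inverse (y t)) \<longlongrightarrow> 1) (at_right 0)" by simp
  then have ratio: "((\<lambda>t. t * kap 0 t / y t) \<longlongrightarrow> 1) (at_right 0)"
  proof (rule Lim_transform_eventually)
    show "\<forall>\<^sub>F t in at_right 0. 1 + (t * kap 0 t + A (i 0) * ln t - FP) * inverse (y t) = t * kap 0 t / y t"
      using y_pos
    proof eventually_elim
      case (elim t)
      have "t * kap 0 t + A (i 0) * ln t - FP = t * kap 0 t - y t" by (simp add: y_def)
      with elim show ?case by (simp add: field_simps)
    qed
  qed
  have x_top: "filterlim (\<lambda>t. t * kap 0 t) at_top (at_right 0)"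
  proof (rule filterlim_at_top_mono)
    show "filterlim (\<lambda>t. y t - 1) at_top (at_right 0)"
      unfolding y_def using A_0_pos by real_asymp
    have "\<forall>\<^sub>F t in at_right 0. t * kap 0 t + A (i 0) * ln t > FP - 1"
      by (rule order_tendstoD[OF lim1]) simp
    then show "\<forall>\<^sub>F t in at_right 0. y t - 1 \<le> t * kap 0 t"
      by eventually_elim (simp add: y_def)
  qed
  have B1: "((\<lambda>t. bell_rec (\<lambda>j. t ^ j * kap (real j - 1) t) k / (t * kap 0 t) ^ k) \<longlongrightarrow> 1) (at_right 0)"
    using bell_rec_dominant[where f = "\<lambda>t j. t ^ j * kap (real j - 1) t" and l = mom_int and F = "at_right 0" and k = k]
      x_top kap_lim_int i0 by simp
  have B2: "((\<lambda>t. bell_rec (\<lambda>j. if j = 1 then y t else mom_int j) k / y t ^ k) \<longlongrightarrow> 1) (at_right 0)"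
    using bell_rec_dominant[where f = "\<lambda>t j. if j = 1 then y t else mom_int j" and l = mom_int and F = "at_right 0" and k = k]
      y_top by simp
  have M: "(\<lambda>n. moment \<Lambda> k n / (moment \<Lambda> 0 n * (y (saddle \<Lambda> n) / saddle \<Lambda> n) ^ k)) \<longlonglongrightarrow> 1"
  \<comment> \<open>The 4 is a 2 from halving the denominator times a 2 from y(t / 2) \<le> 2 y(t),
    valid once y exceeds the increment \<open>A (i 0) * ln 2\<close>.\<close>
  proof (rule moment_saddle[where C = "4 ^ k" and f = "\<lambda>t. (y t / t) ^ k"])
    have "((\<lambda>t. bell_rec (\<lambda>j. t ^ j * kap (real j - 1) t) k / (t * kap 0 t) ^ k * (t * kap 0 t / y t) ^ k) \<longlongrightarrow> 1 * 1 ^ k) (at_right 0)"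
      by (intro tendsto_mult tendsto_power B1 ratio)
    then have "((\<lambda>t. bell_rec (\<lambda>j. t ^ j * kap (real j - 1) t) k / (t * kap 0 t) ^ k * (t * kap 0 t / y t) ^ k) \<longlongrightarrow> 1) (at_right 0)"
      by simp
    then show "((\<lambda>t. bell_rec (\<lambda>j. kap (real j - 1) t) k / (y t / t) ^ k) \<longlongrightarrow> 1) (at_right 0)"
    proof (rule Lim_transform_eventually)
      show "\<forall>\<^sub>F t in at_right 0. bell_rec (\<lambda>j. t ^ j * kap (real j - 1) t) k / (t * kap 0 t) ^ k * (t * kap 0 t / y t) ^ k =
        bell_rec (\<lambda>j. kap (real j - 1) t) k / (y t / t) ^ k"
        using ev
      proof eventually_elim
        case (elim t)
        have "kap 0 t > 0" by (rule kap_pos[OF elim])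
        with elim show ?case unfolding bell_rec_scale by (simp add: power_divide mult.commute)
      qed
    qed
    show "\<forall>\<^sub>F t in at_right 0. (y t / t) ^ k > 0"
      using ev y_pos by eventually_elim simp
    have "\<forall>\<^sub>F t in at_right 0. y t > A (i 0) * ln 2" using y_top by (auto simp: filterlim_at_top_dense)
    then show "\<forall>\<^sub>F t in at_right 0. (y (t / 2) / (t / 2)) ^ k \<le> 4 ^ k * (y t / t) ^ k"
      using ev y_pos
    proof eventually_elim
      case (elim t)
      have "y (t / 2) = y t + A (i 0) * ln 2"
        using elim(2) by (simp add: y_def ln_div right_diff_distrib)
      moreover have "A (i 0) * ln 2 > 0" using A_0_pos by simp
      ultimately have *: "0 \<le> y (t / 2)" "y (t / 2) \<le> 2 * y t" using elim by auto
      have "y (t / 2) / (t / 2) \<le> 4 * (y t / t)"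
        using *(2) elim(2) by (simp add: field_simps)
      then have "(y (t / 2) / (t / 2)) ^ k \<le> (4 * (y t / t)) ^ k"
        using *(1) elim(2) by (intro power_mono) auto
      then show ?case by (simp only: power_mult_distrib)
    qed
  qed simp
  \<comment> \<open>The k-th power of y is traded back for the full Bell polynomial in y and the
    integrals, to which it is asymptotic by \<open>B2\<close>.\<close>
  have "(\<lambda>n. moment \<Lambda> k n / (moment \<Lambda> 0 n * (y (saddle \<Lambda> n) / saddle \<Lambda> n) ^ k) /
      (bell_rec (\<lambda>j. if j = 1 then y (saddle \<Lambda> n) else mom_int j) k / y (saddle \<Lambda> n) ^ k)) \<longlonglongrightarrow> 1 / 1"
    by (intro tendsto_divide M filterlim_compose[OF B2 saddle_lim]) simp
  then have "(\<lambda>n. moment \<Lambda> k n / (moment \<Lambda> 0 n * (y (saddle \<Lambda> n) / saddle \<Lambda> n) ^ k) /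
      (bell_rec (\<lambda>j. if j = 1 then y (saddle \<Lambda> n) else mom_int j) k / y (saddle \<Lambda> n) ^ k)) \<longlonglongrightarrow> 1" by simp
  then have "(\<lambda>n. moment \<Lambda> k n / (moment \<Lambda> 0 n * (saddle \<Lambda> n powr (- real k) *
    bell_rec (\<lambda>j. if j = 1 then y (saddle \<Lambda> n) else mom_int j) k))) \<longlonglongrightarrow> 1"
  proof (rule Lim_transform_eventually)
    have "\<forall>\<^sub>F n in sequentially. saddle \<Lambda> n > 0 \<and> y (saddle \<Lambda> n) > 0"
      using eventually_compose_filterlim[OF eventually_conj[OF ev y_pos] saddle_lim] .
    then show "\<forall>\<^sub>F n in sequentially. moment \<Lambda> k n / (moment \<Lambda> 0 n * (y (saddle \<Lambda> n) / saddle \<Lambda> n) ^ k) /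
      (bell_rec (\<lambda>j. if j = 1 then y (saddle \<Lambda> n) else mom_int j) k / y (saddle \<Lambda> n) ^ k) =
      moment \<Lambda> k n / (moment \<Lambda> 0 n * (saddle \<Lambda> n powr (- real k) *
    bell_rec (\<lambda>j. if j = 1 then y (saddle \<Lambda> n) else mom_int j) k))"
    proof eventually_elim
      case (elim n)
      have "m / (m0 * (u / s) ^ k) / (b / u ^ k) = m / (m0 * (inverse (s ^ k) * b))"
        if "s > 0" "u > 0" for m m0 u s b :: real
        using that by (simp add: power_divide field_simps)
      then show ?case using elim by (simp only: powr_minus powr_realpow)
    qed
  qed
  then show ?thesis by (simp only: y_def)
qed

end

lemma asymp_equiv_complexI:
  fixes m m0 f :: "nat \<Rightarrow> real" and g :: "nat \<Rightarrow> complex"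
  assumes lim: "(\<lambda>n. m n / (m0 n * f n)) \<longlonglongrightarrow> 1"
    and g: "\<forall>\<^sub>F n in sequentially. g n = of_real (m0 n * f n)"
  shows "(\<lambda>n. complex_of_real (m n)) \<sim>[at_top] g"
proof (rule asymp_equivI')
  have "(\<lambda>n. complex_of_real (m n / (m0 n * f n))) \<longlonglongrightarrow> of_real 1"
    by (intro tendsto_of_real lim)
  then have "(\<lambda>n. complex_of_real (m n / (m0 n * f n))) \<longlonglongrightarrow> 1" by simp
  then show "(\<lambda>n. complex_of_real (m n) / g n) \<longlonglongrightarrow> 1"
    by (rule Lim_transform_eventually) (use g in \<open>auto elim!: eventually_mono\<close>)
qed

theorem theorem2:
  fixes \<Lambda> :: "nat \<Rightarrow> nat" and i :: "nat \<Rightarrow> real" and A :: "real \<Rightarrow> real"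
    and \<mu>\<^sub>0 :: real and \<alpha> :: "nat \<Rightarrow> real" and k :: nat
  assumes "admissible \<Lambda> i A"
    and "\<mu>\<^sub>0 = - i 0"
    and "\<alpha> = saddle \<Lambda>"
    and "k \<ge> 1"
  shows "(\<mu>\<^sub>0 > 1 \<longrightarrow>
      (\<lambda>n. complex_of_real (moment \<Lambda> k n)) \<sim>[at_top]
      (\<lambda>n. of_real (moment \<Lambda> 0 n) * of_real (\<alpha> n powr (- \<mu>\<^sub>0 * real k)) *
           of_real (A (- \<mu>\<^sub>0)) ^ k * riemann_zeta (of_real \<mu>\<^sub>0) ^ k)) \<and>
    (\<mu>\<^sub>0 = 1 \<longrightarrow>
      (\<lambda>n. complex_of_real (moment \<Lambda> k n)) \<sim>[at_top]
      (\<lambda>n. of_real (moment \<Lambda> 0 n) * of_real (\<alpha> n powr (- real k)) *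
           bell_Y k (\<lambda>j. if j = 1
             then finite_part (zeta \<Lambda>) 1 - of_real (A (- 1) * ln (\<alpha> n))
             else fact (j - 1) * zeta \<Lambda> (of_nat j)))) \<and>
    (\<mu>\<^sub>0 < 1 \<longrightarrow>
      (\<lambda>n. complex_of_real (moment \<Lambda> k n)) \<sim>[at_top]
      (\<lambda>n. of_real (moment \<Lambda> 0 n) * of_real (\<alpha> n powr (- real k)) *
           bell_Y k (\<lambda>j. fact (j - 1) * zeta \<Lambda> (of_nat j))))"
proof -
  interpret admissible_seq \<Lambda> i A
    by unfold_locales (use assms(1) in \<open>auto simp: admissible_def\<close>)
  \<comment> \<open>The arguments are real although typed complex, so the asymptotics can be taken
    from the real recursion.\<close>
  have bell_real: "bell_Y k x = of_real (bell_rec y k)" if "\<And>j. j \<ge> 1 \<Longrightarrow> x j = of_real (y j)" for x y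
    unfolding bell_Y_eq_bell_rec bell_rec_of_real[symmetric] by (rule bell_rec_cong[OF that])
  have gt: "(\<lambda>n. complex_of_real (moment \<Lambda> k n)) \<sim>[at_top]
      (\<lambda>n. of_real (moment \<Lambda> 0 n) * of_real (\<alpha> n powr (- \<mu>\<^sub>0 * real k)) *
           of_real (A (- \<mu>\<^sub>0)) ^ k * riemann_zeta (of_real \<mu>\<^sub>0) ^ k)" if m: "\<mu>\<^sub>0 > 1"
  proof (rule asymp_equiv_complexI[OF moment_gt1], goal_cases)
    case 2
    have "riemann_zeta (of_real \<mu>\<^sub>0) = of_real (\<Sum>r. real (Suc r) powr i 0)"
      using riemann_zeta_real[OF m] assms(2) by simp
    then show ?case using assms(2,3)
      by (intro always_eventually) (simp add: power_mult_distrib mult_ac)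
  qed (use m assms(2) in simp)
  have lt: "(\<lambda>n. complex_of_real (moment \<Lambda> k n)) \<sim>[at_top]
      (\<lambda>n. of_real (moment \<Lambda> 0 n) * of_real (\<alpha> n powr (- real k)) *
           bell_Y k (\<lambda>j. fact (j - 1) * zeta \<Lambda> (of_nat j)))" if m: "\<mu>\<^sub>0 < 1"
  proof (rule asymp_equiv_complexI[OF moment_lt1], goal_cases)
    case 2
    have "bell_Y k (\<lambda>j. fact (j - 1) * zeta \<Lambda> (of_nat j)) = of_real (bell_rec mom_int k)"
      by (intro bell_real zeta_of_nat) (use m assms(2) in auto)
    then show ?case using assms(3) by (intro always_eventually) simp
  qed (use m assms(2) in simp)
  have eq: "(\<lambda>n. complex_of_real (moment \<Lambda> k n)) \<sim>[at_top]
      (\<lambda>n. of_real (moment \<Lambda> 0 n) * of_real (\<alpha> n powr (- real k)) *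
           bell_Y k (\<lambda>j. if j = 1
             then finite_part (zeta \<Lambda>) 1 - of_real (A (- 1) * ln (\<alpha> n))
             else fact (j - 1) * zeta \<Lambda> (of_nat j)))" if m: "\<mu>\<^sub>0 = 1"
  proof -
    have i0: "i 0 = - 1" using m assms(2) by simp
    show ?thesis
    proof (rule asymp_equiv_complexI[OF moment_eq1[OF i0]], rule always_eventually, rule allI)
      fix n
      have "bell_Y k (\<lambda>j. if j = 1
             then finite_part (zeta \<Lambda>) 1 - of_real (A (- 1) * ln (\<alpha> n))
             else fact (j - 1) * zeta \<Lambda> (of_nat j)) =
        of_real (bell_rec (\<lambda>j. if j = 1
             then (LINT u:{0<..}|lborel. \<theta> u - A (i 0) * exp (- u) / u) - A (i 0) * ln (saddle \<Lambda> n)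
             else mom_int j) k)"
      proof (rule bell_real)
        fix j :: nat assume j: "j \<ge> 1"
        show "(if j = 1 then finite_part (zeta \<Lambda>) 1 - of_real (A (- 1) * ln (\<alpha> n))
             else fact (j - 1) * zeta \<Lambda> (of_nat j)) =
          of_real (if j = 1
             then (LINT u:{0<..}|lborel. \<theta> u - A (i 0) * exp (- u) / u) - A (i 0) * ln (saddle \<Lambda> n)
             else mom_int j)"
        proof (cases "j = 1")
          case True
          show ?thesis unfolding if_P[OF True] finite_part_zeta[OF i0] of_real_diff assms(3) by (simp add: i0)
        next
          case False
          with j i0 have "real j > - i 0" by simp
          then show ?thesis unfolding if_not_P[OF False] by (rule zeta_of_nat)
        qed
      qed
      then show "of_real (moment \<Lambda> 0 n) * of_real (\<alpha> n powr (- real k)) *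
           bell_Y k (\<lambda>j. if j = 1
             then finite_part (zeta \<Lambda>) 1 - of_real (A (- 1) * ln (\<alpha> n))
             else fact (j - 1) * zeta \<Lambda> (of_nat j)) =
        of_real (moment \<Lambda> 0 n * (saddle \<Lambda> n powr (- real k) * bell_rec (\<lambda>j. if j = 1
             then (LINT u:{0<..}|lborel. \<theta> u - A (i 0) * exp (- u) / u) - A (i 0) * ln (saddle \<Lambda> n)
             else mom_int j) k))"
        by (simp only: assms(3) of_real_mult mult.assoc)
    qed
  qed
  from gt eq lt show ?thesis by blast
qed

end
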